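(* Let $D\subset\mathbb{R}^{4p}$ be a bounded domain with smooth boundary $\partial D$ and let the function $g$ be quaternionic monogenic in an open neighbourhood of $\overline{D}$. Then for all $\underline{X}\in\overset{\circ}{D}$ one has the two reproducing formulae \begin{align*} g(\underline{X})&=\frac{1}{(-4)^p}\int_{\partial D}\left[E(\underline{v}-\underline{z})\,d\sigma_{\underline{v}}+E^\dagger(\underline{v}-\underline{z})\,d\sigma_{\underline{v}^\dagger}\right]g(\underline{Y}),\\ g(\underline{X})&=\frac{1}{(-4)^p}\int_{\partial D}\left[E^J(\underline{v}-\underline{z})\,d\sigma_{\underline{v}^J}+E^{\dagger J}(\underline{v}-\underline{z})\,d\sigma_{\underline{v}^{\dagger J}}\right]g(\underline{Y}), \end{align*} and the two additional integral identities \begin{align*} \int_{\partial D}\left[E(\underline{v}-\underline{z})\,d\sigma_{\underline{v}^\dagger}+E^\dagger(\underline{v}-\underline{z})\,d\sigma_{\underline{v}}\right]g(\underline{Y})&=0,\\ \int_{\partial D}\left[E^J(\underline{v}-\underline{z})\,d\sigma_{\underline{v}^{\dagger J}}+E^{\dagger J}(\underline{v}-\underline{z})\,d\sigma_{\underline{v}^J}\right]g(\underline{Y})&=0 . \end{align*}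
   Context: Setting: $n=2p$; coordinates on $\mathbb{R}^{4p}$ are $(x_1,y_1,\dots,x_{2p},y_{2p})$; $(e_1,\dots,e_{4p})$ is the standard orthonormal basis, generating the complex Clifford algebra $\mathbb{C}_{4p}$ with $e_\alpha e_\beta+e_\beta e_\alpha=-2\delta_{\alpha\beta}$. Complex coordinates: $z_k=x_k+iy_k$, $z_k^c=x_k-iy_k$; $\partial_{z_k}=\frac12(\partial_{x_k}-i\partial_{y_k})$, $\partial_{z_k^c}=\frac12(\partial_{x_k}+i\partial_{y_k})$. Witt basis: $\mathfrak{f}_k=-\frac12(e_{2k-1}-ie_{2k})$, $\mathfrak{f}_k^\dagger=\frac12(e_{2k-1}+ie_{2k})$, $k=1,\dots,2p$. Spinor space: $\mathbb{S}=\mathbb{C}_{4p}I$ with $I=I_1\cdots I_{2p}$, $I_j=\mathfrak{f}_j\mathfrak{f}_j^\dagger$. Vector variables of a point $\underline{X}$ with complex coordinates $z_k$: $\underline{z}=\sum_{k=1}^{2p}z_k\mathfrak{f}_k$, $\underline{z}^\dagger=\sum_{k=1}^{2p}z_k^c\mathfrak{f}_k^\dagger$, $\underline{z}^J=\sum_{j=1}^p(z_{2j}\mathfrak{f}^\dagger_{2j-1}-z_{2j-1}\mathfrak{f}^\dagger_{2j})$, $\underline{z}^{\dagger J}=\sum_{j=1}^p(z_{2j}^c\mathfrak{f}_{2j-1}-z_{2j-1}^c\mathfrak{f}_{2j})$, $|\underline{z}|^2=\sum_k|z_k|^2$. For $\underline{Y}\in\partial D$ with complex coordinates $v_k$ one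 defines $\underline{v},\underline{v}^\dagger,\underline{v}^J,\underline{v}^{\dagger J}$ in the same way. In the integrals $\underline{X}$ corresponds to $\underline{z}$ and the integration variable $\underline{Y}$ to $\underline{v}$. Operators: $\partial_{\underline{z}}=\sum_{k}\partial_{z_k}\mathfrak{f}_k^\dagger$, $\partial_{\underline{z}}^\dagger=\sum_k\partial_{z_k^c}\mathfrak{f}_k$, $\partial_{\underline{z}}^J=\sum_{j=1}^p(\partial_{z_{2j}}\mathfrak{f}_{2j-1}-\partial_{z_{2j-1}}\mathfrak{f}_{2j})$, $\partial_{\underline{z}}^{\dagger J}=\sum_{j=1}^p(\partial_{z^c_{2j}}\mathfrak{f}^\dagger_{2j-1}-\partial_{z^c_{2j-1}}\mathfrak{f}^\dagger_{2j})$. A continuously differentiable $\mathbb{S}$-valued function $F$ is quaternionic monogenic in an open set if $\partial_{\underline{z}}F=\partial_{\underline{z}}^\dagger F=\partial_{\underline{z}}^JF=\partial_{\underline{z}}^{\dagger J}F=0$ there. Kernels ($a_{4p}$ = area of the unit sphere $S^{4p-1}$): $E(\underline{z})=\frac{2}{a_{4p}}\frac{\underline{z}}{|\underline{z}|^{4p}}$, $E^\dagger(\underline{z})=\frac{2}{a_{4p}}\frac{\underline{z}^\dagger}{|\underline{z}|^{4p}}$, $E^J(\underline{z})=\frac{2}{a_{4p}}\frac{\underline{z}^J}{|\underline{z}|^{4p}}$, $E^{\dagger J}(\underline{z})=\frac{2}{a_{4p}}\frac{\underline{z}^{\dagger J}}{|\underline{z}|^{4p}}$. Differential forms: $\widehat{dz_k}$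 (resp. $\widehat{dz_k^c}$) is the $(4p-1)$-form obtained from $dz_1\wedge dz_1^c\wedge\cdots\wedge dz_{2p}\wedge dz_{2p}^c$ by omitting $dz_k$ (resp. $dz_k^c$), order otherwise kept; $d\sigma_{\underline{z}}=\sum_{k=1}^{2p}\mathfrak{f}_k^\dagger\widehat{dz_k}$, $d\sigma_{\underline{z}^\dagger}=-\sum_{k=1}^{2p}\mathfrak{f}_k\widehat{dz_k^c}$, $d\sigma_{\underline{z}^J}=\sum_{j=1}^p(\mathfrak{f}_{2j-1}\widehat{dz_{2j}}-\mathfrak{f}_{2j}\widehat{dz_{2j-1}})$, $d\sigma_{\underline{z}^{\dagger J}}=-\sum_{j=1}^p(\mathfrak{f}_{2j-1}^\dagger\widehat{dz_{2j}^c}-\mathfrak{f}_{2j}^\dagger\widehat{dz_{2j-1}^c})$; likewise with $\underline{v}$ in place of $\underline{z}$. $\mathbb{R}^{4p}$ is oriented by $dx_1\wedge dy_1\wedge\cdots\wedge dx_{2p}\wedge dy_{2p}$ and $\partial D$ carries the induced boundary orientation. *)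

theory Defs
  imports "HOL-Analysis.Analysis"
begin

text \<open>
  Conventions: \<open>\<real>\<^sup>4\<^sup>p\<close> is \<^typ>\<open>real ^ 'n\<close> with \<open>CARD('n) = 4 * p\<close>. The finite well-ordered
  type \<open>'n\<close> supplies the order of the coordinates; all indices run from 1 as usual, and
  \<open>ix i\<close> is the \<open>i\<close>-th smallest element of \<open>'n\<close>, for \<open>1 \<le> i \<le> CARD('n)\<close>.
\<close>

type_synonym 'n rvec = "real ^ 'n"

definition ix :: "nat \<Rightarrow> 'n::{finite,wellorder}" where
  "ix i = sorted_list_of_set (UNIV :: 'n set) ! (i - 1)"

lemma bij_betw_ix: "bij_betw ix {1..CARD('n)} (UNIV :: 'n::{finite,wellorder} set)"
proof -
  let ?l = "sorted_list_of_set (UNIV :: 'n set)"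
  have "bij_betw ((!) ?l) {..<length ?l} (set ?l)"
    by (rule bij_betw_nth) auto
  hence 1: "bij_betw ((!) ?l) {..<CARD('n)} (UNIV :: 'n set)" by simp
  have 2: "bij_betw (\<lambda>i. i - 1) {1..CARD('n)} {..<CARD('n)}"
    by (rule bij_betw_byWitness[where f' = Suc]) auto
  show ?thesis
    using bij_betw_trans[OF 2 1] by (simp add: o_def ix_def[abs_def])
qed

section \<open>The complex Clifford algebra and spinor space\<close>

text \<open>
  An element is given by its coefficients with respect to the basis of blades
  \<open>e\<^sub>A = e\<^sub>i e\<^sub>j \<dots>\<close>, for \<open>A = {i < j < \<dots>}\<close>. Reordering \<open>e\<^sub>A e\<^sub>B\<close> costs one sign for every pair
  \<open>i \<in> A\<close>, \<open>j \<in> B\<close> with \<open>j < i\<close>, and the rule \<open>e\<^sub>i\<^sup>2 = -1\<close> one sign for every pair with \<open>i = j\<close>.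
  The type is used for its vector space structure, norm and topology; its componentwise
  multiplication \<open>*\<close> is not the Clifford product.
\<close>

type_synonym 'n clifford = "complex ^ ('n set)"

definition blade_sign :: "'n::{finite,wellorder} set \<Rightarrow> 'n set \<Rightarrow> complex" where
  "blade_sign A B = (-1) ^ card {(i, j). i \<in> A \<and> j \<in> B \<and> j \<le> i}"

definition cl_mult :: "'n::{finite,wellorder} clifford \<Rightarrow> 'n clifford \<Rightarrow> 'n clifford"
    (infixl "\<star>" 70) where
  "a \<star> b = (\<Sum>A\<in>UNIV. \<Sum>B\<in>UNIV. (blade_sign A B * a $ A * b $ B) *s axis (sym_diff A B) 1)"

definition cl_one :: "'n::{finite,wellorder} clifford" where
  "cl_one = axis {} 1"

definition cl_e :: "nat \<Rightarrow> 'n::{finite,wellorder} clifford" where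
  "cl_e \<alpha> = axis {ix \<alpha>} 1"

lemma blade_sign_prod:
  "blade_sign A B = (\<Prod>i\<in>A. \<Prod>j\<in>B. if j \<le> i then -1 else 1)"
proof -
  have "(\<Prod>i\<in>A. \<Prod>j\<in>B. if j \<le> i then -1 else (1::complex))
      = (\<Prod>(i,j)\<in>A \<times> B. if j \<le> i then -1 else 1)"
    by (simp add: prod.cartesian_product)
  also have "\<dots> = (\<Prod>(i,j)\<in>{(i, j). i \<in> A \<and> j \<in> B \<and> j \<le> i}. -1)"
    by (rule prod.mono_neutral_cong_right) (auto split: if_splits)
  also have "\<dots> = blade_sign A B"
    by (simp add: blade_sign_def case_prod_beta)
  finally show ?thesis by simp
qed

lemma prod_sym_diff:
  fixes f :: "'n::finite \<Rightarrow> complex"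
  assumes "\<And>i. f i * f i = 1"
  shows "prod f (sym_diff A B) = prod f A * prod f B"
proof -
  have "prod f A = prod f (A - B) * prod f (A \<inter> B)"
    by (subst prod.union_disjoint[symmetric]) (auto intro!: prod.cong)
  moreover have "prod f B = prod f (B - A) * prod f (A \<inter> B)"
    by (subst prod.union_disjoint[symmetric]) (auto intro!: prod.cong)
  moreover have "prod f (sym_diff A B) = prod f (A - B) * prod f (B - A)"
    by (subst prod.union_disjoint[symmetric]) auto
  moreover have "prod f (A \<inter> B) * prod f (A \<inter> B) = 1"
    by (simp add: prod.distrib[symmetric] assms)
  ultimately show ?thesis by (simp add: mult.left_commute mult.assoc)
qed

lemma blade_sign_sym_diff_left:
  "blade_sign (sym_diff A B) C = blade_sign A C * blade_sign B C"
  unfolding blade_sign_prod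
proof (rule prod_sym_diff)
  fix i
  have "(\<Prod>j\<in>C. if j \<le> i then -1 else 1) * (\<Prod>j\<in>C. if j \<le> i then -1 else 1)
      = (\<Prod>j\<in>C. (if j \<le> i then -1 else 1) * (if j \<le> i then -1 else (1::complex)))"
    by (rule prod.distrib[symmetric])
  also have "\<dots> = 1" by (rule prod.neutral) simp
  finally show "(\<Prod>j\<in>C. if j \<le> i then -1 else 1)
      * (\<Prod>j\<in>C. if j \<le> i then -1 else (1::complex)) = 1" .
qed

lemma blade_sign_sym_diff_right:
  "blade_sign A (sym_diff B C) = blade_sign A B * blade_sign A C"
proof -
  have "blade_sign A (sym_diff B C)
      = (\<Prod>i\<in>A. (\<Prod>j\<in>B. if j \<le> i then -1 else 1) * (\<Prod>j\<in>C. if j \<le> i then -1 else 1))"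
    unfolding blade_sign_prod by (intro prod.cong refl prod_sym_diff) simp
  thus ?thesis by (simp add: blade_sign_prod prod.distrib)
qed

lemma cl_mult_nth:
  "(a \<star> b) $ C = (\<Sum>A\<in>UNIV. blade_sign A (sym_diff A C) * a $ A * b $ (sym_diff A C))"
proof -
  have eq: "(C = sym_diff A B) = (B = sym_diff A C)" for A B :: "'a set" by blast
  show ?thesis
    unfolding cl_mult_def
    by (simp add: axis_def eq if_distrib[of "\<lambda>x. _ * x"] cong: if_cong)
qed

lemma cl_mult_assoc: "(a \<star> b) \<star> c = a \<star> (b \<star> c)"
proof (rule vec_eq_iff[THEN iffD2], rule allI)
  fix E :: "'a set"
  have sd: "sym_diff A (sym_diff A C) = C" for A C :: "'a set" by blast
  let ?t = "\<lambda>A B. blade_sign A B * blade_sign A (sym_diff (sym_diff A B) E)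
      * blade_sign B (sym_diff (sym_diff A B) E) * a $ A * b $ B * c $ (sym_diff (sym_diff A B) E)"
  have "((a \<star> b) \<star> c) $ E = (\<Sum>C\<in>UNIV. \<Sum>A\<in>UNIV. blade_sign C (sym_diff C E)
      * (blade_sign A (sym_diff A C) * a $ A * b $ (sym_diff A C)) * c $ (sym_diff C E))"
    by (simp add: cl_mult_nth sum_distrib_left sum_distrib_right)
  also have "\<dots> = (\<Sum>A\<in>UNIV. \<Sum>C\<in>UNIV. blade_sign C (sym_diff C E)
      * (blade_sign A (sym_diff A C) * a $ A * b $ (sym_diff A C)) * c $ (sym_diff C E))"
    by (rule sum.swap)
  also have "\<dots> = (\<Sum>A\<in>UNIV. \<Sum>B\<in>UNIV. ?t A B)"
  proof (rule sum.cong[OF refl])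
    fix A :: "'a set"
    have "bij (sym_diff A)"
      by (rule o_bij[where g = "sym_diff A"]) (simp_all add: sd fun_eq_iff)
    hence "(\<Sum>C\<in>UNIV. blade_sign C (sym_diff C E)
        * (blade_sign A (sym_diff A C) * a $ A * b $ (sym_diff A C)) * c $ (sym_diff C E))
      = (\<Sum>B\<in>UNIV. blade_sign (sym_diff A B) (sym_diff (sym_diff A B) E)
        * (blade_sign A (sym_diff A (sym_diff A B)) * a $ A * b $ (sym_diff A (sym_diff A B)))
        * c $ (sym_diff (sym_diff A B) E))"
      by (rule sum.reindex_bij_betw[symmetric])
    also have "\<dots> = (\<Sum>B\<in>UNIV. ?t A B)"
      unfolding sd blade_sign_sym_diff_left by (simp only: mult.assoc mult.commute mult.left_commute)
    finally show "(\<Sum>C\<in>UNIV. blade_sign C (sym_diff C E)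
        * (blade_sign A (sym_diff A C) * a $ A * b $ (sym_diff A C)) * c $ (sym_diff C E))
      = (\<Sum>B\<in>UNIV. ?t A B)" .
  qed
  also have "\<dots> = (a \<star> (b \<star> c)) $ E"
  proof -
    have ac: "q * r * x * (s * y * z) = q * r * s * x * y * z" for q r s x y z :: complex
      by simp
    have e1: "sym_diff B (sym_diff A E) = sym_diff (sym_diff A B) E" for A B :: "'a set" by blast
    have e2: "blade_sign A (sym_diff A E)
        = blade_sign A B * blade_sign A (sym_diff (sym_diff A B) E)" for A B :: "'a set"
    proof -
      have "sym_diff A E = sym_diff B (sym_diff (sym_diff A B) E)" by blast
      thus ?thesis by (metis blade_sign_sym_diff_right)
    qed
    have "(a \<star> (b \<star> c)) $ E = (\<Sum>A\<in>UNIV. \<Sum>B\<in>UNIV. blade_sign A (sym_diff A E) * a $ A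
        * (blade_sign B (sym_diff B (sym_diff A E)) * b $ B * c $ (sym_diff B (sym_diff A E))))"
      by (simp add: cl_mult_nth sum_distrib_left)
    also have "\<dots> = (\<Sum>A\<in>UNIV. \<Sum>B\<in>UNIV. ?t A B)"
    proof (intro sum.cong refl)
      fix A B :: "'a set"
      show "blade_sign A (sym_diff A E) * a $ A * (blade_sign B (sym_diff B (sym_diff A E)) * b $ B
          * c $ (sym_diff B (sym_diff A E))) = ?t A B"
        unfolding e1 e2[of A B] by (rule ac)
    qed
    finally show ?thesis by simp
  qed
  finally show "((a \<star> b) \<star> c) $ E = (a \<star> (b \<star> c)) $ E" .
qed

lemma axis_cl_mult_nth: "(axis A 1 \<star> b) $ C = blade_sign A (sym_diff A C) * b $ (sym_diff A C)"
  unfolding cl_mult_nth by (subst sum.mono_neutral_right[of _ "{A}"]) (auto simp: axis_def)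

lemma cl_mult_axis:
  "axis A 1 \<star> axis B 1 = (blade_sign A B *s axis (sym_diff A B) 1 :: 'n::{finite,wellorder} clifford)"
proof (rule vec_eq_iff[THEN iffD2], rule allI)
  fix C :: "'n set"
  have "(sym_diff A C = B) = (C = sym_diff A B)" by blast
  thus "(axis A 1 \<star> axis B 1) $ C = (blade_sign A B *s axis (sym_diff A B) 1 :: 'n clifford) $ C"
    unfolding axis_cl_mult_nth by (cases "sym_diff A C = B") (simp_all add: axis_def)
qed

lemma cl_one_mult: "cl_one \<star> a = a" "a \<star> cl_one = a"
proof -
  have [simp]: "blade_sign {} B = 1" "blade_sign B {} = 1" for B :: "'a set"
    by (simp_all add: blade_sign_prod)
  show "cl_one \<star> a = a"
    unfolding cl_one_def vec_eq_iff axis_cl_mult_nth by simp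
  show "a \<star> cl_one = a"
    unfolding vec_eq_iff
  proof
    fix C :: "'a set"
    have "axis {} (1::complex) $ sym_diff A C = 0" if "A \<noteq> C" for A
      using that by (auto simp: axis_def)
    thus "(a \<star> cl_one) $ C = a $ C"
      unfolding cl_mult_nth cl_one_def
      by (subst sum.mono_neutral_right[of _ "{C}"]) (simp_all add: axis_def)
  qed
qed

lemma cl_e_anticommute:
  assumes "\<alpha> \<in> {1..CARD('n)}" "\<beta> \<in> {1..CARD('n)}"
  shows "cl_e \<alpha> \<star> cl_e \<beta> + cl_e \<beta> \<star> cl_e \<alpha>
    = ((if \<alpha> = \<beta> then -2 else 0) *s cl_one :: 'n::{finite,wellorder} clifford)"
proof (cases "\<alpha> = \<beta>")
  case True
  have "blade_sign {ix \<beta>} {ix \<beta> :: 'n} = -1" by (simp add: blade_sign_prod)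
  thus ?thesis unfolding cl_e_def cl_mult_axis True
    by (simp add: cl_one_def vec_eq_iff)
next
  case False
  define a b :: 'n where "a = ix \<alpha>" and "b = ix \<beta>"
  have "a \<noteq> b"
    using bij_betw_ix[where 'n = 'n] assms False
    unfolding bij_betw_def inj_on_def a_def b_def by blast
  hence "blade_sign {a} {b} = - blade_sign {b} {a}"
    by (cases a b rule: linorder_cases) (auto simp: blade_sign_prod)
  moreover have "sym_diff {b} {a} = sym_diff {a} {b}" by blast
  ultimately show ?thesis
    using False unfolding cl_e_def cl_mult_axis a_def[symmetric] b_def[symmetric]
    by (simp only: if_False vec_eq_iff) (simp add: algebra_simps)
qed

definition witt_f :: "nat \<Rightarrow> 'n::{finite,wellorder} clifford" where
  "witt_f k = (- 1 / 2) *s (cl_e (2 * k - 1) - \<i> *s cl_e (2 * k))"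

definition witt_fd :: "nat \<Rightarrow> 'n::{finite,wellorder} clifford" where
  "witt_fd k = (1 / 2) *s (cl_e (2 * k - 1) + \<i> *s cl_e (2 * k))"

definition primitive_I :: "nat \<Rightarrow> 'n::{finite,wellorder} clifford" where
  "primitive_I p = foldr (\<star>) (map (\<lambda>j. witt_f j \<star> witt_fd j) [1..<2 * p + 1]) cl_one"

definition spinor_space :: "nat \<Rightarrow> 'n::{finite,wellorder} clifford set" where
  "spinor_space p = {a \<star> primitive_I p | a. True}"

section \<open>Quaternionic monogenic functions\<close>

text \<open>The name suffixes \<open>_d\<close>, \<open>_J\<close>, \<open>_dJ\<close> stand for the superscripts \<open>\<dagger>\<close>, \<open>J\<close>, \<open>\<dagger>J\<close>.\<close>

primrec Ck_on :: "nat \<Rightarrow> ('n::finite rvec \<Rightarrow> 'b::real_normed_vector) \<Rightarrow> 'n rvec set \<Rightarrow> bool" where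
  "Ck_on 0 F U = continuous_on U F"
| "Ck_on (Suc k) F U = ((\<forall>X\<in>U. F differentiable (at X)) \<and>
     (\<forall>i. Ck_on k (\<lambda>X. frechet_derivative F (at X) (axis i 1)) U))"

definition pderiv_at :: "nat \<Rightarrow> ('n::{finite,wellorder} rvec \<Rightarrow> 'b::real_normed_vector) \<Rightarrow> 'n rvec \<Rightarrow> 'b" where
  "pderiv_at i F X = frechet_derivative F (at X) (axis (ix i) 1)"

definition d_z :: "nat \<Rightarrow> ('n::{finite,wellorder} rvec \<Rightarrow> 'n clifford) \<Rightarrow> 'n rvec \<Rightarrow> 'n clifford" where
  "d_z k F X = (1 / 2) *s (pderiv_at (2 * k - 1) F X - \<i> *s pderiv_at (2 * k) F X)"

definition d_zc :: "nat \<Rightarrow> ('n::{finite,wellorder} rvec \<Rightarrow> 'n clifford) \<Rightarrow> 'n rvec \<Rightarrow> 'n clifford" where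
  "d_zc k F X = (1 / 2) *s (pderiv_at (2 * k - 1) F X + \<i> *s pderiv_at (2 * k) F X)"

definition dirac :: "nat \<Rightarrow> ('n::{finite,wellorder} rvec \<Rightarrow> 'n clifford) \<Rightarrow> 'n rvec \<Rightarrow> 'n clifford" where
  "dirac p F X = (\<Sum>k=1..2*p. witt_fd k \<star> d_z k F X)"

definition dirac_d :: "nat \<Rightarrow> ('n::{finite,wellorder} rvec \<Rightarrow> 'n clifford) \<Rightarrow> 'n rvec \<Rightarrow> 'n clifford" where
  "dirac_d p F X = (\<Sum>k=1..2*p. witt_f k \<star> d_zc k F X)"

definition dirac_J :: "nat \<Rightarrow> ('n::{finite,wellorder} rvec \<Rightarrow> 'n clifford) \<Rightarrow> 'n rvec \<Rightarrow> 'n clifford" where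
  "dirac_J p F X =
    (\<Sum>j=1..p. witt_f (2*j-1) \<star> d_z (2*j) F X - witt_f (2*j) \<star> d_z (2*j-1) F X)"

definition dirac_dJ :: "nat \<Rightarrow> ('n::{finite,wellorder} rvec \<Rightarrow> 'n clifford) \<Rightarrow> 'n rvec \<Rightarrow> 'n clifford" where
  "dirac_dJ p F X =
    (\<Sum>j=1..p. witt_fd (2*j-1) \<star> d_zc (2*j) F X - witt_fd (2*j) \<star> d_zc (2*j-1) F X)"

definition quat_monogenic :: "nat \<Rightarrow> 'n::{finite,wellorder} rvec set \<Rightarrow> ('n rvec \<Rightarrow> 'n clifford) \<Rightarrow> bool" where
  "quat_monogenic p U F \<longleftrightarrow> F ` U \<subseteq> spinor_space p \<and> Ck_on 1 F U \<and>
     (\<forall>X\<in>U. dirac p F X = 0 \<and> dirac_d p F X = 0 \<and> dirac_J p F X = 0 \<and> dirac_dJ p F X = 0)"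

section \<open>Vector variables and kernels\<close>

definition zco :: "nat \<Rightarrow> 'n::{finite,wellorder} rvec \<Rightarrow> complex" where
  "zco k X = Complex (X $ ix (2 * k - 1)) (X $ ix (2 * k))"

definition zcco :: "nat \<Rightarrow> 'n::{finite,wellorder} rvec \<Rightarrow> complex" where
  "zcco k X = cnj (zco k X)"

definition vecv :: "nat \<Rightarrow> 'n::{finite,wellorder} rvec \<Rightarrow> 'n clifford" where
  "vecv p X = (\<Sum>k=1..2*p. zco k X *s witt_f k)"

definition vecv_d :: "nat \<Rightarrow> 'n::{finite,wellorder} rvec \<Rightarrow> 'n clifford" where
  "vecv_d p X = (\<Sum>k=1..2*p. zcco k X *s witt_fd k)"

definition vecv_J :: "nat \<Rightarrow> 'n::{finite,wellorder} rvec \<Rightarrow> 'n clifford" where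
  "vecv_J p X = (\<Sum>j=1..p. zco (2*j) X *s witt_fd (2*j-1) - zco (2*j-1) X *s witt_fd (2*j))"

definition vecv_dJ :: "nat \<Rightarrow> 'n::{finite,wellorder} rvec \<Rightarrow> 'n clifford" where
  "vecv_dJ p X = (\<Sum>j=1..p. zcco (2*j) X *s witt_f (2*j-1) - zcco (2*j-1) X *s witt_f (2*j))"

definition znorm :: "nat \<Rightarrow> 'n::{finite,wellorder} rvec \<Rightarrow> real" where
  "znorm p X = sqrt (\<Sum>k=1..2*p. (cmod (zco k X))\<^sup>2)"

text \<open>
  The surface measure of a subset \<open>A\<close> of the unit sphere of \<open>\<real>\<^sup>N\<close> is \<open>N\<close> times the Lebesgue
  measure of the cone \<open>{r x | 0 < r \<le> 1, x \<in> A}\<close> over it.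
\<close>

definition sphere_measure :: "'n::finite rvec set \<Rightarrow> real" where
  "sphere_measure A = real CARD('n) * measure lborel {r *\<^sub>R x | r x. 0 < r \<and> r \<le> 1 \<and> x \<in> A}"

definition kernel_coeff :: "nat \<Rightarrow> 'n::{finite,wellorder} rvec \<Rightarrow> real" where
  "kernel_coeff p X = 2 / sphere_measure (sphere (0 :: 'n rvec) 1) / znorm p X ^ (4 * p)"

definition kerE :: "nat \<Rightarrow> 'n::{finite,wellorder} rvec \<Rightarrow> 'n clifford" where
  "kerE p X = kernel_coeff p X *\<^sub>R vecv p X"

definition kerE_d :: "nat \<Rightarrow> 'n::{finite,wellorder} rvec \<Rightarrow> 'n clifford" where
  "kerE_d p X = kernel_coeff p X *\<^sub>R vecv_d p X"

definition kerE_J :: "nat \<Rightarrow> 'n::{finite,wellorder} rvec \<Rightarrow> 'n clifford" where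
  "kerE_J p X = kernel_coeff p X *\<^sub>R vecv_J p X"

definition kerE_dJ :: "nat \<Rightarrow> 'n::{finite,wellorder} rvec \<Rightarrow> 'n clifford" where
  "kerE_dJ p X = kernel_coeff p X *\<^sub>R vecv_dJ p X"

section \<open>Differential forms\<close>

text \<open>
  A form of degree \<open>m\<close> is evaluated at a list of \<open>m\<close> tangent vectors, with the normalisation
  \<open>(\<theta>\<^sub>1 \<and> \<dots> \<and> \<theta>\<^sub>m) (w\<^sub>1, \<dots>, w\<^sub>m) = det (\<theta>\<^sub>a w\<^sub>b)\<close>. The forms \<open>dz\<^sub>k\<close> and \<open>dz\<^sub>k\<^sup>c\<close> are the linear
  functionals \<open>zco k\<close> and \<open>zcco k\<close> on tangent vectors.
\<close>

definition wedge :: "('v \<Rightarrow> complex) list \<Rightarrow> 'v list \<Rightarrow> complex" where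
  "wedge \<theta>s ws = (\<Sum>\<pi> | \<pi> permutes {..<length \<theta>s}.
     of_int (sign \<pi>) * (\<Prod>a<length \<theta>s. (\<theta>s ! a) (ws ! \<pi> a)))"

definition hat_dz :: "nat \<Rightarrow> nat \<Rightarrow> 'n::{finite,wellorder} rvec list \<Rightarrow> complex" where
  "hat_dz p k = wedge (concat (map (\<lambda>l. if l = k then [zcco l] else [zco l, zcco l]) [1..<2*p+1]))"

definition hat_dzc :: "nat \<Rightarrow> nat \<Rightarrow> 'n::{finite,wellorder} rvec list \<Rightarrow> complex" where
  "hat_dzc p k = wedge (concat (map (\<lambda>l. if l = k then [zco l] else [zco l, zcco l]) [1..<2*p+1]))"

definition dsig :: "nat \<Rightarrow> 'n::{finite,wellorder} rvec list \<Rightarrow> 'n clifford" where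
  "dsig p ws = (\<Sum>k=1..2*p. hat_dz p k ws *s witt_fd k)"

definition dsig_d :: "nat \<Rightarrow> 'n::{finite,wellorder} rvec list \<Rightarrow> 'n clifford" where
  "dsig_d p ws = - (\<Sum>k=1..2*p. hat_dzc p k ws *s witt_f k)"

definition dsig_J :: "nat \<Rightarrow> 'n::{finite,wellorder} rvec list \<Rightarrow> 'n clifford" where
  "dsig_J p ws =
    (\<Sum>j=1..p. hat_dz p (2*j) ws *s witt_f (2*j-1) - hat_dz p (2*j-1) ws *s witt_f (2*j))"

definition dsig_dJ :: "nat \<Rightarrow> 'n::{finite,wellorder} rvec list \<Rightarrow> 'n clifford" where
  "dsig_dJ p ws =
    - (\<Sum>j=1..p. hat_dzc p (2*j) ws *s witt_fd (2*j-1) - hat_dzc p (2*j-1) ws *s witt_fd (2*j))"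

section \<open>Smooth boundaries and integration of forms over them\<close>

text \<open>
  A boundary chart straightens \<open>D\<close> near a boundary point to the half-space \<open>u\<^sub>1 < 0\<close>. Being
  injective with invertible derivative, \<open>\<Phi>\<close> is a diffeomorphism of \<open>V\<close> onto the open set \<open>\<Phi> ` V\<close>.
  It preserves the orientation, which a reflection \<open>u\<^sub>2 \<mapsto> -u\<^sub>2\<close> always achieves in dimension at
  least 2. On \<open>u\<^sub>1 = 0\<close> the vector \<open>\<partial>\<^sub>1 \<Phi>\<close> points out of \<open>D\<close>, so that
  \<open>(\<partial>\<^sub>2 \<Phi>, \<dots>, \<partial>\<^sub>N \<Phi>)\<close> is positive for the induced (outward normal first) orientation of the
  boundary.
\<close>

definition boundary_chart ::
    "'n::{finite,wellorder} rvec set \<Rightarrow> 'n rvec set \<Rightarrow> ('n rvec \<Rightarrow> 'n rvec) \<Rightarrow> bool" where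
  "boundary_chart D V \<Phi> \<longleftrightarrow> open V \<and> inj_on \<Phi> V \<and> (\<forall>k. Ck_on k \<Phi> V) \<and>
     (\<forall>u\<in>V. 0 < det (matrix (frechet_derivative \<Phi> (at u)))) \<and>
     (\<forall>u\<in>V. \<Phi> u \<in> D \<longleftrightarrow> u $ ix 1 < 0) \<and>
     (\<forall>u\<in>V. \<Phi> u \<in> frontier D \<longleftrightarrow> u $ ix 1 = 0)"

definition smooth_boundary :: "'n::{finite,wellorder} rvec set \<Rightarrow> bool" where
  "smooth_boundary D \<longleftrightarrow> (\<forall>P\<in>frontier D. \<exists>V \<Phi>. boundary_chart D V \<Phi> \<and> P \<in> \<Phi> ` V)"

text \<open>
  The integral of a form is defined as usual through a finite partition of unity along the
  boundary, subordinate to boundary charts, and the Lebesgue integral of the pulled back form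
  over the parameters \<open>u\<^sub>2, \<dots>, u\<^sub>N\<close>. It does not depend on the charts and the partition.
\<close>

definition boundary_partition ::
    "'n::{finite,wellorder} rvec set \<Rightarrow>
     ('n rvec set \<times> ('n rvec \<Rightarrow> 'n rvec) \<times> ('n rvec \<Rightarrow> real)) list \<Rightarrow> bool" where
  "boundary_partition D cs \<longleftrightarrow>
     (\<forall>(V, \<Phi>, \<eta>)\<in>set cs. boundary_chart D V \<Phi> \<and> Ck_on 1 \<eta> UNIV \<and> (\<forall>X. 0 \<le> \<eta> X) \<and>
        compact (closure {X. \<eta> X \<noteq> 0}) \<and> closure {X. \<eta> X \<noteq> 0} \<subseteq> \<Phi> ` V) \<and>
     (\<exists>W. open W \<and> frontier D \<subseteq> W \<and> (\<forall>X\<in>W. (\<Sum>(V, \<Phi>, \<eta>)\<leftarrow>cs. \<eta> X) = 1))"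

definition wall_point :: "('n::{finite,wellorder} \<Rightarrow> real) \<Rightarrow> 'n rvec" where
  "wall_point u = (\<chi> i. if i = ix 1 then 0 else u i)"

definition chart_integral ::
    "'n::{finite,wellorder} rvec set \<Rightarrow> ('n rvec \<Rightarrow> 'n rvec) \<Rightarrow>
     ('n rvec \<Rightarrow> 'n rvec list \<Rightarrow> 'b::{banach,second_countable_topology}) \<Rightarrow> 'b" where
  "chart_integral V \<Phi> \<omega> =
     (\<integral>u. indicator V (wall_point u) *\<^sub>R
            \<omega> (\<Phi> (wall_point u)) (map (\<lambda>i. pderiv_at i \<Phi> (wall_point u)) [2..<CARD('n)+1])
      \<partial>(\<Pi>\<^sub>M i\<in>UNIV - {ix 1}. lborel))"

definition boundary_integral ::
    "'n::{finite,wellorder} rvec set \<Rightarrow>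
     ('n rvec \<Rightarrow> 'n rvec list \<Rightarrow> 'b::{banach,second_countable_topology}) \<Rightarrow> 'b" where
  "boundary_integral D \<omega> = (THE J. \<forall>cs. boundary_partition D cs \<longrightarrow>
     (\<Sum>(V, \<Phi>, \<eta>)\<leftarrow>cs. chart_integral V \<Phi> (\<lambda>Y ws. \<eta> Y *\<^sub>R \<omega> Y ws)) = J)"

end

theory Submission
  imports Defs "Jordan_Normal_Form.Determinant"
begin

text \<open>
  All four formulae are instances of one statement. Contracting the boundary forms with a normal
  vector \<open>n\<close> turns \<open>d\<sigma>\<close> of the four types into \<open>(-4)\<^sup>p / 2\<close> times \<open>n\<^sup>\<dagger>\<close>, \<open>n\<close>, \<open>n\<^sup>\<dagger>\<^sup>J\<close>, \<open>n\<^sup>J\<close>, so that each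
  integrand is the flux of a Clifford valued vector field built from linear maps \<open>v, w, c, d\<close> with
  \<open>v(Z) c(Z) + w(Z) d(Z) = \<mu> |Z|\<^sup>2\<close>, where \<open>\<mu> = 1\<close> for the reproducing formulae (the Witt relations)
  and \<open>\<mu> = 0\<close> for the other two (isotropy of the vector variables). This identity alone makes the
  field divergence free away from the pole when \<open>g\<close> is monogenic.

  The boundary integral only sees the field near \<open>\<partial>D\<close>, so the field may be multiplied by a radial
  function \<open>\<sigma>(|Y - X|\<^sup>N)\<close> that vanishes near \<open>X\<close>. The divergence theorem then gives \<open>\<mu>\<close> times the
  average of \<open>g\<close> against \<open>\<sigma>'(|Y - X|\<^sup>N)\<close>, which is as close to \<open>g(X)\<close> as desired. The divergence
  theorem is proved chart by chart; the second derivatives of a chart cancel by the Piola identity.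
\<close>

no_notation vec_index (infixl "$" 100)
no_notation scalar_prod (infix "\<bullet>" 70)
hide_const (open) Determinant.det Matrix.mat Matrix.row Matrix.vec Matrix.transpose_mat
hide_fact (open) Matrix.vec_eq_iff Determinant.det_def Determinant.det_transpose Determinant.det_permute_rows Matrix.row_def

text \<open>\<open>boundary_integral\<close> is a definite description, so its value is known only
  once a partition exists and all partitions give the same sum. Independence and the divergence
  theorem come out of one computation: each sum equals an integral over \<open>D\<close> that
  mentions neither charts nor weights. The field inherits only one derivative from \<open>g\<close>;
  second derivatives fall on the charts alone. The exponent N = \<open>CARD('n)\<close> in the
  radial function makes the powers of the distance cancel: the gradient of \<sigma>(|Y - X|^N) is N
  \<sigma>' |Y - X|^(N-2) (Y - X), the kernel is (2/a) |Y - X|^(-N) times a field with radial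
  contraction \<mu> |Y - X|^2, and a = N V with V the volume of the unit ball. What remains is 2
  \<mu> \<sigma>' / V. Its integral needs no polar coordinates, as |Y - X|^N pushes Lebesgue measure
  forward to V times Lebesgue measure on the half-line. The 2 cancels against the 1/2 in (-4)^p / 2,
  which arises from solving two equations for a conjugate pair dz_k, dz_k^c, while (-4)^p =
  (-2\<i>)^(2p) is the determinant of the passage from dx_k, dy_k to dz_k, dz_k^c.\<close>

type_synonym 'n rmat = "real^'n^'n"
type_synonym 'n cmat = "complex^'n^'n"

section \<open>Partial derivatives and integration over half-spaces\<close>

abbreviation pd :: "'n::finite \<Rightarrow> ('n rvec \<Rightarrow> 'b::real_normed_vector) \<Rightarrow> 'n rvec \<Rightarrow> 'b" where
  "pd i f x \<equiv> frechet_derivative f (at x) (axis i 1)"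

lemma linear_eq_sum_axis:
  fixes L :: "real^'n::finite \<Rightarrow> 'b::real_vector"
  assumes "linear L"
  shows "L x = (\<Sum>i\<in>UNIV. x $ i *\<^sub>R L (axis i 1))"
proof -
  have "x = (\<Sum>i\<in>UNIV. x $ i *\<^sub>R axis i 1)"
    by (simp add: vec_eq_iff axis_def if_distrib cong: if_cong)
  hence "L x = L (\<Sum>i\<in>UNIV. x $ i *\<^sub>R axis i 1)" by (rule arg_cong)
  thus ?thesis by (simp only: linear_sum[OF assms] linear_scale[OF assms])
qed

lemma prod_Basis_vec:
  fixes f :: "real^'n::finite \<Rightarrow> 'b::comm_monoid_mult"
  shows "(\<Prod>b\<in>Basis. f b) = (\<Prod>i\<in>UNIV. f (axis i 1))"
proof -
  have "Basis = range (\<lambda>i. axis i (1::real) :: real^'n)" by (auto simp: Basis_vec_def)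
  moreover have "inj (\<lambda>i. axis i (1::real) :: real^'n)" by (auto intro!: injI simp: axis_eq_axis)
  ultimately show ?thesis by (intro prod.reindex_cong[of "\<lambda>i. axis i 1"]) auto
qed

section \<open>Lebesgue measure on Cartesian space as a product measure\<close>

lemma vec_lambda_measurable_PiM [measurable]:
  "(\<lambda>x. (\<chi> i. x i) :: real^'n::finite) \<in> measurable (\<Pi>\<^sub>M i\<in>(UNIV::'n set). lborel) borel"
proof (rule borel_measurable_euclidean_space[THEN iffD2], rule ballI)
  fix b :: "real^'n" assume "b \<in> Basis"
  then obtain i where "b = axis i 1" by (auto simp: Basis_vec_def)
  thus "(\<lambda>x. ((\<chi> i. x i) :: real^'n) \<bullet> b) \<in> borel_measurable (\<Pi>\<^sub>M i\<in>(UNIV::'n::finite set). lborel)"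
    by (simp add: inner_axis)
qed

text \<open>A Borel measure with the right values on boxes is Lebesgue measure. The product form
  lets Fubini split off a single coordinate, and it matches \<open>chart_integral\<close>, which
  integrates over the same product with the factor of \<open>ix 1\<close> removed.\<close>

lemma lborel_eq_distr_PiM:
  "lborel = distr (\<Pi>\<^sub>M i\<in>(UNIV::'n::finite set). lborel) borel (\<lambda>x. (\<chi> i. x i) :: real^'n)"
proof (rule lborel_eqI)
  interpret product_sigma_finite "\<lambda>_::'n. lborel :: real measure" ..
  fix l u :: "real^'n" assume le: "\<And>b. b \<in> Basis \<Longrightarrow> l \<bullet> b \<le> u \<bullet> b"
  have le': "l $ i \<le> u $ i" for i
    using le[of "axis i 1"] by (simp add: inner_axis)
  have "(\<lambda>x. (\<chi> i. x i) :: real^'n) -` box l u \<inter> space (\<Pi>\<^sub>M i\<in>(UNIV::'n set). lborel)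
     = PiE UNIV (\<lambda>i. {l$i<..<u$i})"
    by (auto simp: space_PiM mem_box_cart PiE_def Pi_def)
  hence "emeasure (distr (\<Pi>\<^sub>M i\<in>(UNIV::'n set). lborel) borel (\<lambda>x. (\<chi> i. x i) :: real^'n)) (box l u)
    = emeasure (\<Pi>\<^sub>M i\<in>(UNIV::'n set). lborel) (PiE UNIV (\<lambda>i. {l$i<..<u$i}))"
    by (simp add: emeasure_distr)
  also have "\<dots> = (\<Prod>i\<in>UNIV. emeasure lborel {l$i<..<u$i})"
    by (rule emeasure_PiM) auto
  also have "\<dots> = (\<Prod>b\<in>Basis. (u - l) \<bullet> b)"
    by (simp add: le' prod_Basis_vec inner_axis prod_ennreal)
  finally show "emeasure (distr (\<Pi>\<^sub>M i\<in>(UNIV::'n set). lborel) borel (\<lambda>x. (\<chi> i. x i) :: real^'n)) (box l u)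
    = (\<Prod>b\<in>Basis. (u - l) \<bullet> b)" .
qed simp

section \<open>C^1 maps, their partial derivatives and integration along lines\<close>

lemma Ck_on_1_has_derivative:
  assumes "Ck_on 1 f S" "x \<in> S"
  shows "(f has_derivative frechet_derivative f (at x)) (at x)"
  using assms unfolding frechet_derivative_works[symmetric] by simp

lemma Ck_on_1_continuous_pd: "Ck_on 1 f S \<Longrightarrow> continuous_on S (pd i f)"
  by simp

lemma Ck_on_1_continuous_on:
  assumes "Ck_on 1 f S" shows "continuous_on S f"
proof (rule continuous_at_imp_continuous_on, rule ballI)
  fix x assume "x \<in> S"
  from has_derivative_continuous[OF Ck_on_1_has_derivative[OF assms this]] show "isCont f x" .
qed

lemma pd_eqI:
  assumes "(f has_derivative f') (at x)"
  shows "pd i f x = f' (axis i 1)"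
  using frechet_derivative_at[OF assms] by simp

lemma pd_eq_0:
  assumes "open S" "x \<in> S" "\<And>y. y \<in> S \<Longrightarrow> f y = 0"
  shows "pd i f x = 0"
proof -
  have "(f has_derivative (\<lambda>_. 0)) (at x)"
    by (rule has_derivative_transform_within_open[OF _ assms(1,2), of "\<lambda>_. 0"]) (auto simp: assms)
  thus ?thesis by (rule pd_eqI)
qed

lemma has_vector_derivative_coordinate_line:
  fixes G :: "real^'n::finite \<Rightarrow> 'b::real_normed_vector"
  assumes "(G has_derivative D) (at (\<chi> i. (x(j := y)) i))"
  shows "((\<lambda>y. G (\<chi> i. (x(j := y)) i)) has_vector_derivative D (axis j 1)) (at y)"
proof -
  have eq: "(\<lambda>y. \<chi> i. (x(j := y)) i) = (\<lambda>y. (\<chi> i. (x(j := 0)) i) + y *\<^sub>R axis j 1)"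
    by (auto simp: vec_eq_iff axis_def)
  have "((\<lambda>y. (\<chi> i. (x(j := y)) i)) has_derivative (\<lambda>t. t *\<^sub>R axis j (1::real))) (at y)"
    by (subst eq) (auto intro!: derivative_eq_intros)
  from has_derivative_compose[OF this assms]
  show ?thesis
    unfolding has_vector_derivative_def
    using linear_scale[OF has_derivative_linear[OF assms]] by (simp del: fun_upd_apply)
qed

text \<open>The fundamental theorem of calculus on [-B, B], respectively [-B, 0], with B beyond the
  support. The value h 0 left over by the half-line later becomes the integrand on the wall.\<close>

lemma
  fixes h :: "real \<Rightarrow> 'b::euclidean_space"
  assumes d: "\<And>y. (h has_vector_derivative h' y) (at y)" and c: "continuous_on UNIV h'"
    and z: "\<And>y. R \<le> \<bar>y\<bar> \<Longrightarrow> h y = 0"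
  shows integral_derivative_compact_support: "(LINT y|lborel. h' y) = 0"
    and integral_derivative_half_line: "(LINT y|lborel. indicator {..<0} y *\<^sub>R h' y) = h 0"
proof -
  have z': "h' y = 0" if "\<bar>y\<bar> > \<bar>R\<bar>" for y
  proof -
    have "(h has_vector_derivative 0) (at y)"
      by (rule has_vector_derivative_transform_within_open[of "\<lambda>_. 0" _ _ "{y. \<bar>y\<bar> > \<bar>R\<bar>}"])
         (use that in \<open>auto intro!: open_Collect_less continuous_intros simp: z\<close>)
    with d[of y] show ?thesis by (rule vector_derivative_unique_at)
  qed
  have [measurable]: "h' \<in> borel_measurable borel"
    by (rule borel_measurable_continuous_onI[OF c])
  define B where "B = \<bar>R\<bar> + 1"
  have B: "B > 0" "B > \<bar>R\<bar>" by (auto simp: B_def)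
  have ftc: "has_bochner_integral lborel (\<lambda>x. indicator {a..b} x *\<^sub>R h' x) (h b - h a)" if "a \<le> b" for a b
    by (rule has_bochner_integral_FTC_Icc[OF that])
       (auto intro: has_vector_derivative_at_within[OF d] continuous_on_subset[OF c])
  have "(LINT y|lborel. h' y) = (LINT y|lborel. indicator {-B..B} y *\<^sub>R h' y)"
    by (rule Bochner_Integration.integral_cong) (use B in \<open>auto simp: indicator_def intro!: z'\<close>)
  also have "\<dots> = h B - h (-B)"
    using ftc[of "-B" B] B by (simp add: has_bochner_integral_integral_eq)
  finally show "(LINT y|lborel. h' y) = 0"
    using B by (simp add: z)
  \<comment> \<open>The open half-line and the closed interval differ in the null set {0} and to the
    left of -B, where \<open>h'\<close> vanishes.\<close>
  have "(LINT y|lborel. indicator {..<0} y *\<^sub>R h' y) = (LINT y|lborel. indicator {-B..0} y *\<^sub>R h' y)"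
  proof (rule integral_cong_AE)
    show "AE y in lborel. indicator {..<0} y *\<^sub>R h' y = indicator {-B..0} y *\<^sub>R h' y"
      using AE_lborel_singleton[of 0]
      by eventually_elim (use B in \<open>auto simp: indicator_def intro!: z'\<close>)
  qed measurable
  also have "\<dots> = h 0 - h (-B)"
    using ftc[of "-B" 0] B by (simp add: has_bochner_integral_integral_eq)
  finally show "(LINT y|lborel. indicator {..<0} y *\<^sub>R h' y) = h 0"
    using B by (simp add: z)
qed

lemma integrable_continuous_bounded_support:
  fixes F :: "'a::euclidean_space \<Rightarrow> 'b::{banach,second_countable_topology}"
  assumes "continuous_on UNIV F" "\<And>u. R \<le> norm u \<Longrightarrow> F u = 0"
  shows "integrable lborel F"
proof -
  have "integrable lborel (\<lambda>x. indicator (cball 0 R) x *\<^sub>R F x)"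
    by (rule borel_integrable_compact) (auto intro: continuous_on_subset[OF assms(1)])
  also have "(\<lambda>x. indicator (cball 0 R) x *\<^sub>R F x) = F"
    by (auto simp: indicator_def fun_eq_iff assms(2))
  finally show ?thesis .
qed

lemma continuous_on_coordinate_line:
  "continuous_on UNIV (\<lambda>y. (\<chi> i. (x(j := y)) i) :: real^'n::finite)"
proof (rule continuous_on_vec_lambda)
  show "continuous_on UNIV (\<lambda>y. (x(j := y)) i)" for i
    by (cases "i = j") (auto intro!: continuous_intros)
qed

text \<open>Fubini with the innermost integration along coordinate \<open>j\<close>. For
  \<open>j = k\<close> the integral over the negative half-line is the value on the wall; otherwise
  the indicator is constant along the line and the inner integral vanishes. Summed over
  \<open>j\<close> this is the divergence theorem of a half-space whose outward normal is the
  positive \<open>k\<close> direction.\<close>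

lemma
  fixes G :: "real^'n::finite \<Rightarrow> 'b::euclidean_space"
  assumes G: "Ck_on 1 G UNIV" and supp: "\<And>u. R \<le> norm u \<Longrightarrow> G u = 0"
  shows integrable_pd: "integrable lborel (pd j G)"
    and integral_pd: "(LINT u|lborel. pd j G u) = 0"
    and integral_pd_half_space: "(LINT u|lborel. indicator {u. u $ k < 0} u *\<^sub>R pd j G u)
      = (if j = k then LINT x|(\<Pi>\<^sub>M i\<in>UNIV - {k}. lborel). G (\<chi> i. if i = k then 0 else x i) else 0)"
proof -
  have supp': "pd j G u = 0" if "\<bar>R\<bar> + 1 \<le> norm u" for u
    by (rule pd_eq_0[of "{u. \<bar>R\<bar> < norm u}"])
       (use that in \<open>auto intro!: open_Collect_less continuous_intros simp: supp\<close>)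
  show int: "integrable lborel (pd j G)"
    by (rule integrable_continuous_bounded_support[OF Ck_on_1_continuous_pd[OF G] supp'])
  let ?e = "\<lambda>x. (\<chi> i. x i) :: real^'n"
  interpret product_sigma_finite "\<lambda>_::'n. lborel :: real measure" ..
  have fub: "(LINT u|lborel. F u) = (LINT x|(\<Pi>\<^sub>M i\<in>UNIV - {j}. lborel). LINT y|lborel. F (?e (x(j := y))))"
    if F: "integrable lborel F" for F :: "real^'n \<Rightarrow> 'b"
  proof -
    have [measurable]: "F \<in> borel_measurable borel"
      using F by auto
    have i: "integrable (\<Pi>\<^sub>M i\<in>UNIV. lborel) (\<lambda>x. F (?e x))"
      using F by (subst (asm) lborel_eq_distr_PiM) (simp add: integrable_distr_eq)
    have "(LINT u|lborel. F u) = (LINT x|(\<Pi>\<^sub>M i\<in>UNIV. lborel). F (?e x))"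
      by (subst lborel_eq_distr_PiM) (simp add: integral_distr)
    also have "\<dots> = (LINT x|(\<Pi>\<^sub>M i\<in>insert j (UNIV - {j}). lborel). F (?e x))"
      by (simp add: insert_absorb)
    also have "\<dots> = (LINT x|(\<Pi>\<^sub>M i\<in>UNIV - {j}. lborel). LINT y|lborel. F (?e (x(j := y))))"
      by (rule product_integral_insert) (use i in \<open>auto simp: insert_absorb\<close>)
    finally show ?thesis .
  qed
  have line: "((\<lambda>y. G (?e (x(j := y)))) has_vector_derivative pd j G (?e (x(j := y)))) (at y)" for x y
    by (rule has_vector_derivative_coordinate_line) (rule Ck_on_1_has_derivative[OF G], simp)
  have cont: "continuous_on UNIV (\<lambda>y. pd j G (?e (x(j := y))))" for x
    by (rule continuous_on_compose2[OF Ck_on_1_continuous_pd[OF G] continuous_on_coordinate_line]) simp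
  have zero: "G (?e (x(j := y))) = 0" if "R \<le> \<bar>y\<bar>" for x y
  proof (rule supp)
    have "\<bar>y\<bar> = \<bar>?e (x(j := y)) $ j\<bar>" by simp
    also have "\<dots> \<le> norm (?e (x(j := y)))" by (rule component_le_norm_cart)
    finally show "R \<le> norm (?e (x(j := y)))" using that by simp
  qed
  have int0: "(LINT y|lborel. pd j G (?e (x(j := y)))) = 0" for x
    by (rule integral_derivative_compact_support[OF line cont zero])
  have int1: "(LINT y|lborel. indicator {..<0} y *\<^sub>R pd j G (?e (x(j := y)))) = G (?e (x(j := 0)))" for x
    by (rule integral_derivative_half_line[OF line cont zero])
  show "(LINT u|lborel. pd j G u) = 0"
    by (simp only: fub[OF int] int0 integral_zero)
  have "integrable lborel (\<lambda>u. indicator {u. u $ k < 0} u *\<^sub>R pd j G u)"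
    by (rule integrable_mult_indicator[OF _ int])
       (auto intro!: borel_open open_Collect_less continuous_intros)
  from fub[OF this] have *: "(LINT u|lborel. indicator {u. u $ k < 0} u *\<^sub>R pd j G u)
    = (LINT x|(\<Pi>\<^sub>M i\<in>UNIV - {j}. lborel). LINT y|lborel. indicator {u. u $ k < 0} (?e (x(j := y))) *\<^sub>R pd j G (?e (x(j := y))))" .
  show "(LINT u|lborel. indicator {u. u $ k < 0} u *\<^sub>R pd j G u)
      = (if j = k then LINT x|(\<Pi>\<^sub>M i\<in>UNIV - {k}. lborel). G (\<chi> i. if i = k then 0 else x i) else 0)"
  proof (cases "j = k")
    case True
    have ind: "indicator {u. u $ k < 0} (?e (x(j := y))) = (indicator {..<0} y :: real)" for x y
      by (auto simp: indicator_def True)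
    have eq: "?e (x(j := 0)) = (\<chi> i. if i = k then 0 else x i)" for x
      by (simp add: True vec_eq_iff)
    show ?thesis unfolding * ind int1 eq by (simp add: True)
  next
    case False
    have ind: "indicator {u. u $ k < 0} (?e (x(j := y))) = (indicator {..<0} (x k) :: real)" for x y
      using False by (auto simp: indicator_def)
    have "(LINT y|lborel. indicator {u. u $ k < 0} (?e (x(j := y))) *\<^sub>R pd j G (?e (x(j := y)))) = 0" for x
      unfolding ind by (simp only: integral_scaleR_right int0 scaleR_zero_right)
    thus ?thesis unfolding * using False by (simp only: integral_zero if_False)
  qed
qed

section \<open>The Piola identity\<close>

lemma has_vector_derivative_line:
  assumes "(G has_derivative D) (at (c + s *\<^sub>R e))"
  shows "((\<lambda>s. G (c + s *\<^sub>R e)) has_vector_derivative D e) (at s)"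
proof -
  have "((\<lambda>s. c + s *\<^sub>R e) has_derivative (\<lambda>t. t *\<^sub>R e)) (at s)"
    by (auto intro!: derivative_eq_intros)
  from has_derivative_compose[OF this assms]
  show ?thesis
    unfolding has_vector_derivative_def
    using linear_scale[OF has_derivative_linear[OF assms]] by simp
qed

lemma Ck_on_2D:
  assumes "Ck_on 2 f V"
  shows "Ck_on 1 f V" "Ck_on 1 (pd i f) V"
proof -
  have *: "(\<forall>x\<in>V. f differentiable (at x)) \<and> (\<forall>i. Ck_on 1 (pd i f) V)"
    using assms unfolding numeral_2_eq_2 One_nat_def by (subst (asm) Ck_on.simps) simp
  thus "Ck_on 1 (pd i f) V" by blast
  have "continuous_on V (pd i f)" for i
    using * Ck_on_1_continuous_on by blast
  with * show "Ck_on 1 f V" by simp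
qed

text \<open>The mean value theorem in direction \<open>i\<close>, applied to the difference along
  two parallel segments, and once more in direction \<open>j\<close>. The second difference is
  symmetric in \<open>i\<close> and \<open>j\<close>, so exchanging the two represents it by the
  mixed derivative in the other order. The bound on \<open>h\<close> keeps the parallelogram inside
  the ball.\<close>

lemma second_difference:
  fixes f :: "real^'n::finite \<Rightarrow> real"
  assumes f: "Ck_on 2 f V" and V: "ball u d \<subseteq> V" and h: "0 < h" "2 * h < d"
  obtains v where "v \<in> ball u d"
    "f (u + h *\<^sub>R axis i 1 + h *\<^sub>R axis j 1) - f (u + h *\<^sub>R axis i 1) - f (u + h *\<^sub>R axis j 1) + f u
      = h * (h * pd j (pd i f) v)"
proof -
  have near: "u + s *\<^sub>R axis i 1 + t *\<^sub>R axis j 1 \<in> ball u d" if "0 \<le> s" "s \<le> h" "0 \<le> t" "t \<le> h" for s t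
  proof -
    have "norm (s *\<^sub>R axis i 1 + t *\<^sub>R axis j (1::real)) \<le> \<bar>s\<bar> + \<bar>t\<bar>"
      by (rule norm_triangle_le) simp
    thus ?thesis using that h by (simp add: dist_norm algebra_simps flip: norm_minus_cancel[of "s *\<^sub>R _ + _"])
  qed
  note nearV = subsetD[OF V near]
  have d1: "((\<lambda>s. f (u + s *\<^sub>R axis i 1 + t *\<^sub>R axis j 1)) has_real_derivative
      pd i f (u + s *\<^sub>R axis i 1 + t *\<^sub>R axis j 1)) (at s)" if "0 \<le> s" "s \<le> h" "0 \<le> t" "t \<le> h" for s t
  proof -
    have "(f has_derivative frechet_derivative f (at (u + t *\<^sub>R axis j 1 + s *\<^sub>R axis i 1))) (at (u + t *\<^sub>R axis j 1 + s *\<^sub>R axis i 1))"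
      by (rule Ck_on_1_has_derivative[OF Ck_on_2D(1)[OF f]]) (use nearV[OF that] in \<open>simp add: add_ac\<close>)
    from has_vector_derivative_line[OF this] show ?thesis
      by (simp add: has_real_derivative_iff_has_vector_derivative add_ac)
  qed
  have d2: "((\<lambda>t. pd i f (u + s *\<^sub>R axis i 1 + t *\<^sub>R axis j 1)) has_real_derivative
      pd j (pd i f) (u + s *\<^sub>R axis i 1 + t *\<^sub>R axis j 1)) (at t)" if "0 \<le> s" "s \<le> h" "0 \<le> t" "t \<le> h" for s t
    unfolding has_real_derivative_iff_has_vector_derivative
    by (rule has_vector_derivative_line, rule Ck_on_1_has_derivative[OF Ck_on_2D(2)[OF f]]) (rule nearV[OF that])
  let ?p = "\<lambda>s t. u + s *\<^sub>R axis i 1 + t *\<^sub>R axis j (1::real)"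
  have "((\<lambda>s. f (?p s h) - f (?p s 0)) has_real_derivative pd i f (?p s h) - pd i f (?p s 0)) (at s)"
    if "0 \<le> s" "s \<le> h" for s
    by (intro DERIV_diff d1) (use that h in auto)
  from MVT2[OF h(1) this]
  obtain s where s: "0 < s" "s < h" and s_eq: "(f (?p h h) - f (?p h 0)) - (f (?p 0 h) - f (?p 0 0))
     = (h - 0) * (pd i f (?p s h) - pd i f (?p s 0))" by auto
  have "((\<lambda>t. pd i f (?p s t)) has_real_derivative pd j (pd i f) (?p s t)) (at t)"
    if "0 \<le> t" "t \<le> h" for t
    by (rule d2) (use that s in auto)
  from MVT2[OF h(1) this]
  obtain t where t: "0 < t" "t < h" and
    t_eq: "pd i f (?p s h) - pd i f (?p s 0) = (h - 0) * pd j (pd i f) (?p s t)" by auto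
  show ?thesis
    by (rule that[of "u + s *\<^sub>R axis i 1 + t *\<^sub>R axis j 1"]) (use s_eq t_eq near s t in auto)
qed

text \<open>Both orders represent the same second difference, at two points \<open>v\<close> and
  \<open>w\<close> of a small ball, and continuity moves both values to \<open>u\<close> with error
  \<open>e\<close>.\<close>

lemma mixed_partials_commute_real:
  fixes f :: "real^'n::finite \<Rightarrow> real"
  assumes f: "Ck_on 2 f V" and V: "open V" "u \<in> V"
  shows "pd i (pd j f) u = pd j (pd i f) u"
proof -
  have c: "isCont (pd k (pd l f)) u" for k l
    using Ck_on_1_continuous_pd[OF Ck_on_2D(2)[OF f]] V by (simp add: continuous_on_eq_continuous_at)
  have le: "dist (pd i (pd j f) u) (pd j (pd i f) u) \<le> e + e" if "e > 0" for e
  proof -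
    obtain d where d: "d > 0" "ball u d \<subseteq> V" using V unfolding open_contains_ball by blast
    obtain d1 where d1: "d1 > 0" "\<forall>v. dist v u < d1 \<longrightarrow> dist (pd i (pd j f) v) (pd i (pd j f) u) < e"
      using c[of j i, unfolded continuous_at_eps_delta, rule_format, OF \<open>e > 0\<close>] by auto
    obtain d2 where d2: "d2 > 0" "\<forall>v. dist v u < d2 \<longrightarrow> dist (pd j (pd i f) v) (pd j (pd i f) u) < e"
      using c[of i j, unfolded continuous_at_eps_delta, rule_format, OF \<open>e > 0\<close>] by auto
    define r where "r = min d (min d1 d2)"
    have r: "r > 0" "r \<le> d" "r \<le> d1" "r \<le> d2" using d d1 d2 by (auto simp: r_def)
    define h where "h = r / 3"
    have h: "h > 0" "2 * h < r" using r by (auto simp: h_def)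
    have V': "ball u r \<subseteq> V" using subset_ball[OF r(2)] d(2) by (rule subset_trans)
    obtain v where v: "v \<in> ball u r" "f (u + h *\<^sub>R axis i 1 + h *\<^sub>R axis j 1) - f (u + h *\<^sub>R axis i 1)
        - f (u + h *\<^sub>R axis j 1) + f u = h * (h * pd j (pd i f) v)"
      by (rule second_difference[OF f V' h])
    obtain w where w: "w \<in> ball u r" "f (u + h *\<^sub>R axis j 1 + h *\<^sub>R axis i 1) - f (u + h *\<^sub>R axis j 1)
        - f (u + h *\<^sub>R axis i 1) + f u = h * (h * pd i (pd j f) w)"
      by (rule second_difference[OF f V' h])
    have "h * (h * pd j (pd i f) v) = h * (h * pd i (pd j f) w)"
    proof -
      have "u + h *\<^sub>R axis j 1 + h *\<^sub>R axis i 1 = u + h *\<^sub>R axis i 1 + h *\<^sub>R axis j 1"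
        by (simp add: add_ac)
      from v(2) w(2)[unfolded this] show ?thesis by linarith
    qed
    hence "pd j (pd i f) v = pd i (pd j f) w" using h by simp
    moreover have "dist (pd j (pd i f) v) (pd j (pd i f) u) < e"
      by (rule d2(2)[rule_format]) (use v(1) r in \<open>simp add: dist_commute\<close>)
    moreover have "dist (pd i (pd j f) w) (pd i (pd j f) u) < e"
      by (rule d1(2)[rule_format]) (use w(1) r in \<open>simp add: dist_commute\<close>)
    ultimately show ?thesis
      using dist_triangle3[of "pd i (pd j f) u" "pd j (pd i f) u" "pd i (pd j f) w"] by simp
  qed
  \<comment> \<open>A quarter of the distance as \<open>e\<close> bounds the distance by half of
    itself.\<close>
  show ?thesis
    using le[of "dist (pd i (pd j f) u) (pd j (pd i f) u) / 4"] by (cases "dist (pd i (pd j f) u) (pd j (pd i f) u) = 0") auto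
qed

lemmas has_derivative_vec_nth = bounded_linear.has_derivative[OF bounded_linear_vec_nth]

lemma pd_nth:
  assumes "Ck_on 1 f V" "x \<in> V"
  shows "pd i (\<lambda>x. f x $ r) x = pd i f x $ r"
  by (rule pd_eqI) (rule has_derivative_vec_nth[OF Ck_on_1_has_derivative[OF assms]])

lemma
  assumes "open V" "x \<in> V" "\<And>y. y \<in> V \<Longrightarrow> f y = g y"
  shows frechet_derivative_cong_open: "frechet_derivative f (at x) = frechet_derivative g (at x)"
    and differentiable_cong_open: "f differentiable (at x) \<longleftrightarrow> g differentiable (at x)"
proof -
  have "(f has_derivative D) (at x) \<longleftrightarrow> (g has_derivative D) (at x)" for D
    using has_derivative_transform_within_open[of f D x UNIV V g]
      has_derivative_transform_within_open[of g D x UNIV V f] assms by auto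
  thus "frechet_derivative f (at x) = frechet_derivative g (at x)"
    "f differentiable (at x) \<longleftrightarrow> g differentiable (at x)"
    unfolding frechet_derivative_def differentiable_def by simp_all
qed

lemma Ck_on_cong_open:
  assumes V: "open V"
  shows "(\<And>y. y \<in> V \<Longrightarrow> f y = g y) \<Longrightarrow> Ck_on k f V \<longleftrightarrow> Ck_on k g V"
proof (induction k arbitrary: f g)
  case 0
  thus ?case by (simp cong: continuous_on_cong)
next
  case (Suc k)
  have "f differentiable (at x) \<longleftrightarrow> g differentiable (at x)" if "x \<in> V" for x
    by (rule differentiable_cong_open[OF V that Suc.prems])
  moreover have "Ck_on k (pd i f) V \<longleftrightarrow> Ck_on k (pd i g) V" for i
    by (rule Suc.IH) (use frechet_derivative_cong_open[OF V _ Suc.prems] in auto)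
  ultimately show ?case by simp
qed

lemma Ck_on_nth:
  fixes f :: "real^'n::finite \<Rightarrow> real^'m::finite"
  assumes V: "open V"
  shows "Ck_on k f V \<Longrightarrow> Ck_on k (\<lambda>x. f x $ r) V"
proof (induction k arbitrary: f)
  case 0
  thus ?case by (auto intro: continuous_on_component)
next
  case (Suc k)
  have d: "(f has_derivative frechet_derivative f (at x)) (at x)" if "x \<in> V" for x
    using Suc.prems that unfolding frechet_derivative_works[symmetric] by simp
  have d': "((\<lambda>x. f x $ r) has_derivative (\<lambda>h. frechet_derivative f (at x) h $ r)) (at x)" if "x \<in> V" for x
    by (rule has_derivative_vec_nth[OF d[OF that]])
  have "Ck_on k (pd i (\<lambda>x. f x $ r)) V" for i
  proof (subst Ck_on_cong_open[OF V])
    show "pd i (\<lambda>x. f x $ r) y = pd i f y $ r" if "y \<in> V" for y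
      by (rule pd_eqI[OF d'[OF that]])
    show "Ck_on k (\<lambda>x. pd i f x $ r) V"
      by (rule Suc.IH) (use Suc.prems in simp)
  qed
  moreover have "(\<lambda>x. f x $ r) differentiable (at x)" if "x \<in> V" for x
    using d'[OF that] unfolding differentiable_def by blast
  ultimately show ?case by simp
qed

lemma mixed_partials_commute:
  fixes f :: "real^'n::finite \<Rightarrow> real^'m::finite"
  assumes f: "Ck_on 2 f V" and V: "open V" "u \<in> V"
  shows "pd i (pd j f) u = pd j (pd i f) u"
proof (rule vec_eq_iff[THEN iffD2], rule allI)
  fix r
  have *: "pd i (pd j f) u $ r = pd i (pd j (\<lambda>x. f x $ r)) u" for i j
  proof -
    have "pd i (pd j f) u $ r = pd i (\<lambda>x. pd j f x $ r) u"
      by (rule pd_nth[OF Ck_on_2D(2)[OF f] V(2), symmetric])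
    also have "\<dots> = pd i (pd j (\<lambda>x. f x $ r)) u"
      by (subst frechet_derivative_cong_open[OF V]) (auto simp: pd_nth[OF Ck_on_2D(1)[OF f]])
    finally show ?thesis .
  qed
  show "pd i (pd j f) u $ r = pd j (pd i f) u $ r"
    unfolding * by (rule mixed_partials_commute_real[OF Ck_on_nth[OF V(1) f] V])
qed

text \<open>With \<open>axis i 1\<close> as the new row the determinant is the cofactor of entry (k,
  i). Rows are used because row \<open>c\<close> of the matrices below is \<partial>_c \<Phi>; the
  Jacobian matrix is the transpose.\<close>

definition replace_row :: "'n \<Rightarrow> 'a^'n \<Rightarrow> 'a^'n^'n \<Rightarrow> 'a^'n^'n" where
  "replace_row k v A = (\<chi> i. if i = k then v else A $ i)"

lemma replace_row_nth: "replace_row k v A $ i = (if i = k then v else A $ i)"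
  by (simp add: replace_row_def)

text \<open>Multilinearity: each Leibniz term is differentiated factor by factor, and the terms that
  differentiate row \<open>i\<close> collect to a determinant with that row replaced by its
  derivative.\<close>

lemma has_derivative_det:
  fixes A :: "'a::real_normed_vector \<Rightarrow> real^'n^'n::finite"
  assumes "\<And>i. ((\<lambda>u. A u $ i) has_derivative A' i) (at x)"
  shows "((\<lambda>u. det (A u)) has_derivative (\<lambda>h. \<Sum>i\<in>UNIV. det (replace_row i (A' i h) (A x)))) (at x)"
proof -
  have d: "((\<lambda>u. A u $ i $ p i) has_derivative (\<lambda>h. A' i h $ p i)) (at x)" for i p
    by (rule has_derivative_vec_nth[OF assms])
  have "(\<Prod>k\<in>UNIV. replace_row i (A' i h) (A x) $ k $ p k) = A' i h $ p i * (\<Prod>k\<in>UNIV - {i}. A x $ k $ p k)" for i h p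
    by (subst prod.remove[of _ i]) (auto simp: replace_row_nth intro!: prod.cong)
  hence eq: "(\<Sum>i\<in>UNIV. det (replace_row i (A' i h) (A x)))
    = (\<Sum>p | p permutes UNIV. of_int (sign p) * (\<Sum>i\<in>UNIV. A' i h $ p i * (\<Prod>k\<in>UNIV - {i}. A x $ k $ p k)))" for h
    unfolding det_def by (subst sum.swap) (simp add: sum_distrib_left)
  show ?thesis
    unfolding eq unfolding det_def
    by (intro has_derivative_sum has_derivative_mult_right has_derivative_prod d)
qed

lemma det_replace_row_swap:
  fixes A :: "real^'n^'n::finite"
  assumes "j \<noteq> l"
  shows "det (replace_row l w (replace_row j v A)) = - det (replace_row j w (replace_row l v A))"
proof -
  let ?B = "replace_row j w (replace_row l v A)" and ?p = "Transposition.transpose j l"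
  have "replace_row l w (replace_row j v A) = (\<chi> i. ?B $ ?p i)"
    using assms by (auto simp: vec_eq_iff replace_row_nth Transposition.transpose_def)
  also have "det \<dots> = of_int (sign ?p) * det ?B"
    by (rule det_permute_rows) (simp add: permutes_swap_id)
  finally show ?thesis using assms by (simp add: sign_swap_id)
qed

lemma det_replace_row_zero: "det (replace_row k 0 A) = (0 :: real)"
  by (rule det_zero_row(1)[of k]) (simp add: replace_row_nth row_def vec_eq_iff)

lemma has_derivative_det_replace_row:
  fixes A :: "'a::real_normed_vector \<Rightarrow> real^'n^'n::finite"
  assumes "\<And>i. ((\<lambda>u. A u $ i) has_derivative A' i) (at x)"
  shows "((\<lambda>u. det (replace_row j v (A u))) has_derivative
    (\<lambda>h. \<Sum>l\<in>UNIV - {j}. det (replace_row l (A' l h) (replace_row j v (A x))))) (at x)"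
proof -
  have "((\<lambda>u. replace_row j v (A u) $ i) has_derivative (if i = j then \<lambda>_. 0 else A' i)) (at x)" for i
    using assms by (simp add: replace_row_nth)
  from has_derivative_det[OF this]
  have *: "((\<lambda>u. det (replace_row j v (A u))) has_derivative
    (\<lambda>h. \<Sum>l\<in>UNIV. det (replace_row l ((if l = j then \<lambda>_. 0 else A' l) h) (replace_row j v (A x))))) (at x)" .
  have "(\<Sum>l\<in>UNIV. det (replace_row l ((if l = j then \<lambda>_. 0 else A' l) h) (replace_row j v (A x))))
     = (\<Sum>l\<in>UNIV - {j}. det (replace_row l (A' l h) (replace_row j v (A x))))" for h
    by (subst sum.remove[of _ j]) (simp_all add: det_replace_row_zero)
  with * show ?thesis by simp
qed

text \<open>Differentiating by rows leaves determinants with \<open>v\<close> in row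
  \<open>j\<close> and a second derivative of \<Phi> in row \<open>l\<close>. Under exchange of
  \<open>j\<close> and \<open>l\<close> two rows are swapped while the mixed derivative stays the
  same, so the double sum equals its own negative.\<close>

lemma Piola_identity:
  fixes \<Phi> :: "real^'n::finite \<Rightarrow> real^'n"
  assumes \<Phi>: "Ck_on 2 \<Phi> V" and V: "open V" "u \<in> V"
  shows "(\<Sum>j\<in>UNIV. pd j (\<lambda>u. det (replace_row j v (\<chi> c. pd c \<Phi> u))) u) = 0"
proof -
  let ?A = "\<lambda>u. \<chi> c. pd c \<Phi> u"
  let ?T = "\<lambda>j l. det (replace_row l (pd j (pd l \<Phi>) u) (replace_row j v (?A u)))"
  have "((\<lambda>u. ?A u $ i) has_derivative frechet_derivative (pd i \<Phi>) (at u)) (at u)" for i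
    using Ck_on_1_has_derivative[OF Ck_on_2D(2)[OF \<Phi>] V(2)] by simp
  from has_derivative_det_replace_row[OF this]
  have "pd j (\<lambda>u. det (replace_row j v (?A u))) u = (\<Sum>l\<in>UNIV - {j}. ?T j l)" for j
    by (rule pd_eqI)
  also have "\<dots> j = (\<Sum>l\<in>UNIV. if l = j then 0 else ?T j l)" for j
    by (rule sum.mono_neutral_cong_left) auto
  finally have *: "(\<Sum>j\<in>UNIV. pd j (\<lambda>u. det (replace_row j v (?A u))) u) =
    (\<Sum>j\<in>UNIV. \<Sum>l\<in>UNIV. if l = j then 0 else ?T j l)" (is "_ = ?S") by simp
  have "?S = (\<Sum>l\<in>UNIV. \<Sum>j\<in>UNIV. if l = j then 0 else ?T j l)" by (rule sum.swap)
  also have "\<dots> = (\<Sum>l\<in>UNIV. \<Sum>j\<in>UNIV. - (if j = l then 0 else ?T l j))"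
  proof (intro sum.cong refl)
    fix l j
    show "(if l = j then 0 else ?T j l) = - (if j = l then 0 else ?T l j)"
      using det_replace_row_swap[of j l "pd j (pd l \<Phi>) u" v "?A u"] mixed_partials_commute[OF \<Phi> V, of j l]
      by auto
  qed
  also have "\<dots> = - ?S" by (simp add: sum_negf)
  finally show ?thesis using * by simp
qed

text \<open>Cramer's rule: the quotient of \<open>det (replace_row j v A)\<close> by
  \<open>det A\<close> is the coordinate of \<open>v\<close> along row \<open>j\<close>.\<close>

lemma sum_det_replace_row_scaleR:
  fixes A :: "real^'n^'n::finite"
  assumes "det A \<noteq> 0"
  shows "(\<Sum>j\<in>UNIV. det (replace_row j v A) *\<^sub>R (A $ j)) = det A *\<^sub>R v"
proof -
  have "invertible A" using assms by (simp add: invertible_det_nz)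
  then obtain B where B: "B ** A = mat 1" unfolding invertible_def by blast
  have row_eq: "row i A = A $ i" for i
    by (simp add: row_def vec_eq_iff)
  define x where "x = v v* B"
  have v: "v = (\<Sum>i\<in>UNIV. x $ i *s row i A)"
  proof -
    have "v = x v* A" unfolding x_def vector_matrix_mul_assoc B by simp
    thus ?thesis by (simp add: vec_eq_iff vector_matrix_mult_def row_def mult.commute)
  qed
  have "det (replace_row j v A) = x $ j * det A" for j
    using cramer_lemma_transpose[of j x A] unfolding v[symmetric]
    by (simp add: replace_row_def row_eq cong: if_cong)
  hence "(\<Sum>j\<in>UNIV. det (replace_row j v A) *\<^sub>R (A $ j)) = det A *\<^sub>R (\<Sum>i\<in>UNIV. x $ i *s row i A)"
    by (simp add: scaleR_sum_right vec_eq_iff row_eq sum_distrib_left mult_ac)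
  thus ?thesis unfolding v[symmetric] .
qed

section \<open>The divergence theorem in a boundary chart\<close>

lemma Ck_on_1I:
  assumes d: "\<And>x. x \<in> V \<Longrightarrow> (f has_derivative f' x) (at x)"
    and c: "\<And>i. continuous_on V (\<lambda>x. f' x (axis i 1))"
  shows "Ck_on 1 f V"
proof -
  have "continuous_on V (pd i f)" for i
    using c[of i] by (rule continuous_on_cong[THEN iffD1, rotated 2]) (auto simp: pd_eqI[OF d])
  moreover have "f differentiable (at x)" if "x \<in> V" for x
    using d[OF that] unfolding differentiable_def by blast
  ultimately show ?thesis by simp
qed

lemma Ck_on_1_subset: "Ck_on 1 f V \<Longrightarrow> W \<subseteq> V \<Longrightarrow> Ck_on 1 f W"
  by (auto intro: continuous_on_subset)

lemma Ck_on_1_Un: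
  assumes "open V" "open W" "Ck_on 1 f V" "Ck_on 1 f W"
  shows "Ck_on 1 f (V \<union> W)"
  using assms by (auto intro: continuous_on_open_Un)

lemma Ck_on_1_const: "Ck_on 1 (\<lambda>_. c) V"
  by (rule Ck_on_1I[of _ _ "\<lambda>_ _. 0"]) auto

lemma frechet_derivative_eq_sum_pd:
  assumes "Ck_on 1 f V" "x \<in> V"
  shows "frechet_derivative f (at x) h = (\<Sum>i\<in>UNIV. h $ i *\<^sub>R pd i f x)"
  by (rule linear_eq_sum_axis[OF has_derivative_linear[OF Ck_on_1_has_derivative[OF assms]]])

lemma pd_compose:
  assumes f: "Ck_on 1 f W" and g: "Ck_on 1 g V" and x: "x \<in> V" "g x \<in> W"
  shows "((\<lambda>x. f (g x)) has_derivative (\<lambda>h. frechet_derivative f (at (g x)) (frechet_derivative g (at x) h))) (at x)"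
    "pd i (\<lambda>x. f (g x)) x = (\<Sum>k\<in>UNIV. (pd i g x $ k) *\<^sub>R pd k f (g x))"
proof -
  show d: "((\<lambda>x. f (g x)) has_derivative (\<lambda>h. frechet_derivative f (at (g x)) (frechet_derivative g (at x) h))) (at x)"
    by (rule has_derivative_compose[OF Ck_on_1_has_derivative[OF g x(1)] Ck_on_1_has_derivative[OF f x(2)]])
  show "pd i (\<lambda>x. f (g x)) x = (\<Sum>k\<in>UNIV. (pd i g x $ k) *\<^sub>R pd k f (g x))"
    unfolding pd_eqI[OF d] by (rule frechet_derivative_eq_sum_pd[OF f x(2)])
qed

lemma Ck_on_1_compose:
  fixes g :: "real^'n::finite \<Rightarrow> real^'m::finite"
  assumes f: "Ck_on 1 f W" and g: "Ck_on 1 g V" and sub: "g ` V \<subseteq> W"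
  shows "Ck_on 1 (\<lambda>x. f (g x)) V"
proof (rule Ck_on_1I[where f' = "\<lambda>x h. frechet_derivative f (at (g x)) (frechet_derivative g (at x) h)"])
  show "((\<lambda>x. f (g x)) has_derivative (\<lambda>h. frechet_derivative f (at (g x)) (frechet_derivative g (at x) h))) (at x)"
    if "x \<in> V" for x
    by (rule pd_compose[OF f g]) (use that sub in auto)
  have "continuous_on V (\<lambda>x. \<Sum>k\<in>UNIV. (pd i g x $ k) *\<^sub>R pd k f (g x))" for i
    by (intro continuous_intros Ck_on_1_continuous_pd[OF g] continuous_on_compose2[OF Ck_on_1_continuous_pd[OF f] Ck_on_1_continuous_on[OF g] sub])
  thus "continuous_on V (\<lambda>x. frechet_derivative f (at (g x)) (frechet_derivative g (at x) (axis i 1)))" for i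
    by (rule continuous_on_cong[THEN iffD1, rotated 2]) (use sub in \<open>auto simp: frechet_derivative_eq_sum_pd[OF f]\<close>)
qed

lemma (in bounded_bilinear) Ck_on_1_prod:
  fixes f :: "real^'n::finite \<Rightarrow> 'a" and g :: "real^'n \<Rightarrow> 'b"
  assumes f: "Ck_on 1 f V" and g: "Ck_on 1 g V"
  shows "Ck_on 1 (\<lambda>x. prod (f x) (g x)) V"
    and pd_prod: "x \<in> V \<Longrightarrow> pd i (\<lambda>x. prod (f x) (g x)) x = prod (f x) (pd i g x) + prod (pd i f x) (g x)"
proof -
  have d: "((\<lambda>x. prod (f x) (g x)) has_derivative
      (\<lambda>h. prod (f x) (frechet_derivative g (at x) h) + prod (frechet_derivative f (at x) h) (g x))) (at x)"
    if "x \<in> V" for x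
    by (rule FDERIV[OF Ck_on_1_has_derivative[OF f that] Ck_on_1_has_derivative[OF g that]])
  show "Ck_on 1 (\<lambda>x. prod (f x) (g x)) V"
    by (rule Ck_on_1I[OF d])
       (auto intro!: continuous_on_add continuous_on Ck_on_1_continuous_pd[OF f] Ck_on_1_continuous_pd[OF g]
         Ck_on_1_continuous_on[OF f] Ck_on_1_continuous_on[OF g] simp del: Ck_on.simps)
  show "pd i (\<lambda>x. prod (f x) (g x)) x = prod (f x) (pd i g x) + prod (pd i f x) (g x)" if "x \<in> V"
    by (rule pd_eqI[OF d[OF that]])
qed

lemmas Ck_on_1_scaleR = bounded_bilinear.Ck_on_1_prod[OF bounded_bilinear_scaleR]
lemmas pd_scaleR = bounded_bilinear.pd_prod[OF bounded_bilinear_scaleR]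

lemma
  assumes f: "Ck_on 1 f V" and g: "Ck_on 1 g V"
  shows Ck_on_1_add: "Ck_on 1 (\<lambda>x. f x + g x) V"
    and pd_add: "x \<in> V \<Longrightarrow> pd i (\<lambda>x. f x + g x) x = pd i f x + pd i g x"
    and Ck_on_1_diff: "Ck_on 1 (\<lambda>x. f x - g x) V"
    and pd_diff: "x \<in> V \<Longrightarrow> pd i (\<lambda>x. f x - g x) x = pd i f x - pd i g x"
proof -
  note D = Ck_on_1_has_derivative[OF f] Ck_on_1_has_derivative[OF g]
  note a = has_derivative_add[OF D] and b = has_derivative_diff[OF D]
  show "Ck_on 1 (\<lambda>x. f x + g x) V"
    by (rule Ck_on_1I[OF a]) (auto intro!: continuous_on_add Ck_on_1_continuous_pd[OF f] Ck_on_1_continuous_pd[OF g] simp del: Ck_on.simps)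
  show "Ck_on 1 (\<lambda>x. f x - g x) V"
    by (rule Ck_on_1I[OF b]) (auto intro!: continuous_on_diff Ck_on_1_continuous_pd[OF f] Ck_on_1_continuous_pd[OF g] simp del: Ck_on.simps)
  show "pd i (\<lambda>x. f x + g x) x = pd i f x + pd i g x" "pd i (\<lambda>x. f x - g x) x = pd i f x - pd i g x" if "x \<in> V"
    using pd_eqI[OF a[OF that that]] pd_eqI[OF b[OF that that]] by blast+
qed

text \<open>The open sets \<open>V\<close> and \<open>- K\<close> cover the space; the extended
  function is \<open>f\<close> on the first and 0 on the second. This turns fields on a chart domain
  or on a neighbourhood into global C^1 fields.\<close>

lemma
  assumes V: "open V" "closed K" "K \<subseteq> V" and f: "Ck_on 1 f V" and z: "\<And>x. x \<in> V - K \<Longrightarrow> f x = 0"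
  shows Ck_on_1_extend_zero: "Ck_on 1 (\<lambda>x. if x \<in> V then f x else 0) UNIV"
    and pd_extend_zero: "pd i (\<lambda>x. if x \<in> V then f x else 0) x = (if x \<in> V then pd i f x else 0)"
proof -
  let ?F = "\<lambda>x. if x \<in> V then f x else 0"
  have o: "open (- K)" using V by auto
  have "Ck_on 1 ?F V \<longleftrightarrow> Ck_on 1 f V" by (rule Ck_on_cong_open[OF V(1)]) auto
  moreover have "Ck_on 1 ?F (- K) \<longleftrightarrow> Ck_on 1 (\<lambda>_. 0 :: 'b) (- K)"
    by (rule Ck_on_cong_open[OF o]) (auto simp: z)
  ultimately have "Ck_on 1 ?F (V \<union> - K)"
    using f Ck_on_1_const by (intro Ck_on_1_Un o V) auto
  moreover have "V \<union> - K = UNIV" using V by auto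
  ultimately show "Ck_on 1 ?F UNIV" by simp
  show "pd i ?F x = (if x \<in> V then pd i f x else 0)"
  proof (cases "x \<in> V")
    case True
    thus ?thesis using frechet_derivative_cong_open[OF V(1) True, of ?F f] by simp
  next
    case False
    hence "pd i ?F x = 0"
      by (intro pd_eq_0[OF o]) (use V in \<open>auto simp: z\<close>)
    thus ?thesis using False by simp
  qed
qed

lemma continuous_on_det:
  fixes A :: "'a::topological_space \<Rightarrow> real^'n^'n::finite"
  assumes "\<And>i. continuous_on V (\<lambda>x. A x $ i)"
  shows "continuous_on V (\<lambda>x. det (A x))"
  unfolding det_def by (intro continuous_intros assms)

lemma Ck_on_1_det_replace_row:
  fixes A :: "real^'n::finite \<Rightarrow> real^'n^'n"
  assumes A: "\<And>i. Ck_on 1 (\<lambda>u. A u $ i) V"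
  shows "Ck_on 1 (\<lambda>u. det (replace_row j v (A u))) V"
proof (rule Ck_on_1I[OF has_derivative_det_replace_row[OF Ck_on_1_has_derivative[OF A]]])
  note c = Ck_on_1_continuous_on[OF A] Ck_on_1_continuous_pd[OF A]
  have "continuous_on V (\<lambda>x. replace_row l (pd k (\<lambda>u. A u $ l) x) (replace_row j v (A x)) $ i)" for k l i
    by (cases "i = l"; cases "i = j") (simp_all add: replace_row_nth c del: Ck_on.simps)
  thus "continuous_on V (\<lambda>x. \<Sum>l\<in>UNIV - {j}. det (replace_row l (pd k (\<lambda>u. A u $ l) x) (replace_row j v (A x))))" for k
    by (intro continuous_on_sum continuous_on_det)
qed

text \<open>The transformation theorem used here concerns maps into a Cartesian power and the
  completed measure. Hence \<open>h\<close> passes through \<open>real^1\<close>, and measurability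
  of both integrands takes the equation from \<open>lebesgue\<close> back to
  \<open>lborel\<close>.\<close>

lemma change_of_variables_lborel_real:
  fixes h :: "real^'n::{finite,wellorder} \<Rightarrow> real"
  assumes S: "open S" and d: "\<And>x. x \<in> S \<Longrightarrow> (\<Phi> has_derivative \<Phi>' x) (at x)" and inj: "inj_on \<Phi> S"
    and m: "(\<lambda>u. indicator S u * (\<bar>det (matrix (\<Phi>' u))\<bar> * h (\<Phi> u))) \<in> borel_measurable lborel"
    and i: "integrable lborel (\<lambda>y. indicator (\<Phi> ` S) y * h y)"
  shows "(LINT u|lborel. indicator S u * (\<bar>det (matrix (\<Phi>' u))\<bar> * h (\<Phi> u))) = (LINT y|lborel. indicator (\<Phi> ` S) y * h y)"
proof -
  let ?v = "vec :: real \<Rightarrow> real^1"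
  have bl: "bounded_linear ?v"
    by (rule bounded_linear_intro[where K = 1]) (auto simp: vec_eq_iff norm_vec_def L2_set_def)
  let ?f = "\<lambda>u. \<bar>det (matrix (\<Phi>' u))\<bar> *\<^sub>R ?v (h (\<Phi> u))"
  have nth: "(LINT x|M. g x) $ 1 = (LINT x|M. g x $ 1)" if "integrable M g" for g :: "'n rvec \<Rightarrow> real^1" and M
    using integral_inner_left[of "axis 1 1" M g] that by (simp add: inner_axis)
  have "integrable lebesgue (\<lambda>y. indicator (\<Phi> ` S) y * h y)"
    using i by (subst integrable_completion) auto
  from integrable_bounded_linear[OF bl this]
  have "integrable lebesgue (\<lambda>y. indicator (\<Phi> ` S) y *\<^sub>R ?v (h y))"
    by (simp add: linear_scale[OF bounded_linear.linear[OF bl], symmetric])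
  hence r: "(\<lambda>y. ?v (h y)) absolutely_integrable_on \<Phi> ` S"
    by (simp add: set_integrable_def)
  have "?f absolutely_integrable_on S \<and> integral S ?f = integral (\<Phi> ` S) (\<lambda>y. ?v (h y))"
    by (subst has_absolute_integral_change_of_variables[OF _ _ inj, where g' = \<Phi>'])
       (use r S d in \<open>auto intro: has_derivative_at_withinI borel_open\<close>)
  hence l: "?f absolutely_integrable_on S" and eq: "integral S ?f = integral (\<Phi> ` S) (\<lambda>y. ?v (h y))" by auto
  from eq have "(LINT u:S|lebesgue. ?f u) = (LINT y:\<Phi> ` S|lebesgue. ?v (h y))"
    by (simp only: set_lebesgue_integral_eq_integral(2)[OF l] set_lebesgue_integral_eq_integral(2)[OF r])
  hence "(LINT u:S|lebesgue. ?f u) $ 1 = (LINT y:\<Phi> ` S|lebesgue. ?v (h y)) $ 1" by simp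
  hence "(LINT u|lebesgue. indicator S u * (\<bar>det (matrix (\<Phi>' u))\<bar> * h (\<Phi> u))) = (LINT y|lebesgue. indicator (\<Phi> ` S) y * h y)"
    unfolding set_lebesgue_integral_def nth[OF l[unfolded set_integrable_def]] nth[OF r[unfolded set_integrable_def]]
    by (simp add: mult.assoc)
  thus ?thesis
    using m i by (simp add: integral_completion)
qed

lemma change_of_variables_lborel:
  fixes F :: "real^'n::{finite,wellorder} \<Rightarrow> 'b::euclidean_space"
  assumes S: "open S" and d: "\<And>x. x \<in> S \<Longrightarrow> (\<Phi> has_derivative \<Phi>' x) (at x)" and inj: "inj_on \<Phi> S"
    and l: "integrable lborel (\<lambda>u. indicator S u *\<^sub>R (\<bar>det (matrix (\<Phi>' u))\<bar> *\<^sub>R F (\<Phi> u)))"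
    and r: "integrable lborel (\<lambda>y. indicator (\<Phi> ` S) y *\<^sub>R F y)"
  shows "(LINT u|lborel. indicator S u *\<^sub>R (\<bar>det (matrix (\<Phi>' u))\<bar> *\<^sub>R F (\<Phi> u)))
    = (LINT y|lborel. indicator (\<Phi> ` S) y *\<^sub>R F y)"
proof (rule euclidean_eqI)
  fix b :: 'b
  have "(LINT u|lborel. indicator S u * (\<bar>det (matrix (\<Phi>' u))\<bar> * (F (\<Phi> u) \<bullet> b)))
    = (LINT y|lborel. indicator (\<Phi> ` S) y * (F y \<bullet> b))"
  proof (rule change_of_variables_lborel_real[OF S d inj])
    have "integrable lborel (\<lambda>u. (indicator S u *\<^sub>R (\<bar>det (matrix (\<Phi>' u))\<bar> *\<^sub>R F (\<Phi> u))) \<bullet> b)"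
      by (rule integrable_inner_left) (rule l)
    thus "(\<lambda>u. indicator S u * (\<bar>det (matrix (\<Phi>' u))\<bar> * (F (\<Phi> u) \<bullet> b))) \<in> borel_measurable lborel"
      by (auto dest!: borel_measurable_integrable simp: mult.assoc)
    have "integrable lborel (\<lambda>y. (indicator (\<Phi> ` S) y *\<^sub>R F y) \<bullet> b)"
      by (rule integrable_inner_left) (rule r)
    thus "integrable lborel (\<lambda>y. indicator (\<Phi> ` S) y * (F y \<bullet> b))" by simp
  qed
  thus "(LINT u|lborel. indicator S u *\<^sub>R (\<bar>det (matrix (\<Phi>' u))\<bar> *\<^sub>R F (\<Phi> u))) \<bullet> b
    = (LINT y|lborel. indicator (\<Phi> ` S) y *\<^sub>R F y) \<bullet> b"
    using integral_inner_left[of b, OF l] integral_inner_left[of b, OF r] by (simp add: mult.assoc)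
qed

lemma wall_measurable [measurable]:
  "(\<lambda>x. (\<chi> i. if i = k then 0 else x i) :: real^'n::finite) \<in> measurable (\<Pi>\<^sub>M i\<in>UNIV - {k}. lborel) borel"
proof (rule borel_measurable_euclidean_space[THEN iffD2], rule ballI)
  fix b :: "real^'n" assume "b \<in> Basis"
  then obtain i where "b = axis i 1" by (auto simp: Basis_vec_def)
  thus "(\<lambda>x. ((\<chi> i. if i = k then 0 else x i) :: real^'n) \<bullet> b) \<in> borel_measurable (\<Pi>\<^sub>M i\<in>UNIV - {k}. lborel)"
    by (cases "i = k") (simp_all add: inner_axis)
qed

lemma integrable_wall:
  fixes G :: "real^'n::finite \<Rightarrow> 'b::{banach,second_countable_topology}"
  assumes G: "continuous_on UNIV G" and supp: "\<And>u. R \<le> norm u \<Longrightarrow> G u = 0"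
  shows "integrable (\<Pi>\<^sub>M i\<in>UNIV - {k}. lborel) (\<lambda>x. G (\<chi> i. if i = k then 0 else x i))"
proof -
  interpret product_sigma_finite "\<lambda>_::'n. lborel :: real measure" ..
  have "compact (G ` cball 0 R)"
    by (intro compact_continuous_image continuous_on_subset[OF G]) auto
  then obtain B where B: "\<And>u. u \<in> cball 0 R \<Longrightarrow> norm (G u) \<le> B"
    using compact_imp_bounded[of "G ` cball 0 R"] unfolding bounded_iff by fastforce
  let ?w = "\<lambda>x. (\<chi> i. if i = k then 0 else x i) :: real^'n"
  let ?A = "PiE (UNIV - {k}) (\<lambda>_. {-R..R})"
  have A: "?A \<in> sets (\<Pi>\<^sub>M i\<in>UNIV - {k}. lborel)"
    by (rule sets_PiM_I_finite) auto
  have m: "(\<lambda>x. G (?w x)) \<in> borel_measurable (\<Pi>\<^sub>M i\<in>UNIV - {k}. lborel)"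
    by (rule measurable_compose[OF wall_measurable borel_measurable_continuous_onI[OF G]])
  have "emeasure (\<Pi>\<^sub>M i\<in>UNIV - {k}. lborel) ?A = (\<Prod>i\<in>UNIV - {k}. emeasure lborel {-R..R})"
    by (rule emeasure_PiM) auto
  also have "\<dots> < \<infinity>"
    by (simp add: less_top[symmetric] power_eq_top_ennreal emeasure_lborel_Icc_eq)
  finally have fin: "emeasure (\<Pi>\<^sub>M i\<in>UNIV - {k}. lborel) ?A < \<infinity>" .
  have z: "G (?w x) = 0" if x: "x \<in> space (\<Pi>\<^sub>M i\<in>UNIV - {k}. lborel)" "x \<notin> ?A" for x
  proof (rule supp)
    obtain i where i: "i \<noteq> k" "x i \<notin> {-R..R}"
      using x by (auto simp: space_PiM PiE_def Pi_def)
    have "R \<le> \<bar>?w x $ i\<bar>" using i by auto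
    also have "\<dots> \<le> norm (?w x)" by (rule component_le_norm_cart)
    finally show "R \<le> norm (?w x)" .
  qed
  have b: "norm (G u) \<le> \<bar>B\<bar>" for u
    using B[of u] supp[of u] by (cases "norm u \<le> R") auto
  show ?thesis
    by (rule integrableI_bounded_set[OF A m fin, of "\<bar>B\<bar>"]) (auto simp: b z intro!: AE_I2)
qed

text \<open>\<open>G j\<close> is component \<open>j\<close> of the Piola transform of the field
  with value \<open>f\<close> in direction \<open>i\<close>; its divergence in the parameters is the
  Jacobian determinant times the divergence of the field. The half-space theorem leaves only the
  component normal to the wall, and a change of variables carries the volume integral to
  \<open>D\<close>.\<close>

lemma chart_divergence:
  fixes f :: "'n::{finite,wellorder} rvec \<Rightarrow> 'b::euclidean_space" and i :: 'n
  assumes chart: "boundary_chart D V \<Phi>" and f: "Ck_on 1 f UNIV"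
    and K: "compact K" "K \<subseteq> \<Phi> ` V" "\<And>x. x \<notin> K \<Longrightarrow> f x = 0"
  defines "G \<equiv> \<lambda>j u. if u \<in> V then det (replace_row j (axis i 1) (\<chi> c. pd c \<Phi> u)) *\<^sub>R f (\<Phi> u) else 0"
  shows "integrable (\<Pi>\<^sub>M i\<in>UNIV - {ix 1}. lborel) (\<lambda>x. G (ix 1) (wall_point x))"
    "(LINT x|(\<Pi>\<^sub>M i\<in>UNIV - {ix 1}. lborel). G (ix 1) (wall_point x)) = (LINT y|lborel. indicator D y *\<^sub>R pd i f y)"
proof -
  let ?M = "\<lambda>u. \<chi> c. pd c \<Phi> u"
  let ?C = "\<lambda>j u. det (replace_row j (axis i 1) (?M u))"
  have V: "open V" and inj: "inj_on \<Phi> V" and \<Phi>: "Ck_on k \<Phi> V" for k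
    using chart by (auto simp: boundary_chart_def)
  note \<Phi>2 = \<Phi>[of 2] and \<Phi>1 = \<Phi>[of 1]
  have matrix: "matrix (frechet_derivative \<Phi> (at u)) = transpose (?M u)" for u
    by (simp add: matrix_def transpose_def vec_eq_iff)
  have pos: "det (?M u) > 0" if "u \<in> V" for u
    using chart that unfolding boundary_chart_def matrix det_transpose by auto
  obtain g where g: "homeomorphism V (\<Phi> ` V) \<Phi> g"
    using invariance_of_domain_homeomorphism[OF V Ck_on_1_continuous_on[OF \<Phi>1] _ inj] by auto
  \<comment> \<open>The support in the parameters; it is compact because \<Phi> has a continuous
    inverse by invariance of domain.\<close>
  define K' where "K' = g ` K"
  have K': "compact K'" "K' \<subseteq> V"
    unfolding K'_def using K g
    by (auto intro!: compact_continuous_image intro: continuous_on_subset[OF homeomorphism_cont2[OF g]]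
        simp: homeomorphism_def)
  have zero: "f (\<Phi> u) = 0" if "u \<in> V - K'" for u
  proof (rule K(3))
    show "\<Phi> u \<notin> K"
      using that homeomorphism_apply1[OF g, of u] unfolding K'_def by (metis DiffD1 DiffD2 imageI)
  qed
  have C: "Ck_on 1 (?C j) V" for j
    by (rule Ck_on_1_det_replace_row) (use Ck_on_2D(2)[OF \<Phi>2] in \<open>simp del: Ck_on.simps One_nat_def\<close>)
  have f\<Phi>: "Ck_on 1 (\<lambda>u. f (\<Phi> u)) V"
    by (rule Ck_on_1_compose[OF f \<Phi>1]) simp
  have Cf: "Ck_on 1 (\<lambda>u. ?C j u *\<^sub>R f (\<Phi> u)) V" for j
    by (rule Ck_on_1_scaleR[OF C f\<Phi>])
  have cl: "closed K'" by (rule compact_imp_closed[OF K'(1)])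
  have G: "Ck_on 1 (G j) UNIV" for j
    unfolding G_def by (rule Ck_on_1_extend_zero[OF V cl K'(2) Cf]) (simp add: zero)
  have pdG: "pd j (G j) u = (if u \<in> V then pd j (\<lambda>u. ?C j u *\<^sub>R f (\<Phi> u)) u else 0)" for j u
    unfolding G_def by (rule pd_extend_zero[OF V cl K'(2) Cf]) (simp add: zero)
  have sum_pdG: "(\<Sum>j\<in>UNIV. pd j (G j) u) = (if u \<in> V then det (?M u) *\<^sub>R pd i f (\<Phi> u) else 0)" for u
  proof (cases "u \<in> V")
    case u: True
    interpret L: linear "frechet_derivative f (at (\<Phi> u))"
      by (rule has_derivative_linear[OF Ck_on_1_has_derivative[OF f]]) simp
    \<comment> \<open>The Piola identity removes the terms with differentiated cofactors. By the
      chain rule the others are derivatives of \<open>f\<close> along the rows \<partial>_j \<Phi>,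
      which Cramer's rule recombines to the determinant times direction \<open>i\<close>.\<close>
    have "(\<Sum>j\<in>UNIV. pd j (G j) u)
      = (\<Sum>j\<in>UNIV. ?C j u *\<^sub>R pd j (\<lambda>u. f (\<Phi> u)) u) + (\<Sum>j\<in>UNIV. pd j (?C j) u) *\<^sub>R f (\<Phi> u)"
      using u by (simp add: pdG pd_scaleR[OF C f\<Phi> u] sum.distrib scaleR_sum_left)
    also have "\<dots> = (\<Sum>j\<in>UNIV. ?C j u *\<^sub>R frechet_derivative f (at (\<Phi> u)) (?M u $ j))"
      unfolding Piola_identity[OF \<Phi>2 V u]
      using pd_eqI[OF pd_compose(1)[OF f \<Phi>1 u UNIV_I]] by simp
    also have "\<dots> = frechet_derivative f (at (\<Phi> u)) (\<Sum>j\<in>UNIV. ?C j u *\<^sub>R (?M u $ j))"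
      by (simp only: L.sum L.scale)
    also have "\<dots> = det (?M u) *\<^sub>R pd i f (\<Phi> u)"
      by (subst sum_det_replace_row_scaleR) (use pos[OF u] in \<open>simp_all add: L.scale\<close>)
    finally show ?thesis using u by simp
  qed (simp add: pdG)
  obtain R where R: "\<And>u. u \<in> K' \<Longrightarrow> norm u < R"
    using compact_imp_bounded[OF K'(1)] unfolding bounded_pos_less by blast
  have supp: "G j u = 0" if "R \<le> norm u" for j u
    using R[of u] that zero[of u] by (auto simp: G_def)
  have wall: "wall_point x = (\<chi> i. if i = ix 1 then 0 else x i)" for x
    by (simp add: wall_point_def)
  show "integrable (\<Pi>\<^sub>M i\<in>UNIV - {ix 1}. lborel) (\<lambda>x. G (ix 1) (wall_point x))"
    unfolding wall by (rule integrable_wall[OF Ck_on_1_continuous_on[OF G] supp])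
  let ?H = "{u :: 'n rvec. u $ ix 1 < 0}"
  have H: "open ?H" by (intro open_Collect_less continuous_intros)
  have intH: "integrable lborel (\<lambda>u. indicator ?H u *\<^sub>R pd j (G j) u)" for j
    by (rule integrable_mult_indicator[OF _ integrable_pd[OF G supp]]) (simp add: H borel_open)
  have "(LINT x|(\<Pi>\<^sub>M i\<in>UNIV - {ix 1}. lborel). G (ix 1) (wall_point x))
    = (\<Sum>j\<in>UNIV. if j = ix 1 then (LINT x|(\<Pi>\<^sub>M i\<in>UNIV - {ix 1}. lborel). G j (\<chi> i. if i = ix 1 then 0 else x i)) else 0)"
    by (simp add: wall)
  \<comment> \<open>For j other than \<open>ix 1\<close> the half-space integrals are zero, which
    allows completing the single wall term to a full divergence.\<close>
  also have "\<dots> = (\<Sum>j\<in>UNIV. (LINT u|lborel. indicator ?H u *\<^sub>R pd j (G j) u))"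
    by (rule sum.cong[OF refl], rule integral_pd_half_space[OF G supp, symmetric])
  also have "\<dots> = (LINT u|lborel. (\<Sum>j\<in>UNIV. indicator ?H u *\<^sub>R pd j (G j) u))"
    by (rule Bochner_Integration.integral_sum[symmetric]) (rule intH)
  also have "\<dots> = (LINT u|lborel. indicator (V \<inter> ?H) u *\<^sub>R (\<bar>det (matrix (frechet_derivative \<Phi> (at u)))\<bar> *\<^sub>R pd i f (\<Phi> u)))"
  proof (rule Bochner_Integration.integral_cong[OF refl])
    fix u
    show "(\<Sum>j\<in>UNIV. indicator ?H u *\<^sub>R pd j (G j) u) = indicator (V \<inter> ?H) u *\<^sub>R (\<bar>det (matrix (frechet_derivative \<Phi> (at u)))\<bar> *\<^sub>R pd i f (\<Phi> u))"
      unfolding scaleR_sum_right[symmetric] sum_pdG matrix det_transpose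
      using pos[of u] by (auto simp: indicator_def)
  qed
  also have "\<dots> = (LINT y|lborel. indicator (\<Phi> ` (V \<inter> ?H)) y *\<^sub>R pd i f y)"
  proof (rule change_of_variables_lborel)
    show "integrable lborel (\<lambda>u. indicator (V \<inter> ?H) u *\<^sub>R (\<bar>det (matrix (frechet_derivative \<Phi> (at u)))\<bar> *\<^sub>R pd i f (\<Phi> u)))"
    proof -
      have "integrable lborel (\<lambda>u. \<Sum>j\<in>UNIV. indicator ?H u *\<^sub>R pd j (G j) u)"
        by (rule Bochner_Integration.integrable_sum) (rule intH)
      also have "(\<lambda>u. \<Sum>j\<in>UNIV. indicator ?H u *\<^sub>R pd j (G j) u)
        = (\<lambda>u. indicator (V \<inter> ?H) u *\<^sub>R (\<bar>det (matrix (frechet_derivative \<Phi> (at u)))\<bar> *\<^sub>R pd i f (\<Phi> u)))"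
      proof
        fix u
        show "(\<Sum>j\<in>UNIV. indicator ?H u *\<^sub>R pd j (G j) u) = indicator (V \<inter> ?H) u *\<^sub>R (\<bar>det (matrix (frechet_derivative \<Phi> (at u)))\<bar> *\<^sub>R pd i f (\<Phi> u))"
          unfolding scaleR_sum_right[symmetric] sum_pdG matrix det_transpose
          using pos[of u] by (auto simp: indicator_def)
      qed
      finally show ?thesis .
    qed
    have "open (\<Phi> ` (V \<inter> ?H))"
      by (rule invariance_of_domain)
         (use V H inj Ck_on_1_continuous_on[OF \<Phi>1] in \<open>auto intro: continuous_on_subset inj_on_subset\<close>)
    thus "integrable lborel (\<lambda>y. indicator (\<Phi> ` (V \<inter> ?H)) y *\<^sub>R pd i f y)"
    proof (intro integrable_mult_indicator)
      obtain R where R: "\<And>x. x \<in> K \<Longrightarrow> norm x < R"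
        using compact_imp_bounded[OF K(1)] unfolding bounded_pos_less by blast
      show "integrable lborel (pd i f)"
        by (rule integrable_pd[OF f, of R]) (use R K(3) in fastforce)
    qed (simp add: borel_open)
  qed (use V H inj Ck_on_1_has_derivative[OF \<Phi>1] in \<open>auto intro: inj_on_subset\<close>)
  also have "\<dots> = (LINT y|lborel. indicator D y *\<^sub>R pd i f y)"
  proof (rule Bochner_Integration.integral_cong[OF refl])
    fix y
    have D: "\<Phi> u \<in> D \<longleftrightarrow> u \<in> ?H" if "u \<in> V" for u
      using chart that by (auto simp: boundary_chart_def)
    have "pd i f y = 0" if "y \<notin> \<Phi> ` V"
      by (rule pd_eq_0[of "- K"]) (use K that in \<open>auto intro: compact_imp_closed\<close>)
    moreover have "y \<in> \<Phi> ` (V \<inter> ?H) \<longleftrightarrow> y \<in> D" if "y \<in> \<Phi> ` V"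
      using that D by auto
    ultimately show "indicator (\<Phi> ` (V \<inter> ?H)) y *\<^sub>R pd i f y = indicator D y *\<^sub>R pd i f y"
      by (cases "y \<in> \<Phi> ` V") (auto simp: indicator_def)
  qed
  finally show "(LINT x|(\<Pi>\<^sub>M i\<in>UNIV - {ix 1}. lborel). G (ix 1) (wall_point x)) = (LINT y|lborel. indicator D y *\<^sub>R pd i f y)" .
qed

section \<open>Cut-off functions and partitions along the boundary\<close>

lemma
  fixes f :: "real^'n::finite \<Rightarrow> real"
  assumes h: "\<And>t. t \<in> S \<Longrightarrow> (h has_real_derivative h' t) (at t)" and c: "continuous_on S h'" and f: "Ck_on 1 f V" "f ` V \<subseteq> S"
  shows Ck_on_1_real_compose_on: "Ck_on 1 (\<lambda>x. h (f x)) V"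
    and pd_real_compose_on: "x \<in> V \<Longrightarrow> pd i (\<lambda>x. h (f x)) x = h' (f x) * pd i f x"
proof -
  have d: "((\<lambda>x. h (f x)) has_derivative (\<lambda>v. h' (f x) * frechet_derivative f (at x) v)) (at x)" if "x \<in> V" for x
    using has_derivative_compose[OF Ck_on_1_has_derivative[OF f(1) that] h[of "f x", unfolded has_field_derivative_def]] f(2) that by blast
  show "Ck_on 1 (\<lambda>x. h (f x)) V"
    by (rule Ck_on_1I[OF d], assumption)
       (intro continuous_on_mult Ck_on_1_continuous_pd[OF f(1)] continuous_on_compose2[OF c Ck_on_1_continuous_on[OF f(1)] f(2)])
  show "pd i (\<lambda>x. h (f x)) x = h' (f x) * pd i f x" if "x \<in> V"
    by (rule pd_eqI[OF d[OF that]])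
qed

lemma
  fixes f :: "real^'n::finite \<Rightarrow> real"
  assumes "\<And>t. (h has_real_derivative h' t) (at t)" "continuous_on UNIV h'" "Ck_on 1 f V"
  shows Ck_on_1_real_compose: "Ck_on 1 (\<lambda>x. h (f x)) V"
    and pd_real_compose: "x \<in> V \<Longrightarrow> pd i (\<lambda>x. h (f x)) x = h' (f x) * pd i f x"
  using Ck_on_1_real_compose_on[OF assms subset_UNIV] pd_real_compose_on[OF assms subset_UNIV] by blast+

lemma has_real_derivative_pos_part_square:
  "((\<lambda>t. (max 0 t)\<^sup>2) has_real_derivative 2 * max 0 t) (at (t::real))"
proof (cases t "0 :: real" rule: linorder_cases)
  case less
  have "((\<lambda>_. 0) has_real_derivative 0) (at t)" by simp
  from DERIV_cong[OF this] show ?thesis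
    by (rule has_field_derivative_transform_within_open[where S = "{..<0}"]) (use less in auto)
next
  case greater
  have "((\<lambda>t. t\<^sup>2) has_real_derivative 2 * t) (at t)" by (auto intro!: derivative_eq_intros)
  from DERIV_cong[OF this] show ?thesis
    by (rule has_field_derivative_transform_within_open[where S = "{0<..}"]) (use greater in auto)
next
  case equal
  have "((\<lambda>h. ((max 0 (0 + h))\<^sup>2 - (max 0 0)\<^sup>2) / h) \<longlongrightarrow> 0) (at (0::real))"
  proof (rule Lim_null_comparison)
    show "\<forall>\<^sub>F h in at (0::real). norm (((max 0 (0 + h))\<^sup>2 - (max 0 0)\<^sup>2) / h) \<le> \<bar>h\<bar>"
      by (rule eventuallyI) (auto simp: max_def power2_eq_square)
    show "((\<lambda>h::real. \<bar>h\<bar>) \<longlongrightarrow> 0) (at 0)" by (rule tendsto_rabs_zero) simp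
  qed
  thus ?thesis by (simp add: equal DERIV_def)
qed

text \<open>With q(t) = (max 0 t)^2, which is C^1, and w the affine map taking a, b to 0, 1, the
  step is 1 - q(1 - q(w(t))). The two minus signs make its derivative nonnegative.\<close>

lemma ex_C1_step:
  fixes a b :: real
  assumes "a < b"
  obtains \<sigma> \<sigma>' where "\<And>t. (\<sigma> has_real_derivative \<sigma>' t) (at t)" "continuous_on UNIV \<sigma>'"
    "\<And>t. 0 \<le> \<sigma>' t" "\<And>t. t \<le> a \<Longrightarrow> \<sigma> t = 0" "\<And>t. b \<le> t \<Longrightarrow> \<sigma> t = 1"
    "\<And>t. 0 \<le> \<sigma> t" "\<And>t. \<sigma> t \<le> 1"
proof -
  let ?q = "\<lambda>t::real. (max 0 t)\<^sup>2" and ?q' = "\<lambda>t::real. 2 * max 0 t"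
  let ?w = "\<lambda>t. (t - a) / (b - a)"
  define \<sigma> where "\<sigma> t = 1 - ?q (1 - ?q (?w t))" for t
  define \<sigma>' where "\<sigma>' t = - (?q' (1 - ?q (?w t)) * (- (?q' (?w t) * (1 / (b - a)))))" for t
  have w: "(?w has_real_derivative 1 / (b - a)) (at t)" for t
    using assms by (auto intro!: derivative_eq_intros)
  have 1: "((\<lambda>t. 1 - ?q (?w t)) has_real_derivative - (?q' (?w t) * (1 / (b - a)))) (at t)" for t
    using DERIV_diff[OF DERIV_const[of 1] DERIV_chain2[OF has_real_derivative_pos_part_square w]] by simp
  have 2: "(\<sigma> has_real_derivative \<sigma>' t) (at t)" for t
    unfolding \<sigma>_def \<sigma>'_def
    using DERIV_diff[OF DERIV_const[of 1] DERIV_chain2[OF has_real_derivative_pos_part_square 1]] by simp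
  have "max 0 (1 - (max 0 x)\<^sup>2) \<le> 1" for x :: real by simp
  hence q1: "?q (1 - ?q x) \<le> 1" for x
    by (simp add: power_le_one_iff)
  have le1: "1 \<le> ?q (?w t)" if "b \<le> t" for t
  proof (rule one_le_power)
    have "1 \<le> ?w t" using that assms by simp
    thus "1 \<le> max 0 (?w t)" by (rule order_trans) (rule max.cobounded2)
  qed
  show ?thesis
  proof (rule that[OF 2])
    show "continuous_on UNIV \<sigma>'" unfolding \<sigma>'_def
      using assms by (intro continuous_intros) auto
    show "0 \<le> \<sigma>' t" for t unfolding \<sigma>'_def using assms by simp
    show "\<sigma> t = 0" if "t \<le> a" for t
    proof -
      have "?w t \<le> 0" using that assms by (simp add: divide_nonpos_pos)
      hence "max 0 (?w t) = 0" by (rule max_absorb1)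
      thus ?thesis by (simp add: \<sigma>_def)
    qed
    show "\<sigma> t = 1" if "b \<le> t" for t
      using le1[OF that] by (simp add: \<sigma>_def max_def)
    show "0 \<le> \<sigma> t" "\<sigma> t \<le> 1" for t using q1 by (auto simp: \<sigma>_def)
  qed
qed

lemma
  shows Ck_on_1_inner_self: "Ck_on 1 (\<lambda>x::real^'n::finite. (x - P) \<bullet> (x - P)) V"
    and pd_inner_self: "pd i (\<lambda>x::real^'n. (x - P) \<bullet> (x - P)) x = 2 * (x - P) $ i"
proof -
  have d: "((\<lambda>x::real^'n. (x - P) \<bullet> (x - P)) has_derivative (\<lambda>h. 2 * ((x - P) \<bullet> h))) (at x)" for x
    by (auto intro!: derivative_eq_intros simp: inner_commute)
  show "Ck_on 1 (\<lambda>x::real^'n. (x - P) \<bullet> (x - P)) V"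
    by (rule Ck_on_1I[OF d]) (intro continuous_intros)
  show "pd i (\<lambda>x::real^'n. (x - P) \<bullet> (x - P)) x = 2 * (x - P) $ i"
    by (simp add: pd_eqI[OF d] inner_axis)
qed

text \<open>One minus a step in the squared distance, which unlike the distance is differentiable at
  the centre.\<close>

lemma ex_C1_bump:
  fixes P :: "real^'n::finite"
  assumes "r > 0"
  obtains \<rho> where "Ck_on 1 \<rho> UNIV" "\<And>x. 0 \<le> \<rho> x" "\<And>x. \<rho> x \<le> (1::real)"
    "\<And>x. x \<in> ball P (r / 2) \<Longrightarrow> \<rho> x = 1" "\<And>x. x \<notin> cball P r \<Longrightarrow> \<rho> x = 0"
proof -
  have lt: "(r / 2)\<^sup>2 < r\<^sup>2" using assms by (simp add: power_divide)
  obtain \<sigma> \<sigma>' where \<sigma>: "\<And>t. (\<sigma> has_real_derivative \<sigma>' t) (at t)" "continuous_on UNIV \<sigma>'"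
    "\<And>t. 0 \<le> \<sigma>' t" "\<And>t. t \<le> (r / 2)\<^sup>2 \<Longrightarrow> \<sigma> t = 0" "\<And>t. r\<^sup>2 \<le> t \<Longrightarrow> \<sigma> t = 1" "\<And>t. 0 \<le> \<sigma> t" "\<And>t. \<sigma> t \<le> 1"
    by (rule ex_C1_step[OF lt]) (rule that)
  let ?n = "\<lambda>x. (x - P) \<bullet> (x - P)"
  show ?thesis
  proof (rule that[of "\<lambda>x. 1 - \<sigma> (?n x)"])
    show "Ck_on 1 (\<lambda>x. 1 - \<sigma> (?n x)) UNIV"
      by (intro Ck_on_1_diff Ck_on_1_const Ck_on_1_real_compose[OF \<sigma>(1,2)] Ck_on_1_inner_self)
    show "1 - \<sigma> (?n x) = 1" if "x \<in> ball P (r / 2)" for x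
    proof -
      have "(norm (x - P))\<^sup>2 \<le> (r / 2)\<^sup>2"
        using that by (intro power_mono) (auto simp: dist_norm norm_minus_commute)
      thus ?thesis by (simp add: \<sigma>(4) power2_norm_eq_inner)
    qed
    show "1 - \<sigma> (?n x) = 0" if "x \<notin> cball P r" for x
    proof -
      have "r\<^sup>2 \<le> (norm (x - P))\<^sup>2"
        using that assms by (intro power_mono) (auto simp: dist_norm norm_minus_commute)
      thus ?thesis by (simp add: \<sigma>(5) power2_norm_eq_inner)
    qed
  qed (use \<sigma>(6,7) in auto)
qed

lemmas Ck_on_1_mult = bounded_bilinear.Ck_on_1_prod[OF bounded_bilinear_mult]

text \<open>\<eta> + (1 - \<eta>) \<rho> equals 1 - (1 - \<eta>) (1 - \<rho>): it is 1 where either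
  function is 1 and 0 where both vanish.\<close>

lemma ex_C1_cutoff_balls:
  fixes U :: "(real^'n::finite) set"
  assumes "finite F" "\<forall>P\<in>F. 0 < r P \<and> cball P (r P) \<subseteq> U"
  shows "\<exists>\<rho> C. Ck_on 1 \<rho> UNIV \<and> compact C \<and> C \<subseteq> U \<and> (\<forall>x. x \<notin> C \<longrightarrow> \<rho> x = (0::real)) \<and>
    (\<forall>x\<in>(\<Union>P\<in>F. ball P (r P / 2)). \<rho> x = 1)"
  using assms
proof (induction F)
  case empty
  have "Ck_on 1 (\<lambda>_::real^'n. 0::real) UNIV" by (rule Ck_on_1_const)
  thus ?case by (intro exI[of _ "\<lambda>_. 0"] exI[of _ "{}"]) (simp del: Ck_on.simps One_nat_def)
next
  case (insert P F)
  have "\<forall>Q\<in>F. 0 < r Q \<and> cball Q (r Q) \<subseteq> U" using insert.prems by simp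
  from insert.IH[OF this]
  obtain \<rho> C where \<rho>: "Ck_on 1 \<rho> UNIV" "compact C" "C \<subseteq> U" "\<forall>x. x \<notin> C \<longrightarrow> \<rho> x = (0::real)"
    "\<forall>x\<in>(\<Union>P\<in>F. ball P (r P / 2)). \<rho> x = 1"
    by (elim exE conjE) (rule that)
  have P: "0 < r P" "cball P (r P) \<subseteq> U" using insert.prems by auto
  obtain \<eta> where \<eta>: "Ck_on 1 \<eta> UNIV" "\<And>x. 0 \<le> \<eta> x" "\<And>x. \<eta> x \<le> (1::real)" "\<And>x. x \<in> ball P (r P / 2) \<Longrightarrow> \<eta> x = (1::real)"
    "\<And>x. x \<notin> cball P (r P) \<Longrightarrow> \<eta> x = 0"
    by (rule ex_C1_bump[OF P(1), of P]) (rule that)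
  let ?\<rho> = "\<lambda>x. \<eta> x + (1 - \<eta> x) * \<rho> x"
  have "Ck_on 1 ?\<rho> UNIV"
    by (intro Ck_on_1_add Ck_on_1_mult Ck_on_1_diff Ck_on_1_const \<rho> \<eta>)
  moreover have "compact (C \<union> cball P (r P))" "C \<union> cball P (r P) \<subseteq> U"
    using \<rho> P by (auto intro: compact_Un)
  moreover have "?\<rho> x = 0" if "x \<notin> C \<union> cball P (r P)" for x
    using that \<rho>(4)[rule_format, of x] \<eta>(5)[of x] by auto
  moreover have "?\<rho> x = 1" if "x \<in> (\<Union>P\<in>insert P F. ball P (r P / 2))" for x
  proof -
    have "\<eta> x = 1 \<or> \<rho> x = 1" using that \<rho>(5) \<eta>(4)[of x] by blast
    thus ?thesis by auto
  qed
  ultimately show ?case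
    by (intro exI[of _ ?\<rho>] exI[of _ "C \<union> cball P (r P)"] conjI allI impI ballI)
qed

lemma ex_C1_cutoff:
  fixes U :: "(real^'n::finite) set"
  assumes K: "compact K" and U: "open U" "K \<subseteq> U"
  obtains \<rho> W C where "Ck_on 1 \<rho> UNIV" "open W" "K \<subseteq> W" "\<And>x. x \<in> W \<Longrightarrow> \<rho> x = (1::real)"
    "compact C" "C \<subseteq> U" "\<And>x. x \<notin> C \<Longrightarrow> \<rho> x = 0"
proof -
  have "\<exists>r>0. cball P r \<subseteq> U" if "P \<in> K" for P
    using U that open_contains_cball by blast
  then obtain r where r: "\<And>P. P \<in> K \<Longrightarrow> 0 < r P \<and> cball P (r P) \<subseteq> U" by metis
  have "K \<subseteq> (\<Union>P\<in>K. ball P (r P / 2))" using r by force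
  then obtain F where F: "F \<subseteq> K" "finite F" "K \<subseteq> (\<Union>P\<in>F. ball P (r P / 2))"
    using compactE_image[OF K, of K "\<lambda>P. ball P (r P / 2)"] by auto
  have "\<forall>P\<in>F. 0 < r P \<and> cball P (r P) \<subseteq> U" using r F(1) by blast
  from ex_C1_cutoff_balls[OF F(2) this]
  obtain \<rho> C where "Ck_on 1 \<rho> UNIV" "compact C" "C \<subseteq> U" "\<forall>x. x \<notin> C \<longrightarrow> \<rho> x = (0::real)"
    "\<forall>x\<in>(\<Union>P\<in>F. ball P (r P / 2)). \<rho> x = 1"
    by (elim exE conjE) (rule that)
  thus ?thesis
    using F by (intro that[of \<rho> "\<Union>P\<in>F. ball P (r P / 2)" C]) (auto simp del: Ck_on.simps One_nat_def)
qed

section \<open>Partitions of unity along the boundary\<close>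

type_synonym 'n weighted_chart = "'n rvec set \<times> ('n rvec \<Rightarrow> 'n rvec) \<times> ('n rvec \<Rightarrow> real)"

text \<open>The new weight \<rho> is put in front and the old ones are multiplied by 1 - \<rho>, so
  their sum S becomes \<rho> + (1 - \<rho>) S. This is exactly 1 wherever \<rho> or S is, with no
  division by a sum of bumps.\<close>

lemma ex_boundary_partition_balls:
  fixes D :: "'n::{finite,wellorder} rvec set"
  assumes "finite F" "\<forall>P\<in>F. 0 < r P \<and> boundary_chart D (V P) (\<Phi> P) \<and> cball P (r P) \<subseteq> \<Phi> P ` V P"
  shows "\<exists>cs :: 'n weighted_chart list. (\<forall>(V, \<Phi>, \<eta>)\<in>set cs. boundary_chart D V \<Phi> \<and> Ck_on 1 \<eta> UNIV \<and> (\<forall>X. 0 \<le> \<eta> X) \<and>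
      compact (closure {X. \<eta> X \<noteq> 0}) \<and> closure {X. \<eta> X \<noteq> 0} \<subseteq> \<Phi> ` V) \<and>
    (\<forall>X\<in>(\<Union>P\<in>F. ball P (r P / 2)). (\<Sum>(V, \<Phi>, \<eta>)\<leftarrow>cs. \<eta> X) = 1)"
  using assms
proof (induction F)
  case empty
  show ?case by (rule exI[of _ "[]"]) simp
next
  case (insert P F)
  let ?ok = "\<lambda>(V, \<Phi>, \<eta>). boundary_chart D V \<Phi> \<and> Ck_on 1 \<eta> UNIV \<and> (\<forall>X. 0 \<le> \<eta> X) \<and>
      compact (closure {X. \<eta> X \<noteq> 0}) \<and> closure {X. \<eta> X \<noteq> 0} \<subseteq> \<Phi> ` V"
  have "\<forall>Q\<in>F. 0 < r Q \<and> boundary_chart D (V Q) (\<Phi> Q) \<and> cball Q (r Q) \<subseteq> \<Phi> Q ` V Q"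
    using insert.prems by simp
  from insert.IH[OF this]
  obtain cs :: "'n weighted_chart list" where cs: "\<forall>c\<in>set cs. ?ok c"
    "\<forall>X\<in>(\<Union>P\<in>F. ball P (r P / 2)). (\<Sum>(V, \<Phi>, \<eta>)\<leftarrow>cs. \<eta> X) = 1"
    by (elim exE conjE) (rule that, assumption, assumption)
  have P: "0 < r P" "cball P (r P) \<subseteq> \<Phi> P ` V P" "boundary_chart D (V P) (\<Phi> P)" using insert.prems by auto
  obtain \<rho> where \<rho>: "Ck_on 1 \<rho> UNIV" "\<And>x. 0 \<le> \<rho> x" "\<And>x. \<rho> x \<le> (1::real)"
    "\<And>x. x \<in> ball P (r P / 2) \<Longrightarrow> \<rho> x = 1" "\<And>x. x \<notin> cball P (r P) \<Longrightarrow> \<rho> x = 0"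
    by (rule ex_C1_bump[OF P(1), of P]) (rule that)
  let ?h = "\<lambda>(V, \<Phi>, \<eta>). (V, \<Phi>, \<lambda>x. (1 - \<rho> x) * \<eta> x)"
  let ?cs = "(V P, \<Phi> P, \<rho>) # map ?h cs"
  have sum: "(\<Sum>(V, \<Phi>, \<eta>)\<leftarrow>?cs. \<eta> X) = \<rho> X + (1 - \<rho> X) * (\<Sum>(V, \<Phi>, \<eta>)\<leftarrow>cs. \<eta> X)" for X
  proof -
    have "(\<Sum>(V, \<Phi>, \<eta>)\<leftarrow>map ?h cs. \<eta> X) = (1 - \<rho> X) * (\<Sum>(V, \<Phi>, \<eta>)\<leftarrow>cs. \<eta> X)"
      by (induction cs) (auto simp: algebra_simps)
    thus ?thesis by simp
  qed
  have "(\<Sum>(V, \<Phi>, \<eta>)\<leftarrow>?cs. \<eta> X) = 1" if "X \<in> (\<Union>P\<in>insert P F. ball P (r P / 2))" for X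
  proof -
    have "\<rho> X = 1 \<or> (\<Sum>(V, \<Phi>, \<eta>)\<leftarrow>cs. \<eta> X) = 1" using that \<rho>(4)[of X] cs(2) by blast
    thus ?thesis unfolding sum by auto
  qed
  moreover have "?ok c" if c: "c \<in> set ?cs" for c
  proof (cases "c = (V P, \<Phi> P, \<rho>)")
    case True
    have sub: "closure {X. \<rho> X \<noteq> 0} \<subseteq> cball P (r P)"
    proof (rule closure_minimal)
      show "{X. \<rho> X \<noteq> 0} \<subseteq> cball P (r P)" using \<rho>(5) by blast
    qed simp
    hence "compact (closure {X. \<rho> X \<noteq> 0})"
      by (meson bounded_cball bounded_subset closed_closure compact_eq_bounded_closed)
    with sub show ?thesis using True P \<rho>(1,2) by auto
  next
    case False
    then obtain V' \<Phi>' \<eta> where \<eta>: "(V', \<Phi>', \<eta>) \<in> set cs" and c: "c = (V', \<Phi>', \<lambda>x. (1 - \<rho> x) * \<eta> x)"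
      using c by auto
    have ok: "?ok (V', \<Phi>', \<eta>)" by (rule cs(1)[rule_format, OF \<eta>])
    have sub: "closure {X. (1 - \<rho> X) * \<eta> X \<noteq> 0} \<subseteq> closure {X. \<eta> X \<noteq> 0}"
      by (rule closure_mono) auto
    have "compact (closure {X. (1 - \<rho> X) * \<eta> X \<noteq> 0})"
      using sub ok by (auto intro: compact_closure[THEN iffD2] bounded_subset simp: compact_eq_bounded_closed)
    moreover have "Ck_on 1 (\<lambda>x. (1 - \<rho> x) * \<eta> x) UNIV"
      using ok by (intro Ck_on_1_mult Ck_on_1_diff Ck_on_1_const \<rho>(1)) (simp del: Ck_on.simps One_nat_def)
    ultimately show ?thesis
      unfolding c using ok sub \<rho>(3) by (simp del: Ck_on.simps One_nat_def) blast
  qed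
  ultimately show ?case
    by (intro exI[of _ ?cs] conjI ballI) (blast, blast)
qed

text \<open>Without a partition every \<open>J\<close> would satisfy the description in
  \<open>boundary_integral\<close>. Chart images are open by invariance of domain, and compactness
  of the frontier selects finitely many balls inside them.\<close>

lemma ex_boundary_partition:
  fixes D :: "'n::{finite,wellorder} rvec set"
  assumes D: "bounded D" "smooth_boundary D"
  shows "\<exists>cs. boundary_partition D cs"
proof -
  have K: "compact (frontier D)" using D by (simp add: compact_frontier_bounded)
  have "\<exists>r V \<Phi>. 0 < r \<and> boundary_chart D V \<Phi> \<and> cball P r \<subseteq> \<Phi> ` V" if P: "P \<in> frontier D" for P
  proof -
    obtain V \<Phi> where V: "boundary_chart D V \<Phi>" "P \<in> \<Phi> ` V"
      using D P unfolding smooth_boundary_def by blast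
    hence "open V" "inj_on \<Phi> V" "Ck_on 0 \<Phi> V" by (auto simp: boundary_chart_def simp del: Ck_on.simps)
    hence "open (\<Phi> ` V)" by (intro invariance_of_domain) auto
    with V show ?thesis unfolding open_contains_cball by blast
  qed
  then obtain r V \<Phi> where r: "\<And>P. P \<in> frontier D \<Longrightarrow> 0 < r P \<and> boundary_chart D (V P) (\<Phi> P) \<and> cball P (r P) \<subseteq> \<Phi> P ` V P"
    by metis
  have "frontier D \<subseteq> (\<Union>P\<in>frontier D. ball P (r P / 2))" using r by force
  then obtain F where F: "F \<subseteq> frontier D" "finite F" "frontier D \<subseteq> (\<Union>P\<in>F. ball P (r P / 2))"
    using compactE_image[OF K, of "frontier D" "\<lambda>P. ball P (r P / 2)"] by auto
  have "\<forall>P\<in>F. 0 < r P \<and> boundary_chart D (V P) (\<Phi> P) \<and> cball P (r P) \<subseteq> \<Phi> P ` V P"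
    using r F(1) by blast
  from ex_boundary_partition_balls[OF F(2) this] obtain cs :: "'n weighted_chart list" where
    "\<forall>(V, \<Phi>, \<eta>)\<in>set cs. boundary_chart D V \<Phi> \<and> Ck_on 1 \<eta> UNIV \<and> (\<forall>X. 0 \<le> \<eta> X) \<and>
      compact (closure {X. \<eta> X \<noteq> 0}) \<and> closure {X. \<eta> X \<noteq> 0} \<subseteq> \<Phi> ` V"
    "\<forall>X\<in>(\<Union>P\<in>F. ball P (r P / 2)). (\<Sum>(V, \<Phi>, \<eta>)\<leftarrow>cs. \<eta> X) = 1"
    by (elim exE conjE) (rule that, assumption, assumption)
  thus ?thesis
    unfolding boundary_partition_def
    by (intro exI[of _ cs] conjI exI[of _ "\<Union>P\<in>F. ball P (r P / 2)"] F(3)) auto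
qed

section \<open>The divergence theorem for boundary integrals\<close>

text \<open>The chart maps the wall into the frontier, where the hypothesis on \<omega> writes the
  form as cofactors of row \<open>ix 1\<close> times field components. The integrand is therefore a
  sum of the normal components \<open>G (ix 1)\<close> of \<open>chart_divergence\<close>, with
  \<eta> f in place of f.\<close>

lemma chart_integral_weighted:
  fixes D :: "'n::{finite,wellorder} rvec set" and f :: "'n \<Rightarrow> 'n rvec \<Rightarrow> 'b::euclidean_space"
  assumes chart: "boundary_chart D V \<Phi>" and \<eta>: "Ck_on 1 \<eta> UNIV" "compact (closure {X. \<eta> X \<noteq> 0})"
      "closure {X. \<eta> X \<noteq> 0} \<subseteq> \<Phi> ` V"
    and f: "\<And>i. Ck_on 1 (f i) UNIV"
    and \<omega>: "\<And>Y M. Y \<in> frontier D \<Longrightarrow> \<omega> Y (map (\<lambda>m. M $ ix m) [2..<CARD('n)+1]) =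
      (\<Sum>i\<in>UNIV. det (replace_row (ix 1) (axis i 1) M) *\<^sub>R f i Y)"
  shows "chart_integral V \<Phi> (\<lambda>Y ws. \<eta> Y *\<^sub>R \<omega> Y ws) =
    (\<Sum>i\<in>UNIV. (LINT y|lborel. indicator D y *\<^sub>R pd i (\<lambda>x. \<eta> x *\<^sub>R f i x) y))"
proof -
  let ?G = "\<lambda>i u. if u \<in> V then det (replace_row (ix 1) (axis i 1) (\<chi> c. pd c \<Phi> u)) *\<^sub>R (\<eta> (\<Phi> u) *\<^sub>R f i (\<Phi> u)) else 0"
  have \<eta>f: "Ck_on 1 (\<lambda>x. \<eta> x *\<^sub>R f i x) UNIV" for i
    by (rule Ck_on_1_scaleR[OF \<eta>(1) f])
  have z: "\<eta> x *\<^sub>R f i x = 0" if "x \<notin> closure {X. \<eta> X \<noteq> 0}" for i x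
    using that closure_subset[of "{X. \<eta> X \<noteq> 0}"] by auto
  note div = chart_divergence[OF chart \<eta>f \<eta>(2,3) z]
  have "indicator V (wall_point x) *\<^sub>R (\<eta> (\<Phi> (wall_point x)) *\<^sub>R
      \<omega> (\<Phi> (wall_point x)) (map (\<lambda>i. pderiv_at i \<Phi> (wall_point x)) [2..<CARD('n)+1]))
    = (\<Sum>i\<in>UNIV. ?G i (wall_point x))" for x :: "'n \<Rightarrow> real"
  proof (cases "wall_point x \<in> V")
    case True
    hence "\<Phi> (wall_point x) \<in> frontier D"
      using chart by (simp add: boundary_chart_def wall_point_def)
    from \<omega>[OF this, of "\<chi> c. pd c \<Phi> (wall_point x)"] show ?thesis
      using True by (simp add: pderiv_at_def scaleR_sum_right mult.commute)
  qed simp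
  hence "chart_integral V \<Phi> (\<lambda>Y ws. \<eta> Y *\<^sub>R \<omega> Y ws)
    = (LINT x|(\<Pi>\<^sub>M i\<in>UNIV - {ix 1}. lborel). (\<Sum>i\<in>UNIV. ?G i (wall_point x)))"
    unfolding chart_integral_def by simp
  also have "\<dots> = (\<Sum>i\<in>UNIV. (LINT x|(\<Pi>\<^sub>M i\<in>UNIV - {ix 1}. lborel). ?G i (wall_point x)))"
    by (rule Bochner_Integration.integral_sum) (rule div(1))
  also have "\<dots> = (\<Sum>i\<in>UNIV. (LINT y|lborel. indicator D y *\<^sub>R pd i (\<lambda>x. \<eta> x *\<^sub>R f i x) y))"
    by (rule sum.cong[OF refl]) (rule div(2))
  finally show ?thesis .
qed

lemma weighted_divergence_sum_list:
  fixes D :: "'n::{finite,wellorder} rvec set" and f :: "'n \<Rightarrow> 'n rvec \<Rightarrow> 'b::euclidean_space" and cs :: "'n weighted_chart list"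
  assumes cs: "\<forall>(V, \<Phi>, \<eta>)\<in>set cs. Ck_on 1 \<eta> UNIV" and D: "open D"
    and f: "\<And>i. Ck_on 1 (f i) UNIV" and supp: "\<And>i x. R \<le> norm x \<Longrightarrow> f i x = 0"
  shows "Ck_on 1 (\<lambda>x. \<Sum>(V, \<Phi>, \<eta>)\<leftarrow>cs. \<eta> x) UNIV"
    "(\<Sum>(V, \<Phi>, \<eta>)\<leftarrow>cs. (\<Sum>i\<in>UNIV. (LINT y|lborel. indicator D y *\<^sub>R pd i (\<lambda>x. \<eta> x *\<^sub>R f i x) y)))
    = (\<Sum>i\<in>UNIV. (LINT y|lborel. indicator D y *\<^sub>R pd i (\<lambda>x. (\<Sum>(V, \<Phi>, \<eta>)\<leftarrow>cs. \<eta> x) *\<^sub>R f i x) y))"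
proof -
  let ?s = "\<lambda>cs x. \<Sum>(V, \<Phi>, \<eta>)\<leftarrow>(cs :: 'n weighted_chart list). \<eta> x"
  have "Ck_on 1 (?s cs) UNIV \<and> (\<Sum>(V, \<Phi>, \<eta>)\<leftarrow>cs. (\<Sum>i\<in>UNIV. (LINT y|lborel. indicator D y *\<^sub>R pd i (\<lambda>x. \<eta> x *\<^sub>R f i x) y)))
    = (\<Sum>i\<in>UNIV. (LINT y|lborel. indicator D y *\<^sub>R pd i (\<lambda>x. ?s cs x *\<^sub>R f i x) y))"
    using cs
  proof (induction cs)
    case Nil
    have "pd i (\<lambda>x. 0 :: 'b) y = 0" for i y
      by (rule pd_eq_0[of UNIV]) auto
    thus ?case using Ck_on_1_const[of "0::real"] by (simp del: Ck_on.simps One_nat_def)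
  next
    case (Cons c cs)
    obtain V \<Phi> \<eta> where c: "c = (V, \<Phi>, \<eta>)" by (cases c)
    have \<eta>: "Ck_on 1 \<eta> UNIV" using Cons.prems by (simp add: c del: Ck_on.simps One_nat_def)
    have IH: "Ck_on 1 (?s cs) UNIV" "(\<Sum>(V, \<Phi>, \<eta>)\<leftarrow>cs. (\<Sum>i\<in>UNIV. (LINT y|lborel. indicator D y *\<^sub>R pd i (\<lambda>x. \<eta> x *\<^sub>R f i x) y)))
      = (\<Sum>i\<in>UNIV. (LINT y|lborel. indicator D y *\<^sub>R pd i (\<lambda>x. ?s cs x *\<^sub>R f i x) y))"
      using Cons.IH Cons.prems by (simp_all del: Ck_on.simps One_nat_def)
    have C: "Ck_on 1 (\<lambda>x. \<eta> x *\<^sub>R f i x) UNIV" "Ck_on 1 (\<lambda>x. ?s cs x *\<^sub>R f i x) UNIV" for i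
      by (rule Ck_on_1_scaleR[OF _ f], rule \<eta> IH(1))+
    have int: "integrable lborel (\<lambda>y. indicator D y *\<^sub>R pd i (\<lambda>x. \<eta> x *\<^sub>R f i x) y)"
      "integrable lborel (\<lambda>y. indicator D y *\<^sub>R pd i (\<lambda>x. ?s cs x *\<^sub>R f i x) y)" for i
      by (intro integrable_mult_indicator integrable_pd[of _ R] C; simp add: D borel_open supp)+
    have eq: "indicator D y *\<^sub>R pd i (\<lambda>x. ?s (c # cs) x *\<^sub>R f i x) y
      = indicator D y *\<^sub>R pd i (\<lambda>x. \<eta> x *\<^sub>R f i x) y + indicator D y *\<^sub>R pd i (\<lambda>x. ?s cs x *\<^sub>R f i x) y" for i y
      using pd_add[OF C(1)[where i = i] C(2)[where i = i] UNIV_I[of y]] by (simp add: c scaleR_add_left scaleR_add_right)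
    have "Ck_on 1 (?s (c # cs)) UNIV"
      using Ck_on_1_add[OF \<eta> IH(1)] by (simp add: c del: Ck_on.simps One_nat_def)
    moreover have "(\<Sum>(V, \<Phi>, \<eta>)\<leftarrow>(c # cs). (\<Sum>i\<in>UNIV. (LINT y|lborel. indicator D y *\<^sub>R pd i (\<lambda>x. \<eta> x *\<^sub>R f i x) y)))
      = (\<Sum>i\<in>UNIV. (LINT y|lborel. indicator D y *\<^sub>R pd i (\<lambda>x. ?s (c # cs) x *\<^sub>R f i x) y))"
      unfolding eq Bochner_Integration.integral_add[OF int] sum.distrib using IH(2) by (simp add: c)
    ultimately show ?case by blast
  qed
  thus "Ck_on 1 (?s cs) UNIV" "(\<Sum>(V, \<Phi>, \<eta>)\<leftarrow>cs. (\<Sum>i\<in>UNIV. (LINT y|lborel. indicator D y *\<^sub>R pd i (\<lambda>x. \<eta> x *\<^sub>R f i x) y)))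
    = (\<Sum>i\<in>UNIV. (LINT y|lborel. indicator D y *\<^sub>R pd i (\<lambda>x. ?s cs x *\<^sub>R f i x) y))"
    by blast+
qed

text \<open>As \<open>h\<close> vanishes near the frontier, setting it to 0 outside \<open>D\<close>
  keeps it C^1 and gives bounded support; a partial derivative of such a function has integral 0
  over the whole space.\<close>

lemma integral_pd_supported_in:
  fixes D :: "(real^'n::finite) set" and h :: "real^'n \<Rightarrow> 'b::euclidean_space"
  assumes D: "open D" "bounded D" and h: "Ck_on 1 h UNIV" and W: "open W" "frontier D \<subseteq> W" "\<And>x. x \<in> W \<Longrightarrow> h x = 0"
  shows "(LINT y|lborel. indicator D y *\<^sub>R pd i h y) = 0"
proof -
  let ?K = "closure D - W"
  have K: "closed ?K" "?K \<subseteq> D"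
    using W D interior_open[OF D(1)] by (auto simp: frontier_def closed_Diff)
  have hD: "Ck_on 1 h D" by (rule Ck_on_1_subset[OF h]) simp
  have z: "h x = 0" if "x \<in> D - ?K" for x
    using that W(3) closure_subset[of D] by auto
  obtain R where R: "\<And>x. x \<in> D \<Longrightarrow> norm x < R"
    using D(2) unfolding bounded_pos_less by blast
  have "(LINT y|lborel. pd i (\<lambda>x. if x \<in> D then h x else 0) y) = 0"
    by (rule integral_pd[OF Ck_on_1_extend_zero[OF D(1) K hD z], where R = R]) (use R in force)+
  also have "pd i (\<lambda>x. if x \<in> D then h x else 0) = (\<lambda>y. indicator D y *\<^sub>R pd i h y)"
    using pd_extend_zero[OF D(1) K hD z, where i = i] by (auto simp: fun_eq_iff indicator_def)
  finally show ?thesis .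
qed

text \<open>For any partition the weights sum to a function s that is 1 near the frontier. Then s f
  - f vanishes there and its divergence integrates to 0 over \<open>D\<close>, so the partition
  drops out of the result.\<close>

theorem boundary_integral_eq_divergence:
  fixes D U :: "'n::{finite,wellorder} rvec set" and F :: "'n \<Rightarrow> 'n rvec \<Rightarrow> 'b::euclidean_space"
  assumes D: "open D" "bounded D" "smooth_boundary D" and U: "open U" "closure D \<subseteq> U"
    and F: "\<And>i. Ck_on 1 (F i) U"
    and \<omega>: "\<And>Y M. Y \<in> frontier D \<Longrightarrow> \<omega> Y (map (\<lambda>m. M $ ix m) [2..<CARD('n)+1]) =
      (\<Sum>i\<in>UNIV. det (replace_row (ix 1) (axis i 1) M) *\<^sub>R F i Y)"
  shows "boundary_integral D \<omega> = (LINT y|lborel. indicator D y *\<^sub>R (\<Sum>i\<in>UNIV. pd i (F i) y))"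
    (is "_ = ?J")
proof -
  have "compact (closure D)" using D(2) by simp
  then obtain \<rho> W C where \<rho>: "Ck_on 1 \<rho> UNIV" and W: "open W" "closure D \<subseteq> W" "\<And>x. x \<in> W \<Longrightarrow> \<rho> x = (1::real)"
    and C: "compact C" "C \<subseteq> U" "\<And>x. x \<notin> C \<Longrightarrow> \<rho> x = 0"
    by (rule ex_C1_cutoff[OF _ U]) (rule that)
  define f where "f i x = (if x \<in> U then \<rho> x *\<^sub>R F i x else 0)" for i x
  have \<rho>F: "Ck_on 1 (\<lambda>x. \<rho> x *\<^sub>R F i x) U" for i
    by (rule Ck_on_1_scaleR[OF Ck_on_1_subset[OF \<rho>] F]) simp
  have f: "Ck_on 1 (f i) UNIV" for i
    unfolding f_def by (rule Ck_on_1_extend_zero[OF U(1) compact_imp_closed[OF C(1)] C(2) \<rho>F]) (simp add: C(3))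
  have fF: "f i x = F i x" if "x \<in> closure D" for i x
    using that W U by (auto simp: f_def)
  obtain R where R: "\<And>x. x \<in> C \<Longrightarrow> norm x < R"
    using compact_imp_bounded[OF C(1)] unfolding bounded_pos_less by blast
  have supp: "f i x = 0" if "R \<le> norm x" for i x
    using R[of x] C(3)[of x] that by (auto simp: f_def)
  have \<omega>f: "\<omega> Y (map (\<lambda>m. M $ ix m) [2..<CARD('n)+1]) =
      (\<Sum>i\<in>UNIV. det (replace_row (ix 1) (axis i 1) M) *\<^sub>R f i Y)" if "Y \<in> frontier D" for Y M
    unfolding \<omega>[OF that] using that by (simp add: fF frontier_def)
  have int: "integrable lborel (\<lambda>y. indicator D y *\<^sub>R pd i (f i) y)" for i
    by (intro integrable_mult_indicator integrable_pd[OF f supp]) (simp add: D borel_open)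
  have pdf: "pd i (f i) y = pd i (F i) y" if "y \<in> D" for i y
    by (rule fun_cong[OF frechet_derivative_cong_open[OF D(1) that]]) (use closure_subset fF in auto)
  have total: "(\<Sum>(V, \<Phi>, \<eta>)\<leftarrow>cs. chart_integral V \<Phi> (\<lambda>Y ws. \<eta> Y *\<^sub>R \<omega> Y ws)) = ?J"
    if cs: "boundary_partition D cs" for cs
  proof -
    let ?s = "\<lambda>x. \<Sum>(V, \<Phi>, \<eta>)\<leftarrow>cs. \<eta> x"
    obtain W' where W': "open W'" "frontier D \<subseteq> W'" "\<And>X. X \<in> W' \<Longrightarrow> ?s X = 1"
      using cs unfolding boundary_partition_def by blast
    have c1: "\<forall>(V, \<Phi>, \<eta>)\<in>set cs. Ck_on 1 \<eta> UNIV"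
      using cs unfolding boundary_partition_def by blast
    have s: "Ck_on 1 ?s UNIV" by (rule weighted_divergence_sum_list(1)[OF c1 D(1) f supp])
    have "(case c of (V, \<Phi>, \<eta>) \<Rightarrow> chart_integral V \<Phi> (\<lambda>Y ws. \<eta> Y *\<^sub>R \<omega> Y ws))
      = (case c of (V, \<Phi>, \<eta>) \<Rightarrow> (\<Sum>i\<in>UNIV. (LINT y|lborel. indicator D y *\<^sub>R pd i (\<lambda>x. \<eta> x *\<^sub>R f i x) y)))"
      if "c \<in> set cs" for c
    proof (cases c)
      case (fields V \<Phi> \<eta>)
      hence "boundary_chart D V \<Phi>" "Ck_on 1 \<eta> UNIV" "compact (closure {X. \<eta> X \<noteq> 0})"
        "closure {X. \<eta> X \<noteq> 0} \<subseteq> \<Phi> ` V"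
        using cs that unfolding boundary_partition_def by blast+
      from chart_integral_weighted[OF this f \<omega>f] show ?thesis by (simp add: fields)
    qed
    hence "(\<Sum>(V, \<Phi>, \<eta>)\<leftarrow>cs. chart_integral V \<Phi> (\<lambda>Y ws. \<eta> Y *\<^sub>R \<omega> Y ws))
      = (\<Sum>(V, \<Phi>, \<eta>)\<leftarrow>cs. (\<Sum>i\<in>UNIV. (LINT y|lborel. indicator D y *\<^sub>R pd i (\<lambda>x. \<eta> x *\<^sub>R f i x) y)))"
      by (intro arg_cong[of _ _ sum_list] map_cong refl)
    also have "\<dots> = (\<Sum>i\<in>UNIV. (LINT y|lborel. indicator D y *\<^sub>R pd i (\<lambda>x. ?s x *\<^sub>R f i x) y))"
      by (rule weighted_divergence_sum_list(2)[OF c1 D(1) f supp])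
    also have "\<dots> = (\<Sum>i\<in>UNIV. (LINT y|lborel. indicator D y *\<^sub>R pd i (f i) y))"
    proof (rule sum.cong[OF refl])
      fix i
      have sf: "Ck_on 1 (\<lambda>x. ?s x *\<^sub>R f i x) UNIV" by (rule Ck_on_1_scaleR[OF s f])
      have "(LINT y|lborel. indicator D y *\<^sub>R pd i (\<lambda>x. ?s x *\<^sub>R f i x - f i x) y) = 0"
        by (rule integral_pd_supported_in[OF D(1,2) Ck_on_1_diff[OF sf f] W'(1,2)]) (simp add: W'(3))
      also have "(\<lambda>y. indicator D y *\<^sub>R pd i (\<lambda>x. ?s x *\<^sub>R f i x - f i x) y)
        = (\<lambda>y. indicator D y *\<^sub>R pd i (\<lambda>x. ?s x *\<^sub>R f i x) y - indicator D y *\<^sub>R pd i (f i) y)"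
        by (simp add: pd_diff[OF sf f] scaleR_diff_right)
      also have "(LINT y|lborel. indicator D y *\<^sub>R pd i (\<lambda>x. ?s x *\<^sub>R f i x) y - indicator D y *\<^sub>R pd i (f i) y)
        = (LINT y|lborel. indicator D y *\<^sub>R pd i (\<lambda>x. ?s x *\<^sub>R f i x) y) - (LINT y|lborel. indicator D y *\<^sub>R pd i (f i) y)"
        by (intro Bochner_Integration.integral_diff int integrable_mult_indicator integrable_pd[OF sf, of R])
           (simp_all add: D borel_open supp)
      finally show "(LINT y|lborel. indicator D y *\<^sub>R pd i (\<lambda>x. ?s x *\<^sub>R f i x) y) = (LINT y|lborel. indicator D y *\<^sub>R pd i (f i) y)"
        by simp
    qed
    also have "\<dots> = (LINT y|lborel. (\<Sum>i\<in>UNIV. indicator D y *\<^sub>R pd i (f i) y))"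
      by (rule Bochner_Integration.integral_sum[symmetric]) (rule int)
    also have "\<dots> = ?J"
      by (rule Bochner_Integration.integral_cong[OF refl]) (auto simp: indicator_def pdf)
    finally show ?thesis .
  qed
  \<comment> \<open>A single partition excludes every other value in the description.\<close>
  obtain cs where cs: "boundary_partition D cs" using ex_boundary_partition[OF D(2,3)] by blast
  show ?thesis
    unfolding boundary_integral_def
  proof (rule the_equality)
    show "\<forall>cs. boundary_partition D cs \<longrightarrow> (\<Sum>(V, \<Phi>, \<eta>)\<leftarrow>cs. chart_integral V \<Phi> (\<lambda>Y ws. \<eta> Y *\<^sub>R \<omega> Y ws)) = ?J"
      using total by blast
    show "J = ?J" if "\<forall>cs. boundary_partition D cs \<longrightarrow> (\<Sum>(V, \<Phi>, \<eta>)\<leftarrow>cs. chart_integral V \<Phi> (\<lambda>Y ws. \<eta> Y *\<^sub>R \<omega> Y ws)) = J" for J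
      using that[rule_format, OF cs] total[OF cs] by (rule trans[OF sym])
  qed
qed

section \<open>Clifford identities of the vector variables\<close>

lemma cl_mult_add_left: "(a + b) \<star> c = a \<star> c + b \<star> c"
  by (simp add: vec_eq_iff cl_mult_nth algebra_simps sum.distrib)

lemma cl_mult_add_right: "a \<star> (b + c) = a \<star> b + a \<star> c"
  by (simp add: vec_eq_iff cl_mult_nth algebra_simps sum.distrib)

lemma cl_mult_vector_scalar_left: "(k *s a) \<star> b = k *s (a \<star> b)"
  by (simp add: vec_eq_iff cl_mult_nth sum_distrib_left mult_ac)

lemma cl_mult_vector_scalar_right: "a \<star> (k *s b) = k *s (a \<star> b)"
  by (simp add: vec_eq_iff cl_mult_nth sum_distrib_left mult_ac)

lemma scaleR_eq_vector_scalar: "r *\<^sub>R (a :: complex^'m) = complex_of_real r *s a"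
  by (simp add: vec_eq_iff complex_eq_iff)

lemma bounded_bilinear_cl_mult: "bounded_bilinear ((\<star>) :: 'n::{finite,wellorder} clifford \<Rightarrow> _)"
  unfolding bilinear_conv_bounded_bilinear[symmetric] bilinear_def
  by (intro conjI allI linearI)
     (simp_all add: cl_mult_add_left cl_mult_add_right scaleR_eq_vector_scalar
       cl_mult_vector_scalar_left cl_mult_vector_scalar_right)

interpretation cl_mult: bounded_bilinear "(\<star>) :: 'n::{finite,wellorder} clifford \<Rightarrow> _"
  by (rule bounded_bilinear_cl_mult)

text \<open>Being bilinear, it extends the Witt relations from basis elements to linear
  combinations; isotropy of \<open>a\<close> is the case \<open>anticomm a a = 0\<close>.\<close>

definition anticomm :: "'n::{finite,wellorder} clifford \<Rightarrow> 'n clifford \<Rightarrow> 'n clifford" where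
  "anticomm a b = a \<star> b + b \<star> a"

lemma
  shows anticomm_add_left: "anticomm (a + b) c = anticomm a c + anticomm b c"
    and anticomm_add_right: "anticomm a (b + c) = anticomm a b + anticomm a c"
    and anticomm_diff_left: "anticomm (a - b) c = anticomm a c - anticomm b c"
    and anticomm_diff_right: "anticomm a (b - c) = anticomm a b - anticomm a c"
    and anticomm_scalar_left: "anticomm (k *s a) b = k *s anticomm a b"
    and anticomm_scalar_right: "anticomm a (k *s b) = k *s anticomm a b"
  by (simp_all add: anticomm_def cl_mult.add_left cl_mult.add_right cl_mult.diff_left cl_mult.diff_right
      cl_mult_vector_scalar_left cl_mult_vector_scalar_right vector_add_ldistrib)

lemma anticomm_sum_left: "anticomm (\<Sum>k\<in>A. f k) b = (\<Sum>k\<in>A. anticomm (f k) b)"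
  by (simp add: anticomm_def cl_mult.sum_left cl_mult.sum_right sum.distrib)

lemma anticomm_sum_right: "anticomm b (\<Sum>k\<in>A. f k) = (\<Sum>k\<in>A. anticomm b (f k))"
  by (simp add: anticomm_def cl_mult.sum_left cl_mult.sum_right sum.distrib)

lemma anticomm_cl_e:
  assumes "\<alpha> \<in> {1..CARD('n)}" "\<beta> \<in> {1..CARD('n)}"
  shows "anticomm (cl_e \<alpha>) (cl_e \<beta>) = ((if \<alpha> = \<beta> then -2 else 0) *s cl_one :: 'n::{finite,wellorder} clifford)"
  unfolding anticomm_def by (rule cl_e_anticommute[OF assms])

text \<open>Each bracket expands into four brackets of generators. For k = l the two squares cancel
  within one family, because \<i>^2 = -1, and add up in the mixed bracket.\<close>

lemma
  assumes dim: "CARD('n::{finite,wellorder}) = 4 * p" and kl: "k \<in> {1..2*p}" "l \<in> {1..2*p}"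
  shows anticomm_witt_f: "anticomm (witt_f k) (witt_f l) = (0 :: 'n clifford)"
    and anticomm_witt_fd: "anticomm (witt_fd k) (witt_fd l) = (0 :: 'n clifford)"
    and anticomm_witt_f_fd: "anticomm (witt_f k) (witt_fd l) = (if k = l then cl_one else 0 :: 'n clifford)"
proof -
  have r: "2 * k - 1 \<in> {1..CARD('n)}" "2 * k \<in> {1..CARD('n)}" "2 * l - 1 \<in> {1..CARD('n)}" "2 * l \<in> {1..CARD('n)}"
    using kl by (auto simp: dim)
  have ne: "2 * k - 1 = 2 * l - 1 \<longleftrightarrow> k = l" "2 * k - 1 \<noteq> 2 * l" "2 * k \<noteq> 2 * l - 1"
    using kl by (auto, presburger+)
  note * = anticomm_add_left anticomm_add_right anticomm_diff_left anticomm_diff_right anticomm_scalar_left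
    anticomm_scalar_right anticomm_cl_e[OF r(1) r(3)] anticomm_cl_e[OF r(1) r(4)] anticomm_cl_e[OF r(2) r(3)] anticomm_cl_e[OF r(2) r(4)]
  show "anticomm (witt_f k) (witt_f l) = (0 :: 'n clifford)"
    and "anticomm (witt_fd k) (witt_fd l) = (0 :: 'n clifford)"
    and "anticomm (witt_f k) (witt_fd l) = (if k = l then cl_one else 0 :: 'n clifford)"
    unfolding witt_f_def witt_fd_def * using ne by (auto simp: vec_eq_iff)
qed

lemma
  assumes dim: "CARD('n::{finite,wellorder}) = 4 * p"
  shows anticomm_sum_witt_f: "anticomm (\<Sum>k=1..2*p. a k *s witt_f k) (\<Sum>k=1..2*p. b k *s witt_f k) = (0 :: 'n clifford)"
    and anticomm_sum_witt_fd: "anticomm (\<Sum>k=1..2*p. a k *s witt_fd k) (\<Sum>k=1..2*p. b k *s witt_fd k) = (0 :: 'n clifford)"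
    and anticomm_sum_witt_f_fd: "anticomm (\<Sum>k=1..2*p. a k *s witt_f k) (\<Sum>k=1..2*p. b k *s witt_fd k)
      = ((\<Sum>k=1..2*p. a k * b k) *s cl_one :: 'n clifford)"
proof -
  note S = anticomm_sum_left anticomm_sum_right anticomm_scalar_left anticomm_scalar_right
  show "anticomm (\<Sum>k=1..2*p. a k *s witt_f k) (\<Sum>k=1..2*p. b k *s witt_f k) = (0 :: 'n clifford)"
    "anticomm (\<Sum>k=1..2*p. a k *s witt_fd k) (\<Sum>k=1..2*p. b k *s witt_fd k) = (0 :: 'n clifford)"
    unfolding S by (intro sum.neutral ballI; simp add: anticomm_witt_f[OF dim] anticomm_witt_fd[OF dim])+
  have "anticomm (\<Sum>k=1..2*p. a k *s witt_f k) (\<Sum>k=1..2*p. b k *s witt_fd k)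
    = (\<Sum>l=1..2*p. b l *s (\<Sum>k=1..2*p. a k *s (if k = l then cl_one else 0 :: 'n clifford)))"
    unfolding S by (intro sum.cong refl arg_cong2[of _ _ _ _ "(*s)"]) (auto simp: anticomm_witt_f_fd[OF dim])
  also have "\<dots> = (\<Sum>k=1..2*p. (a k * b k) *s cl_one)"
  proof (rule sum.cong[OF refl])
    fix l assume "l \<in> {1..2*p}"
    hence "(\<Sum>k=1..2*p. a k *s (if k = l then cl_one else 0 :: 'n clifford)) = a l *s cl_one"
      by (subst sum.mono_neutral_right[of _ "{l}"]) auto
    thus "b l *s (\<Sum>k=1..2*p. a k *s (if k = l then cl_one else 0 :: 'n clifford)) = (a l * b l) *s cl_one"
      by (simp add: mult.commute)
  qed
  also have "\<dots> = (\<Sum>k=1..2*p. a k * b k) *s cl_one"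
    by (simp add: vec_eq_iff sum_distrib_right)
  finally show "anticomm (\<Sum>k=1..2*p. a k *s witt_f k) (\<Sum>k=1..2*p. b k *s witt_fd k)
      = ((\<Sum>k=1..2*p. a k * b k) *s cl_one :: 'n clifford)" .
qed

lemma anticomm_self_eq_0D: "anticomm a a = 0 \<Longrightarrow> a \<star> a = 0"
  by (simp add: anticomm_def vec_eq_iff)

lemma sum_pairs: "(\<Sum>k=1..2*p. h k) = (\<Sum>j=1..p. h (2*j-1) + h (2*j))" for h :: "nat \<Rightarrow> 'a::comm_monoid_add"
  by (induction p) (simp_all add: algebra_simps)

text \<open>The coefficients of \<open>z\<^sup>J\<close> with respect to the \<open>f\<^sub>k\<^sup>\<dagger>\<close>: the vector variables with superscript \<open>J\<close>
  are isotropic for the same reason as those without.\<close>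

definition swap_co :: "(nat \<Rightarrow> complex) \<Rightarrow> nat \<Rightarrow> complex" where
  "swap_co z k = (if odd k then z (k + 1) else - z (k - 1))"

lemma vecv_J_eq: "vecv_J p X = (\<Sum>k=1..2*p. swap_co (\<lambda>l. zco l X) k *s witt_fd k)"
  unfolding sum_pairs vecv_J_def
  by (intro sum.cong refl) (auto simp: swap_co_def vec_eq_iff)

lemma vecv_dJ_eq: "vecv_dJ p X = (\<Sum>k=1..2*p. swap_co (\<lambda>l. zcco l X) k *s witt_f k)"
  unfolding sum_pairs vecv_dJ_def
  by (intro sum.cong refl) (auto simp: swap_co_def vec_eq_iff)

section \<open>Complex coordinates and the Euclidean norm\<close>

lemma sum_ix:
  fixes h :: "'n::{finite,wellorder} \<Rightarrow> 'a::comm_monoid_add"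
  assumes dim: "CARD('n) = 4 * p"
  shows "(\<Sum>i\<in>UNIV. h i) = (\<Sum>k=1..2*p. h (ix (2*k-1)) + h (ix (2*k)))"
proof -
  have "(\<Sum>i\<in>UNIV. h i) = (\<Sum>m=1..2*(2*p). h (ix m))"
    using sum.reindex_bij_betw[OF bij_betw_ix[where 'n = 'n], of h] by (simp add: dim)
  thus ?thesis unfolding sum_pairs .
qed

lemma sum_cmod_zco:
  fixes X :: "'n::{finite,wellorder} rvec"
  assumes dim: "CARD('n) = 4 * p"
  shows "(\<Sum>k=1..2*p. (cmod (zco k X))\<^sup>2) = (norm X)\<^sup>2"
proof -
  have "(norm X)\<^sup>2 = (\<Sum>i\<in>UNIV. (X $ i)\<^sup>2)"
    unfolding power2_norm_eq_inner inner_vec_def by (simp add: power2_eq_square)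
  also have "\<dots> = (\<Sum>k=1..2*p. (cmod (zco k X))\<^sup>2)"
    unfolding sum_ix[OF dim] by (simp add: zco_def cmod_power2)
  finally show ?thesis by simp
qed

lemma znorm_eq_norm:
  fixes X :: "'n::{finite,wellorder} rvec"
  assumes dim: "CARD('n) = 4 * p"
  shows "znorm p X = norm X"
  unfolding znorm_def sum_cmod_zco[OF dim] by simp

lemma sum_zco_zcco:
  fixes X :: "'n::{finite,wellorder} rvec"
  assumes dim: "CARD('n) = 4 * p"
  shows "(\<Sum>k=1..2*p. zco k X * zcco k X) = complex_of_real ((norm X)\<^sup>2)"
  unfolding sum_cmod_zco[OF dim, symmetric] by (simp add: zcco_def complex_norm_square[symmetric])

text \<open>Each pair of indices is exchanged, and the minus sign at the even places enters
  twice.\<close>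

lemma sum_swap_co: "(\<Sum>k=1..2*p. swap_co a k * swap_co b k) = (\<Sum>k=1..2*p. a k * b k)"
  unfolding sum_pairs by (intro sum.cong refl) (auto simp: swap_co_def)

text \<open>Each of the four variables is a combination of the \<open>witt_f\<close> alone or of the
  \<open>witt_fd\<close> alone and so squares to 0; conjugate partners lie in opposite families and
  anticommute to the sum of the |z_k|^2.\<close>

lemma
  fixes X :: "'n::{finite,wellorder} rvec"
  assumes dim: "CARD('n) = 4 * p"
  shows vecv_vecv_d: "vecv p X \<star> vecv_d p X + vecv_d p X \<star> vecv p X = (norm X)\<^sup>2 *\<^sub>R cl_one"
    and vecv_J_vecv_dJ: "vecv_J p X \<star> vecv_dJ p X + vecv_dJ p X \<star> vecv_J p X = (norm X)\<^sup>2 *\<^sub>R cl_one"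
    and vecv_square: "vecv p X \<star> vecv p X = 0"
    and vecv_d_square: "vecv_d p X \<star> vecv_d p X = 0"
    and vecv_J_square: "vecv_J p X \<star> vecv_J p X = 0"
    and vecv_dJ_square: "vecv_dJ p X \<star> vecv_dJ p X = 0"
proof -
  show "vecv p X \<star> vecv_d p X + vecv_d p X \<star> vecv p X = (norm X)\<^sup>2 *\<^sub>R cl_one"
    using anticomm_sum_witt_f_fd[OF dim, of "\<lambda>k. zco k X" "\<lambda>k. zcco k X"]
    unfolding anticomm_def vecv_def vecv_d_def sum_zco_zcco[OF dim] scaleR_eq_vector_scalar .
  show "vecv_J p X \<star> vecv_dJ p X + vecv_dJ p X \<star> vecv_J p X = (norm X)\<^sup>2 *\<^sub>R cl_one"
    using anticomm_sum_witt_f_fd[OF dim, of "swap_co (\<lambda>k. zcco k X)" "swap_co (\<lambda>k. zco k X)"] sum_zco_zcco[OF dim, of X]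
    unfolding anticomm_def vecv_J_eq vecv_dJ_eq sum_swap_co scaleR_eq_vector_scalar by (simp add: mult.commute add.commute)
qed (simp_all only: vecv_def vecv_d_def vecv_J_eq vecv_dJ_eq anticomm_self_eq_0D anticomm_sum_witt_f[OF dim] anticomm_sum_witt_fd[OF dim])

lemma linear_zco: "linear (zco k)" "linear (zcco k)"
  by (auto intro!: linearI simp: zco_def zcco_def complex_eq_iff)

lemma linear_vecv:
  "linear (vecv p)" "linear (vecv_d p)" "linear (vecv_J p)" "linear (vecv_dJ p)"
  unfolding vecv_def[abs_def] vecv_d_def[abs_def] vecv_J_def[abs_def] vecv_dJ_def[abs_def]
  by (auto intro!: linearI simp: linear_add[OF linear_zco(1)] linear_add[OF linear_zco(2)]
      linear_scale[OF linear_zco(1)] linear_scale[OF linear_zco(2)] vec_eq_iff algebra_simps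
      sum.distrib sum_subtractf scaleR_sum_right)

lemma sum_zco_axis:
  fixes P :: "'n::{finite,wellorder} \<Rightarrow> complex^'m::finite"
  shows "(\<Sum>i\<in>UNIV. zco k (axis i 1) *s P i) = P (ix (2*k-1)) + \<i> *s P (ix (2*k))"
    and "(\<Sum>i\<in>UNIV. zcco k (axis i 1) *s P i) = P (ix (2*k-1)) - \<i> *s P (ix (2*k))"
proof -
  have z: "zco k (axis i 1) = (if i = ix (2*k-1) then 1 else 0) + \<i> * (if i = ix (2*k) then 1 else 0)"
    "zcco k (axis i 1) = (if i = ix (2*k-1) then 1 else 0) - \<i> * (if i = ix (2*k) then 1 else 0)" for i :: 'n
    by (auto simp: zco_def zcco_def axis_def complex_eq_iff)
  show "(\<Sum>i\<in>UNIV. zco k (axis i 1) *s P i) = P (ix (2*k-1)) + \<i> *s P (ix (2*k))"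
    "(\<Sum>i\<in>UNIV. zcco k (axis i 1) *s P i) = P (ix (2*k-1)) - \<i> *s P (ix (2*k))"
    unfolding z by (simp_all add: vec_eq_iff distrib_right left_diff_distrib sum.distrib sum_subtractf
      if_distrib[of "\<lambda>x. x * _"] if_distrib[of "\<lambda>x. _ * x"] cong: if_cong)
qed

text \<open>Putting the gradient in place of the vector turns \<open>zco k\<close> into \<partial>_x
  + \<i> \<partial>_y, twice the derivative in z_k^c. Hence the crossover: conjugated coordinates
  give unconjugated derivatives and conversely.\<close>

lemma
  fixes F :: "'n::{finite,wellorder} rvec \<Rightarrow> 'n clifford"
  shows sum_vecv_d_pd: "(\<Sum>i\<in>UNIV. vecv_d p (axis i 1) \<star> pd i F X) = 2 *\<^sub>R dirac p F X"
    and sum_vecv_pd: "(\<Sum>i\<in>UNIV. vecv p (axis i 1) \<star> pd i F X) = 2 *\<^sub>R dirac_d p F X"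
    and sum_vecv_dJ_pd: "(\<Sum>i\<in>UNIV. vecv_dJ p (axis i 1) \<star> pd i F X) = 2 *\<^sub>R dirac_J p F X"
    and sum_vecv_J_pd: "(\<Sum>i\<in>UNIV. vecv_J p (axis i 1) \<star> pd i F X) = 2 *\<^sub>R dirac_dJ p F X"
proof -
  have d: "2 *\<^sub>R (a \<star> d_zc k F X) = (\<Sum>i\<in>UNIV. (zco k (axis i 1) *s a) \<star> pd i F X)"
    "2 *\<^sub>R (a \<star> d_z k F X) = (\<Sum>i\<in>UNIV. (zcco k (axis i 1) *s a) \<star> pd i F X)" for k a
  proof -
    have "2 *\<^sub>R d_zc k F X = (\<Sum>i\<in>UNIV. zco k (axis i 1) *s pd i F X)"
      "2 *\<^sub>R d_z k F X = (\<Sum>i\<in>UNIV. zcco k (axis i 1) *s pd i F X)"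
      unfolding sum_zco_axis d_z_def d_zc_def pderiv_at_def by (simp_all add: vec_eq_iff scaleR_conv_of_real)
    from this[THEN arg_cong[of _ _ "(\<star>) a"]]
    show "2 *\<^sub>R (a \<star> d_zc k F X) = (\<Sum>i\<in>UNIV. (zco k (axis i 1) *s a) \<star> pd i F X)"
      "2 *\<^sub>R (a \<star> d_z k F X) = (\<Sum>i\<in>UNIV. (zcco k (axis i 1) *s a) \<star> pd i F X)"
      by (simp_all add: cl_mult.sum_right cl_mult.scaleR_right cl_mult_vector_scalar_left cl_mult_vector_scalar_right)
  qed
  show "(\<Sum>i\<in>UNIV. vecv_d p (axis i 1) \<star> pd i F X) = 2 *\<^sub>R dirac p F X"
    "(\<Sum>i\<in>UNIV. vecv p (axis i 1) \<star> pd i F X) = 2 *\<^sub>R dirac_d p F X"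
    unfolding vecv_def vecv_d_def dirac_def dirac_d_def cl_mult.sum_left scaleR_sum_right d
    by (rule sum.swap)+
  show "(\<Sum>i\<in>UNIV. vecv_dJ p (axis i 1) \<star> pd i F X) = 2 *\<^sub>R dirac_J p F X"
    "(\<Sum>i\<in>UNIV. vecv_J p (axis i 1) \<star> pd i F X) = 2 *\<^sub>R dirac_dJ p F X"
    unfolding vecv_J_def vecv_dJ_def dirac_J_def dirac_dJ_def cl_mult.sum_left scaleR_sum_right
      cl_mult.diff_left scaleR_diff_right d sum_subtractf[symmetric]
    by (rule sum.swap)+
qed

section \<open>The coordinate forms as fluxes\<close>

text \<open>Determinants whose size is a number rather than a type suit forms of degree N - 1 and
  bring the Laplace expansion with them.\<close>

lemma wedge_eq_det:
  assumes "length \<theta>s = m"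
  shows "wedge \<theta>s ws = Determinant.det (Matrix.mat m m (\<lambda>(a, b). (\<theta>s ! a) (ws ! b)))"
proof -
  have "(\<Prod>a<m. (\<theta>s ! a) (ws ! \<pi> a)) = (\<Prod>i = 0..<m. Matrix.mat m m (\<lambda>(a, b). (\<theta>s ! a) (ws ! b)) $$ (i, \<pi> i))"
    if "\<pi> permutes {..<m}" for \<pi>
  proof (rule prod.cong)
    fix i assume i: "i \<in> {0..<m}"
    hence "\<pi> i < m" using permutes_in_image[OF that, of i] by simp
    with i show "(\<theta>s ! i) (ws ! \<pi> i) = Matrix.mat m m (\<lambda>(a, b). (\<theta>s ! a) (ws ! b)) $$ (i, \<pi> i)" by simp
  qed auto
  thus ?thesis
    by (simp add: wedge_def Determinant.det_def assms atLeast0LessThan)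
qed

text \<open>Laplace expansion along the column of the first tangent vector. The minor of row
  \<open>a\<close> is the wedge with covector \<open>a\<close> omitted, which is how the hat forms
  enter.\<close>

lemma wedge_Cons:
  assumes "length \<theta>s = Suc m"
  shows "wedge \<theta>s (w # ws) = (\<Sum>a<Suc m. (-1) ^ a * (\<theta>s ! a) w * wedge (take a \<theta>s @ drop (Suc a) \<theta>s) ws)"
proof -
  let ?A = "Matrix.mat (Suc m) (Suc m) (\<lambda>(a, b). (\<theta>s ! a) ((w # ws) ! b))"
  have "wedge \<theta>s (w # ws) = (\<Sum>a<Suc m. ?A $$ (a, 0) * cofactor ?A a 0)"
    unfolding wedge_eq_det[OF assms] by (rule laplace_expansion_column) auto
  also have "\<dots> = (\<Sum>a<Suc m. (-1) ^ a * (\<theta>s ! a) w * wedge (take a \<theta>s @ drop (Suc a) \<theta>s) ws)"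
  proof (rule sum.cong[OF refl])
    fix a assume a: "a \<in> {..<Suc m}"
    have "mat_delete ?A a 0 = Matrix.mat m m (\<lambda>(i, j). ((take a \<theta>s @ drop (Suc a) \<theta>s) ! i) (ws ! j))"
      unfolding mat_delete_def by (rule eq_matI) (use a assms in \<open>auto simp: nth_append min_def\<close>)
    moreover have len: "length (take a \<theta>s @ drop (Suc a) \<theta>s) = m" using a assms by simp
    ultimately show "?A $$ (a, 0) * cofactor ?A a 0 = (-1) ^ a * (\<theta>s ! a) w * wedge (take a \<theta>s @ drop (Suc a) \<theta>s) ws"
      using a by (simp add: cofactor_def wedge_eq_det[OF len])
  qed
  finally show ?thesis .
qed

lemma ix_strict_mono:
  assumes "1 \<le> i" "i < j" "j \<le> CARD('n)"
  shows "(ix i :: 'n::{finite,wellorder}) < ix j"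
  unfolding ix_def
  by (rule sorted_wrt_nth_less[OF strict_sorted_list_of_set]) (use assms in auto)

text \<open>The list dz_1, dz_1^c, dz_2, dz_2^c, ... numbered from 0: the even position 2(k-1) holds
  dz_k, the next one dz_k^c.\<close>

definition covector :: "nat \<Rightarrow> 'n::{finite,wellorder} rvec \<Rightarrow> complex" where
  "covector a = (if even a then zco (a div 2 + 1) else zcco (a div 2 + 1))"

lemma concat_coordinates: "concat (map (\<lambda>l. [zco l, zcco l]) [1..<n+1]) = map covector [0..<2*n]"
  by (induction n) (simp_all add: covector_def)

lemma bij_betw_ix_Suc: "bij_betw (\<lambda>a. ix (Suc a)) {..<CARD('n)} (UNIV :: 'n::{finite,wellorder} set)"
proof -
  have "bij_betw Suc {..<CARD('n)} {1..CARD('n)}"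
    by (rule bij_betw_byWitness[where f' = "\<lambda>i. i - 1"]) auto
  from bij_betw_trans[OF this bij_betw_ix] show ?thesis by (simp add: o_def)
qed

text \<open>Conjugation by the order bijection between \<open>{..<CARD('n)}\<close> and
  \<open>'n\<close> carries permutations to permutations and keeps their sign. Forms of full degree
  thereby become determinants over the index type.\<close>

lemma det_eq_sum_ix:
  fixes B :: "'n::{finite,wellorder} cmat"
  shows "det B = (\<Sum>\<pi> | \<pi> permutes {..<CARD('n)}. of_int (sign \<pi>) * (\<Prod>a<CARD('n). B $ ix (Suc a) $ ix (Suc (\<pi> a))))"
proof -
  let ?\<kappa> = "\<lambda>a. ix (Suc a) :: 'n" and ?A = "{..<CARD('n)}"
  have bij: "bij_betw ?\<kappa> ?A UNIV" by (rule bij_betw_ix_Suc)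
  have inj: "inj_on ?\<kappa> ?A" using bij by (rule bij_betw_imp_inj_on)
  let ?g = "inv_into ?A ?\<kappa>"
  have bij': "bij_betw (map_permutation ?A ?\<kappa>) {\<pi>. \<pi> permutes ?A} {\<pi>. \<pi> permutes UNIV}"
  proof (rule bij_betw_byWitness[where f' = "map_permutation UNIV ?g"])
    show "\<forall>\<pi>\<in>{\<pi>. \<pi> permutes ?A}. map_permutation UNIV ?g (map_permutation ?A ?\<kappa> \<pi>) = \<pi>"
      using map_permutation_compose_inv[OF bij] inv_into_f_f[OF inj] by blast
    show "\<forall>\<pi>\<in>{\<pi>. \<pi> permutes UNIV}. map_permutation ?A ?\<kappa> (map_permutation UNIV ?g \<pi>) = \<pi>"
    proof
      fix \<pi> :: "'n \<Rightarrow> 'n" assume "\<pi> \<in> {\<pi>. \<pi> permutes UNIV}"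
      hence "\<pi> permutes UNIV" by simp
      moreover have "?\<kappa> (?g i) = i" for i
        using bij f_inv_into_f[of i ?\<kappa> ?A] by (auto simp: bij_betw_def)
      ultimately show "map_permutation ?A ?\<kappa> (map_permutation UNIV ?g \<pi>) = \<pi>"
        by (intro map_permutation_compose_inv[OF bij_betw_inv_into[OF bij]])
    qed
    show "map_permutation ?A ?\<kappa> ` {\<pi>. \<pi> permutes ?A} \<subseteq> {\<pi>. \<pi> permutes UNIV}"
      using map_permutation_permutes[OF bij] by blast
    show "map_permutation UNIV ?g ` {\<pi>. \<pi> permutes UNIV} \<subseteq> {\<pi>. \<pi> permutes ?A}"
      using map_permutation_permutes[OF bij_betw_inv_into[OF bij]] by blast
  qed
  have "det B = (\<Sum>\<pi> | \<pi> permutes ?A. of_int (sign (map_permutation ?A ?\<kappa> \<pi>)) *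
      (\<Prod>i\<in>UNIV. B $ i $ map_permutation ?A ?\<kappa> \<pi> i))"
    unfolding det_def by (rule sum.reindex_bij_betw[OF bij', symmetric])
  also have "\<dots> = (\<Sum>\<pi> | \<pi> permutes ?A. of_int (sign \<pi>) * (\<Prod>a\<in>?A. B $ ?\<kappa> a $ ?\<kappa> (\<pi> a)))"
  proof (rule sum.cong[OF refl])
    fix \<pi> assume "\<pi> \<in> {\<pi>. \<pi> permutes ?A}"
    hence \<pi>: "\<pi> permutes ?A" by simp
    have "(\<Prod>i\<in>UNIV. B $ i $ map_permutation ?A ?\<kappa> \<pi> i) = (\<Prod>a\<in>?A. B $ ?\<kappa> a $ map_permutation ?A ?\<kappa> \<pi> (?\<kappa> a))"
      by (rule prod.reindex_bij_betw[OF bij, symmetric])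
    also have "\<dots> = (\<Prod>a\<in>?A. B $ ?\<kappa> a $ ?\<kappa> (\<pi> a))"
      by (intro prod.cong refl) (simp add: map_permutation_apply[OF inj])
    finally show "of_int (sign (map_permutation ?A ?\<kappa> \<pi>)) * (\<Prod>i\<in>UNIV. B $ i $ map_permutation ?A ?\<kappa> \<pi> i)
      = of_int (sign \<pi>) * (\<Prod>a\<in>?A. B $ ?\<kappa> a $ ?\<kappa> (\<pi> a))"
      by (simp add: sign_map_permutation[OF inj \<pi>])
  qed
  finally show ?thesis .
qed

lemma wedge_eq_det_cart:
  assumes "length \<theta>s = CARD('n::{finite,wellorder})"
  shows "wedge \<theta>s ws = det (\<chi> i j. (\<theta>s ! inv_into {..<CARD('n)} (\<lambda>a. ix (Suc a)) i)
      (ws ! inv_into {..<CARD('n)} (\<lambda>a. ix (Suc a)) j) :: 'n cmat)"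
proof -
  let ?\<kappa> = "\<lambda>a. ix (Suc a) :: 'n" and ?A = "{..<CARD('n)}"
  have inv: "inv_into ?A ?\<kappa> (ix (Suc a)) = a" if "a \<in> ?A" for a
    using inv_into_f_f[OF bij_betw_imp_inj_on[OF bij_betw_ix_Suc[where 'n = 'n]] that] .
  have \<pi>: "\<pi> a \<in> ?A" if "\<pi> permutes ?A" "a \<in> ?A" for \<pi> a
    using permutes_in_image[OF that(1)] that(2) by blast
  show ?thesis
    unfolding wedge_def det_eq_sum_ix assms
    by (intro sum.cong arg_cong2[of _ _ _ _ "(*)"] prod.cong refl) (simp add: inv \<pi> del: lessThan_iff)
qed

text \<open>The matrix of the covectors \<open>dz\<^sub>k\<close>, \<open>dz\<^sub>k\<^sup>c\<close> is block diagonal with blocks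
  \<open>(1, \<i>; 1, -\<i>) = (1, 0; 1, 1) (1, \<i>; 0, -2\<i>)\<close>.\<close>

lemma det_covectors:
  assumes dim: "CARD('n::{finite,wellorder}) = 4 * p"
  shows "det (\<chi> i j. covector (inv_into {..<CARD('n)} (\<lambda>a. ix (Suc a)) i) (axis j 1) :: 'n cmat) = (-4) ^ p"
proof -
  let ?\<kappa> = "\<lambda>a. ix (Suc a) :: 'n" and ?A = "{..<CARD('n)}"
  let ?g = "inv_into ?A ?\<kappa>"
  note bij = bij_betw_ix_Suc[where 'n = 'n]
  have g: "?g (?\<kappa> a) = a" if "a < 4 * p" for a
    using inv_into_f_f[OF bij_betw_imp_inj_on[OF bij], of a] that by (simp add: dim)
  have ex: "\<exists>a<4*p. i = ?\<kappa> a" for i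
    using bij by (auto simp: bij_betw_def dim)
  have mono: "?\<kappa> a < ?\<kappa> b \<longleftrightarrow> a < b" if "a < 4 * p" "b < 4 * p" for a b
  proof -
    have 1: "?\<kappa> a < ?\<kappa> b" if "a < b" "b < 4 * p" for a b
      by (rule ix_strict_mono) (use that in \<open>auto simp: dim\<close>)
    show ?thesis using 1[of a b] 1[of b a] that by (cases a b rule: linorder_cases) auto
  qed
  have eq: "?\<kappa> a = ?\<kappa> b \<longleftrightarrow> a = b" if "a < 4 * p" "b < 4 * p" for a b
    using mono[of a b] mono[of b a] that by (cases a b rule: linorder_cases) auto
  define L :: "'n cmat" where
    "L = (\<chi> i j. if j = i \<or> odd (?g i) \<and> j = ?\<kappa> (?g i - 1) then 1 else 0)"
  define R :: "'n cmat" where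
    "R = (\<chi> i j. if j = i then (if even (?g i) then 1 else -2 * \<i>) else if even (?g i) \<and> j = ?\<kappa> (?g i + 1) then \<i> else 0)"
  have LR: "(\<chi> i j. covector (?g i) (axis j 1) :: 'n cmat) = L ** R"
  proof (rule vec_eq_iff[THEN iffD2], rule allI, rule vec_eq_iff[THEN iffD2], rule allI)
    fix i j :: 'n
    obtain a where a: "a < 4 * p" "i = ?\<kappa> a" using ex by blast
    obtain b where b: "b < 4 * p" "j = ?\<kappa> b" using ex by blast
    have "(L ** R) $ i $ j = (\<Sum>k\<in>UNIV. L $ i $ k * R $ k $ j)"
      by (simp add: matrix_matrix_mult_def)
    also have "\<dots> = (\<Sum>k\<in>(if odd a then {?\<kappa> a, ?\<kappa> (a - 1)} else {?\<kappa> a}). R $ k $ j)"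
      by (rule sum.mono_neutral_cong_right) (auto simp: L_def a g split: if_splits)
    also have "\<dots> = covector (?g i) (axis j 1)"
    proof (cases "even a")
      case True
      then obtain m where m: "a = 2 * m" by (elim evenE)
      have "Suc a < 4 * p" using True a(1) by (metis Suc_lessI even_Suc even_mult_iff even_numeral)
      thus ?thesis using True a b
        by (auto simp: R_def g covector_def zco_def axis_def eq m complex_eq_iff)
    next
      case False
      then obtain m where m: "a = 2 * m + 1" by (elim oddE)
      have ne: "?\<kappa> a \<noteq> ?\<kappa> (a - 1)" using eq[of a "a - 1"] a m by simp
      have "(\<Sum>k\<in>(if odd a then {?\<kappa> a, ?\<kappa> (a - 1)} else {?\<kappa> a}). R $ k $ j) = R $ ?\<kappa> a $ j + R $ ?\<kappa> (a - 1) $ j"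
        using False ne by simp
      also have "\<dots> = covector (?g i) (axis j 1)"
        using a b m by (auto simp: R_def g covector_def zcco_def zco_def axis_def eq complex_eq_iff)
      finally show ?thesis .
    qed
    finally show "(\<chi> i j. covector (?g i) (axis j 1) :: 'n cmat) $ i $ j = (L ** R) $ i $ j" by simp
  qed
  have "L $ i $ j = 0" if "i < j" for i j
  proof -
    obtain a where a: "a < 4 * p" "i = ?\<kappa> a" using ex by blast
    have "?\<kappa> (a - 1) \<le> ?\<kappa> a" using mono[of "a - 1" a] a eq[of "a - 1" a] by (cases a) auto
    thus ?thesis using that a by (auto simp: L_def g)
  qed
  hence L: "det L = 1"
    by (subst det_lowerdiagonal) (auto simp: L_def)
  have "R $ i $ j = 0" if "j < i" for i j
  proof -
    obtain a where a: "a < 4 * p" "i = ?\<kappa> a" using ex by blast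
    have "?\<kappa> a < ?\<kappa> (a + 1)" if "even a"
    proof -
      have "Suc a < 4 * p" using that a(1) by (metis Suc_lessI even_Suc even_mult_iff even_numeral)
      thus ?thesis using mono[of a "a + 1"] a by simp
    qed
    thus ?thesis using that a by (auto simp: R_def g)
  qed
  hence "det R = (\<Prod>i\<in>UNIV. R $ i $ i)"
    by (rule det_upperdiagonal)
  also have "\<dots> = (\<Prod>a<4*p. R $ ?\<kappa> a $ ?\<kappa> a)"
    using prod.reindex_bij_betw[OF bij, of "\<lambda>i. R $ i $ i"] by (simp add: dim)
  also have "\<dots> = (\<Prod>a<4*p. if even a then 1 else -2 * \<i>)"
    by (rule prod.cong[OF refl]) (simp add: R_def g)
  also have "\<dots> = (-4) ^ p"
  proof (induction p)
    case (Suc p)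
    have "{..<4 * Suc p} = insert (4*p) (insert (4*p+1) (insert (4*p+2) (insert (4*p+3) {..<4*p})))" by auto
    thus ?case using Suc by simp
  qed simp
  finally show ?thesis unfolding LR det_mul L by simp
qed

lemma det_of_real: "det (\<chi> i j. complex_of_real (M $ i $ j)) = complex_of_real (det (M :: 'n::finite rmat))"
  by (simp add: det_def)

lemma covector_linear: "linear (covector a)"
  by (auto intro!: linearI simp: covector_def zco_def zcco_def complex_eq_iff)

text \<open>The values of the covectors on the rows of \<open>M\<close> form the constant coordinate
  matrix times the transpose of \<open>M\<close>, so determinants multiply.\<close>

lemma wedge_coordinates:
  fixes M :: "'n::{finite,wellorder} rmat"
  assumes dim: "CARD('n) = 4 * p"
  shows "wedge (map covector [0..<4*p]) (map (\<lambda>m. M $ ix m) [1..<4*p+1]) = (-4) ^ p * complex_of_real (det M)"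
proof -
  let ?\<kappa> = "\<lambda>a. ix (Suc a) :: 'n" and ?A = "{..<CARD('n)}"
  let ?g = "inv_into ?A ?\<kappa>"
  note bij = bij_betw_ix_Suc[where 'n = 'n]
  have g: "?g i < 4 * p" "?\<kappa> (?g i) = i" for i
    using bij inv_into_into[of i ?\<kappa> ?A] f_inv_into_f[of i ?\<kappa> ?A] by (auto simp: bij_betw_def dim)
  have len: "length (map covector [0..<4*p] :: ('n rvec \<Rightarrow> complex) list) = CARD('n)" by (simp add: dim)
  let ?\<Theta> = "\<chi> i j. covector (?g i) (axis j 1) :: 'n cmat"
  have "wedge (map covector [0..<4*p]) (map (\<lambda>m. M $ ix m) [1..<4*p+1])
    = det (\<chi> i j. covector (?g i) (M $ j) :: 'n cmat)"
    unfolding wedge_eq_det_cart[OF len]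
    by (rule arg_cong[of _ _ det]) (simp add: vec_eq_iff g del: upt_Suc)
  also have "(\<chi> i j. covector (?g i) (M $ j) :: 'n cmat)
    = ?\<Theta> ** Finite_Cartesian_Product.transpose (\<chi> i j. complex_of_real (M $ i $ j))"
  proof -
    have expand: "covector a w = (\<Sum>k\<in>UNIV. covector a (axis k 1) * complex_of_real (w $ k))" for a and w :: "'n rvec"
      using linear_eq_sum_axis[OF covector_linear] by (simp only: scaleR_conv_of_real mult.commute)
    show ?thesis
      by (simp add: vec_eq_iff matrix_matrix_mult_def Finite_Cartesian_Product.transpose_def expand[of _ "M $ _"])
  qed
  finally show ?thesis
    by (simp add: det_mul det_covectors[OF dim] det_of_real Determinants.det_transpose)
qed

text \<open>Row \<open>ix m\<close> of \<open>M\<close> stands for \<open>\<partial>\<^sub>m \<Phi>\<close>, so \<open>flux M\<close> is the normal vector \<open>\<partial>\<^sub>2 \<Phi> \<times> \<dots> \<times> \<partial>\<^sub>N \<Phi>\<close>.\<close>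

definition flux :: "'n::{finite,wellorder} rmat \<Rightarrow> 'n rvec" where
  "flux M = (\<chi> i. det (replace_row (ix 1) (axis i 1) M))"

text \<open>With a coordinate vector as first argument the full form gives (-4)^p times a component
  of the flux. Expanding in this argument for the directions 2k-1 and 2k, only dz_k and dz_k^c
  contribute, and the two equations determine both hat forms.\<close>

lemma
  fixes M :: "'n::{finite,wellorder} rmat"
  assumes dim: "CARD('n) = 4 * p" and k: "k \<in> {1..2*p}"
  shows hat_dz_eq: "hat_dz p k (map (\<lambda>m. M $ ix m) [2..<CARD('n)+1]) = (-4) ^ p / 2 * zcco k (flux M)"
    and hat_dzc_eq: "hat_dzc p k (map (\<lambda>m. M $ ix m) [2..<CARD('n)+1]) = - ((-4) ^ p / 2 * zco k (flux M))"
proof -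
  let ?ws = "map (\<lambda>m. M $ ix m) [2..<4*p+1]" and ?\<theta> = "map covector [0..<4*p] :: ('n rvec \<Rightarrow> complex) list"
  let ?a = "2 * (k - 1)"
  have p: "0 < 4 * p" using k by auto
  have ne: "ix m \<noteq> (ix 1 :: 'n)" if "2 \<le> m" "m \<le> 4 * p" for m
  proof -
    have "(ix 1 :: 'n) < ix m" by (rule ix_strict_mono) (use that in \<open>simp_all add: dim\<close>)
    thus ?thesis by (rule less_imp_neq[THEN not_sym])
  qed
  have ix_inj: "(ix m :: 'n) = ix l \<longleftrightarrow> m = l" if "m \<in> {1..4*p}" "l \<in> {1..4*p}" for m l
    using inj_on_eq_iff[OF bij_betw_imp_inj_on[OF bij_betw_ix[where 'n = 'n]], of m l] that by (simp only: dim)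
  have full: "(-4) ^ p * complex_of_real (flux M $ i) = (\<Sum>a<4*p. (-1) ^ a * covector a (axis i 1) * wedge (take a ?\<theta> @ drop (Suc a) ?\<theta>) ?ws)" for i
  proof -
    have "[1..<4*p+1] = 1 # [2..<4*p+1]" using p upt_conv_Cons[of 1 "4*p+1"] by (simp add: numeral_2_eq_2 del: upt_Suc)
    hence "map (\<lambda>m. replace_row (ix 1) (axis i 1) M $ ix m) [1..<4*p+1] = axis i 1 # ?ws"
      using ne by (auto simp: replace_row_nth simp del: upt_Suc)
    hence "(-4) ^ p * complex_of_real (flux M $ i) = wedge ?\<theta> (axis i 1 # ?ws)"
      using wedge_coordinates[OF dim, of "replace_row (ix 1) (axis i 1) M"] by (simp add: flux_def)
    also have "\<dots> = (\<Sum>a<Suc (4*p-1). (-1) ^ a * (?\<theta> ! a) (axis i 1) * wedge (take a ?\<theta> @ drop (Suc a) ?\<theta>) ?ws)"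
      by (rule wedge_Cons) (use p in simp)
    also have "\<dots> = (\<Sum>a<4*p. (-1) ^ a * covector a (axis i 1) * wedge (take a ?\<theta> @ drop (Suc a) ?\<theta>) ?ws)"
      using p by (intro sum.cong) auto
    finally show ?thesis .
  qed
  have split: "[1..<2*p+1] = [1..<k] @ k # [k+1..<2*p+1]"
  proof -
    define d where "d = 2 * p - k"
    hence d: "2*p+1 = k + Suc d" using k by auto
    have "[1..<k + Suc d] = [1..<k] @ [k..<k + Suc d]"
      by (rule upt_add_eq_append) (use k in simp)
    also have "[k..<k + Suc d] = k # [k+1..<k + Suc d]"
      using upt_conv_Cons[of k "k + Suc d"] by simp
    finally show ?thesis unfolding d .
  qed
  let ?P = "concat (map (\<lambda>l. [zco l, zcco l]) [1..<k]) :: ('n rvec \<Rightarrow> complex) list"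
  let ?Q = "concat (map (\<lambda>l. [zco l, zcco l]) [k+1..<2*p+1]) :: ('n rvec \<Rightarrow> complex) list"
  have \<theta>: "?\<theta> = ?P @ [zco k, zcco k] @ ?Q"
    using concat_coordinates[of "2*p", where 'a = 'n] unfolding split by simp
  have lenP: "length ?P = ?a"
  proof -
    have "k - 1 + 1 = k" using k by simp
    with arg_cong[OF concat_coordinates[of "k-1", where 'a = 'n], of length]
    show ?thesis by (simp only: length_map length_upt diff_zero)
  qed
  have P': "concat (map (\<lambda>l. if l = k then X l else [zco l, zcco l]) [1..<k]) = ?P"
    "concat (map (\<lambda>l. if l = k then X l else [zco l, zcco l]) [k+1..<2*p+1]) = ?Q" for X
    by (intro arg_cong[of _ _ concat] map_cong refl; auto)+
  have omit: "concat (map (\<lambda>l. if l = k then X l else [zco l, zcco l]) [1..<2*p+1]) = ?P @ X k @ ?Q" for X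
    by (simp only: split map_append list.map concat_append concat.simps P' simp_thms if_True)
  have \<theta>': "take ?a ?\<theta> @ drop (Suc ?a) ?\<theta> = ?P @ [zcco k] @ ?Q"
    "take (Suc ?a) ?\<theta> @ drop (Suc (Suc ?a)) ?\<theta> = ?P @ [zco k] @ ?Q"
    unfolding \<theta> lenP[symmetric] by simp_all
  have hz: "hat_dz p k ?ws = wedge (take ?a ?\<theta> @ drop (Suc ?a) ?\<theta>) ?ws"
    and hzc: "hat_dzc p k ?ws = wedge (take (Suc ?a) ?\<theta> @ drop (Suc (Suc ?a)) ?\<theta>) ?ws"
    unfolding hat_dz_def hat_dzc_def omit \<theta>' by (rule refl)+
  have zax: "zco l (axis (ix m) 1 :: 'n rvec) = (if m = 2 * l - 1 then 1 else if m = 2 * l then \<i> else 0)"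
    "zcco l (axis (ix m) 1 :: 'n rvec) = (if m = 2 * l - 1 then 1 else if m = 2 * l then -\<i> else 0)"
    if "l \<in> {1..2*p}" "m \<in> {1..4*p}" for l m
  proof -
    have "2 * l - 1 \<in> {1..4*p}" "2 * l \<in> {1..4*p}" using that by auto
    hence "(axis (ix m) 1 :: 'n rvec) $ ix (2 * l - 1) = (if m = 2 * l - 1 then 1 else 0)"
      "(axis (ix m) 1 :: 'n rvec) $ ix (2 * l) = (if m = 2 * l then 1 else 0)"
      using ix_inj that by (auto simp: axis_def)
    moreover have "2 * l - 1 \<noteq> 2 * l" using that by auto
    ultimately show "zco l (axis (ix m) 1 :: 'n rvec) = (if m = 2 * l - 1 then 1 else if m = 2 * l then \<i> else 0)"
      "zcco l (axis (ix m) 1 :: 'n rvec) = (if m = 2 * l - 1 then 1 else if m = 2 * l then -\<i> else 0)"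
      by (simp_all add: zco_def zcco_def complex_eq_iff)
  qed
  \<comment> \<open>Directions 2k-1 and 2k are invisible to the covectors of every other complex
    coordinate.\<close>
  have cov0: "covector b (axis (ix m) 1 :: 'n rvec) = 0"
    if b: "b < 4 * p" "b \<noteq> ?a" "b \<noteq> Suc ?a" and m: "m = 2 * k - 1 \<or> m = 2 * k" for b m
  proof -
    have l: "b div 2 + 1 \<in> {1..2*p}" "m \<in> {1..4*p}" "b div 2 + 1 \<noteq> k" using b k m by auto
    hence "m \<noteq> 2 * (b div 2 + 1) - 1" "m \<noteq> 2 * (b div 2 + 1)" using m k by auto
    hence "zco (b div 2 + 1) (axis (ix m) 1 :: 'n rvec) = 0" "zcco (b div 2 + 1) (axis (ix m) 1 :: 'n rvec) = 0"
      unfolding zax[OF l(1,2)] by (simp_all only: if_False)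
    thus ?thesis by (simp add: covector_def)
  qed
  have cova: "covector ?a = zco k" "covector (Suc ?a) = zcco k" using k by (auto simp: covector_def)
  have a: "?a < 4 * p" "Suc ?a < 4 * p" using k by auto
  \<comment> \<open>The position 2(k-1) of dz_k is even and that of dz_k^c is odd, hence one plus
    and one minus sign.\<close>
  have two: "(\<Sum>b<4*p. (-1) ^ b * c b * W b) = c ?a * W ?a - c (Suc ?a) * W (Suc ?a)"
    if "\<And>b. b < 4 * p \<Longrightarrow> b \<noteq> ?a \<Longrightarrow> b \<noteq> Suc ?a \<Longrightarrow> c b = 0" for c W :: "nat \<Rightarrow> complex"
  proof -
    have "(\<Sum>b<4*p. (-1) ^ b * c b * W b) = (\<Sum>b\<in>{?a, Suc ?a}. (-1) ^ b * c b * W b)"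
      by (rule sum.mono_neutral_right) (use a that in auto)
    thus ?thesis by simp
  qed
  have k': "2 * k - 1 \<in> {1..4*p}" "2 * k \<in> {1..4*p}" "2 * k \<noteq> 2 * k - 1" using k by auto
  have full': "(-4) ^ p * complex_of_real (flux M $ ix m)
      = zco k (axis (ix m) 1 :: 'n rvec) * hat_dz p k ?ws - zcco k (axis (ix m) 1 :: 'n rvec) * hat_dzc p k ?ws"
    if m: "m = 2 * k - 1 \<or> m = 2 * k" for m
    unfolding full hz hzc cova[symmetric] by (rule two) (rule cov0[OF _ _ _ m])
  have x: "(-4) ^ p * complex_of_real (flux M $ ix (2*k-1)) = hat_dz p k ?ws - hat_dzc p k ?ws"
    unfolding full'[OF disjI1[OF refl]] zax[OF k k'(1)] by (simp only: if_True refl mult_1)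
  have y: "(-4) ^ p * complex_of_real (flux M $ ix (2*k)) = \<i> * hat_dz p k ?ws + \<i> * hat_dzc p k ?ws"
    unfolding full'[OF disjI2[OF refl]] zax[OF k k'(2)] if_not_P[OF k'(3)]
    by (simp only: if_True refl mult_minus_left diff_minus_eq_add)
  have zz: "zco k (flux M) = complex_of_real (flux M $ ix (2*k-1)) + \<i> * complex_of_real (flux M $ ix (2*k))"
    "zcco k (flux M) = complex_of_real (flux M $ ix (2*k-1)) - \<i> * complex_of_real (flux M $ ix (2*k))"
    by (auto simp: zco_def zcco_def complex_eq_iff)
  \<comment> \<open>Adding -\<i> or \<i> times the second equation to the first isolates one hat
    form and produces the factor 2.\<close>
  have "(-4) ^ p * zcco k (flux M) = (-4) ^ p * complex_of_real (flux M $ ix (2*k-1)) - \<i> * ((-4) ^ p * complex_of_real (flux M $ ix (2*k)))"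
    "(-4) ^ p * zco k (flux M) = (-4) ^ p * complex_of_real (flux M $ ix (2*k-1)) + \<i> * ((-4) ^ p * complex_of_real (flux M $ ix (2*k)))"
    unfolding zz by (simp_all add: algebra_simps)
  hence "(-4) ^ p * zcco k (flux M) = 2 * hat_dz p k ?ws" "(-4) ^ p * zco k (flux M) = - 2 * hat_dzc p k ?ws"
    unfolding x y by (simp_all add: algebra_simps)
  hence "hat_dz p k ?ws = (-4) ^ p / 2 * zcco k (flux M)" "hat_dzc p k ?ws = - ((-4) ^ p / 2 * zco k (flux M))"
    by (simp_all add: eq_divide_eq_numeral1 mult.commute del: upt_Suc)
  thus "hat_dz p k (map (\<lambda>m. M $ ix m) [2..<CARD('n)+1]) = (-4) ^ p / 2 * zcco k (flux M)"
    "hat_dzc p k (map (\<lambda>m. M $ ix m) [2..<CARD('n)+1]) = - ((-4) ^ p / 2 * zco k (flux M))"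
    by (simp_all only: dim)
qed

section \<open>Radial integrals\<close>

lemma derivative_eq_0_on_open:
  fixes \<sigma> :: "real \<Rightarrow> real"
  assumes "(\<sigma> has_real_derivative s) (at t)" "open S" "t \<in> S" "\<And>t. t \<in> S \<Longrightarrow> \<sigma> t = c"
  shows "s = 0"
proof -
  have "((\<lambda>_. c) has_real_derivative 0) (at t)" by simp
  hence "(\<sigma> has_real_derivative 0) (at t)"
    by (rule has_field_derivative_transform_within_open[OF _ assms(2,3)]) (simp add: assms(4))
  with assms(1) show ?thesis by (rule DERIV_unique)
qed

text \<open>The sign makes the upper rays \<open>{x<..}\<close>, which generate the Borel sets, have finite measure.\<close>

lemma distr_norm_power:
  defines "V \<equiv> measure lborel (ball (0 :: real^'n::finite) 1)"
  shows "distr lborel borel (\<lambda>y::real^'n. - (norm y ^ CARD('n))) = density lborel (\<lambda>s. ennreal (V * indicator {..0} s))"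
proof (rule measure_eqI_lessThan)
  let ?M = "distr lborel borel (\<lambda>y::real^'n. - (norm y ^ CARD('n)))"
  have V: "V \<ge> 0" by (simp add: V_def)
  have less_iff: "s ^ CARD('n) < r ^ CARD('n) \<longleftrightarrow> s < r" if "0 \<le> s" "0 \<le> r" for s r :: real
    unfolding not_le[symmetric] using that by (simp add: power_mono_iff)
  have sub: "emeasure lborel {y::real^'n. norm y ^ CARD('n) < t} = ennreal (V * max 0 t)" for t
  proof (cases "0 < t")
    case True
    hence root: "root (CARD('n)) t ^ CARD('n) = t" "0 \<le> root (CARD('n)) t" by simp_all
    have iff: "norm y ^ CARD('n) < t \<longleftrightarrow> norm y < root (CARD('n)) t" for y :: "real^'n"
      using less_iff[OF norm_ge_zero root(2), of y] unfolding root(1) .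
    have "{y::real^'n. norm y ^ CARD('n) < t} = ball 0 (root (CARD('n)) t)"
      unfolding set_eq_iff mem_Collect_eq mem_ball iff by simp
    hence "emeasure lborel {y::real^'n. norm y ^ CARD('n) < t} = emeasure lborel (ball (0::real^'n) (root (CARD('n)) t))"
      by (rule arg_cong)
    also have "\<dots> = ennreal (unit_ball_vol (real CARD('n)) * root (CARD('n)) t ^ CARD('n))"
      using emeasure_ball[OF root(2), of "0 :: real^'n"] by simp
    also have "\<dots> = ennreal (V * max 0 t)"
      unfolding root(1) using True by (simp add: V_def content_ball)
    finally show ?thesis .
  next
    case False
    have "\<not> norm y ^ CARD('n) < t" for y :: "real^'n"
      using False zero_le_power[OF norm_ge_zero, of y "CARD('n)"] by linarith
    hence "{y::real^'n. norm y ^ CARD('n) < t} = {}" by blast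
    thus ?thesis using False by simp
  qed
  have M: "emeasure ?M {x<..} = ennreal (V * max 0 (- x))" for x
  proof -
    have "emeasure ?M {x<..} = emeasure lborel {y::real^'n. norm y ^ CARD('n) < - x}"
      by (subst emeasure_distr) (auto intro!: arg_cong[of _ _ "emeasure lborel"])
    thus ?thesis unfolding sub .
  qed
  show "emeasure ?M {x<..} < \<infinity>" for x unfolding M by simp
  show "emeasure ?M {x<..} = emeasure (density lborel (\<lambda>s. ennreal (V * indicator {..0} s))) {x<..}" for x
  proof -
    have "emeasure (density lborel (\<lambda>s. ennreal (V * indicator {..0} s))) {x<..}
      = (\<integral>\<^sup>+s. ennreal V * indicator {x<..0} s \<partial>lborel)"
      by (subst emeasure_density) (auto intro!: nn_integral_cong simp: indicator_def)
    also have "\<dots> = ennreal V * emeasure lborel {x<..0}"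
      by (rule nn_integral_cmult_indicator) auto
    also have "\<dots> = ennreal (V * max 0 (- x))"
      using V by (cases "x \<le> 0") (simp_all add: ennreal_mult[symmetric])
    finally show ?thesis unfolding M by simp
  qed
qed auto

text \<open>The variable -|y - X|^N has constant density V on the negative half-line, so the
  integral is V times the increase of \<sigma> from 0 to b, which is 1.\<close>

lemma integral_radial_step:
  fixes \<sigma> \<sigma>' :: "real \<Rightarrow> real" and X :: "real^'n::finite"
  assumes \<sigma>: "\<And>t. (\<sigma> has_real_derivative \<sigma>' t) (at t)" "continuous_on UNIV \<sigma>'"
    and ab: "0 \<le> a" "a < b" and const: "\<And>t. t \<le> a \<Longrightarrow> \<sigma> t = 0" "\<And>t. b \<le> t \<Longrightarrow> \<sigma> t = 1"
  shows "(LINT y|lborel. \<sigma>' (norm (y - X) ^ CARD('n))) = measure lborel (ball (0 :: real^'n) 1)"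
proof -
  let ?V = "measure lborel (ball (0 :: real^'n) 1)"
  have [measurable]: "\<sigma>' \<in> borel_measurable borel"
    by (rule borel_measurable_continuous_onI[OF \<sigma>(2)])
  have zero: "\<sigma>' t = 0" if "b < t" for t
    by (rule derivative_eq_0_on_open[OF \<sigma>(1), where S = "{b<..}" and c = 1]) (use that const(2) in auto)
  have "has_bochner_integral lborel (\<lambda>s. indicator {-b..0} s *\<^sub>R \<sigma>' (- s)) ((- \<sigma> (- 0)) - (- \<sigma> (- (- b))))"
  proof (rule has_bochner_integral_FTC_Icc)
    show "((\<lambda>s. - \<sigma> (- s)) has_vector_derivative \<sigma>' (- s)) (at s within {- b..0})" for s
    proof -
      have "(uminus has_real_derivative - 1) (at s)"
        by (auto intro!: derivative_eq_intros)
      from DERIV_minus[OF DERIV_chain2[OF \<sigma>(1) this]]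
      have "((\<lambda>s. - \<sigma> (- s)) has_real_derivative \<sigma>' (- s)) (at s)" by simp
      thus ?thesis
        unfolding has_real_derivative_iff_has_vector_derivative by (rule has_vector_derivative_at_within)
    qed
    show "continuous_on {- b..0} (\<lambda>s. \<sigma>' (- s))"
      by (rule continuous_on_compose2[OF \<sigma>(2)]) (auto intro!: continuous_intros)
  qed (use ab in simp)
  hence ftc: "(LINT s|lborel. indicator {-b..0} s *\<^sub>R \<sigma>' (- s)) = 1"
    using ab const by (simp add: has_bochner_integral_integral_eq)
  have "(LINT y|lborel. \<sigma>' (norm (y - X) ^ CARD('n))) = (LINT y|distr lborel borel ((+) X). \<sigma>' (norm (y - X) ^ CARD('n)))"
    by (simp add: lborel_distr_plus)
  also have "\<dots> = (LINT y|(lborel :: (real^'n) measure). \<sigma>' (norm y ^ CARD('n)))"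
    by (subst integral_distr) auto
  also have "\<dots> = (LINT s|distr lborel borel (\<lambda>y::real^'n. - (norm y ^ CARD('n))). \<sigma>' (- s))"
    by (subst integral_distr) auto
  also have "\<dots> = (LINT s|lborel. (?V * indicator {..0} s) *\<^sub>R \<sigma>' (- s))"
    unfolding distr_norm_power by (rule integral_density) auto
  also have "\<dots> = (LINT s|lborel. ?V * (indicator {-b..0} s *\<^sub>R \<sigma>' (- s)))"
    by (rule Bochner_Integration.integral_cong[OF refl]) (auto simp: indicator_def zero)
  also have "\<dots> = ?V" using ftc by simp
  finally show ?thesis .
qed

lemma measure_unit_ball_pos: "measure lborel (ball (0 :: real^'n::finite) 1) > 0"
  by (simp add: content_ball)

text \<open>The cone over the unit sphere is the closed unit ball minus its centre, and a point has
  measure zero.\<close>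

lemma sphere_measure_unit_sphere:
  "sphere_measure (sphere (0 :: real^'n::finite) 1) = real CARD('n) * measure lborel (ball (0 :: real^'n) 1)"
proof -
  have "{r *\<^sub>R x |r (x :: real^'n). 0 < r \<and> r \<le> 1 \<and> x \<in> sphere 0 1} = cball 0 1 - {0}"
  proof (intro equalityI subsetI)
    fix y :: "real^'n" assume "y \<in> cball 0 1 - {0}"
    hence "y = norm y *\<^sub>R (y /\<^sub>R norm y)" "0 < norm y" "norm y \<le> 1" "y /\<^sub>R norm y \<in> sphere 0 1" by auto
    thus "y \<in> {r *\<^sub>R x |r (x :: real^'n). 0 < r \<and> r \<le> 1 \<and> x \<in> sphere 0 1}" by blast
  qed auto
  moreover have "measure lborel (cball (0 :: real^'n) 1 - {0}) = measure lborel (cball (0 :: real^'n) 1)"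
    by (subst measure_Diff_null_set) (auto intro: finite_imp_null_set_lborel)
  ultimately show ?thesis
    by (simp add: sphere_measure_def content_ball content_cball)
qed

text \<open>\<open>k\<close> is a nonnegative kernel of total mass 1 supported in the ball, so the
  weighted mean of \<open>g\<close> stays within \<open>e\<close> of g X.\<close>

lemma integral_radial_approximation:
  fixes g :: "real^'n::finite \<Rightarrow> 'b::euclidean_space"
  assumes \<sigma>: "\<And>t. (\<sigma> has_real_derivative \<sigma>' t) (at t)" "continuous_on UNIV \<sigma>'" "\<And>t. 0 \<le> \<sigma>' t"
    and r: "0 < r" and const: "\<And>t. t \<le> r ^ CARD('n) / 2 \<Longrightarrow> \<sigma> t = 0" "\<And>t. r ^ CARD('n) \<le> t \<Longrightarrow> \<sigma> t = 1"
    and D: "cball X r \<subseteq> D" and g: "continuous_on (cball X r) g" "\<And>y. y \<in> cball X r \<Longrightarrow> norm (g y - g X) \<le> e"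
  defines "k \<equiv> \<lambda>y. \<sigma>' (norm (y - X) ^ CARD('n)) / measure lborel (ball (0 :: real^'n) 1)"
  shows "norm ((LINT y|lborel. indicator D y *\<^sub>R (k y *\<^sub>R g y)) - g X) \<le> e"
proof -
  let ?V = "measure lborel (ball (0 :: real^'n) 1)" and ?C = "cball X r"
  have k0: "0 \<le> k y" for y using \<sigma>(3) by (simp add: k_def)
  have kz: "k y = 0" if "y \<notin> ?C" for y
  proof -
    have "r ^ CARD('n) < norm (y - X) ^ CARD('n)"
      using that r by (intro power_strict_mono) (auto simp: dist_norm norm_minus_commute)
    hence "\<sigma>' (norm (y - X) ^ CARD('n)) = 0"
      by (intro derivative_eq_0_on_open[OF \<sigma>(1), where S = "{r ^ CARD('n)<..}" and c = 1]) (use const(2) in auto)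
    thus ?thesis by (simp add: k_def)
  qed
  have kc: "continuous_on UNIV k"
  proof -
    have "continuous_on UNIV (\<lambda>y. \<sigma>' (norm (y - X) ^ CARD('n)))"
      by (rule continuous_on_compose2[OF \<sigma>(2)]) (auto intro!: continuous_intros)
    thus ?thesis unfolding k_def using measure_unit_ball_pos[where 'n = 'n] by (intro continuous_on_divide) auto
  qed
  have indk: "indicator ?C y *\<^sub>R (k y *\<^sub>R z) = k y *\<^sub>R z" for y and z :: "'c::real_vector"
    using kz[of y] by (auto simp: indicator_def)
  have int: "integrable lborel (\<lambda>y. k y *\<^sub>R h y)" if "continuous_on ?C h" for h :: "real^'n \<Rightarrow> 'c::euclidean_space"
    using borel_integrable_compact[OF compact_cball continuous_on_scaleR[OF continuous_on_subset[OF kc subset_UNIV] that]]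
    unfolding indk .
  have "(LINT y|lborel. k y) = 1"
    unfolding k_def using integral_radial_step[OF \<sigma>(1,2), where X = X and a = "r ^ CARD('n) / 2" and b = "r ^ CARD('n)"] const r measure_unit_ball_pos[where 'n = 'n] by simp
  have "(LINT y|lborel. indicator D y *\<^sub>R (k y *\<^sub>R g y)) = (LINT y|lborel. k y *\<^sub>R g y)"
  proof (rule Bochner_Integration.integral_cong[OF refl])
    show "indicator D y *\<^sub>R (k y *\<^sub>R g y) = k y *\<^sub>R g y" for y
    proof (cases "y \<in> D")
      case False
      hence "y \<notin> ?C" using D by blast
      thus ?thesis using kz[of y] by simp
    qed simp
  qed
  moreover have "g X = (LINT y|lborel. k y *\<^sub>R g X)"
    using \<open>(LINT y|lborel. k y) = 1\<close> int[of "\<lambda>_. 1::real"] by simp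
  ultimately have "(LINT y|lborel. indicator D y *\<^sub>R (k y *\<^sub>R g y)) - g X = (LINT y|lborel. k y *\<^sub>R g y) - (LINT y|lborel. k y *\<^sub>R g X)"
    by simp
  also have "\<dots> = (LINT y|lborel. k y *\<^sub>R (g y - g X))"
    by (subst Bochner_Integration.integral_diff[symmetric]) (auto intro!: int g simp: scaleR_diff_right)
  also have "norm \<dots> \<le> (LINT y|lborel. k y *\<^sub>R e)"
  proof (rule Bochner_Integration.integral_norm_bound_integral)
    show "norm (k y *\<^sub>R (g y - g X)) \<le> k y *\<^sub>R e" for y
      using k0[of y] kz[of y] g(2)[of y] by (cases "y \<in> ?C") (auto intro: mult_left_mono)
    show "integrable lborel (\<lambda>y. k y *\<^sub>R (g y - g X))"
      by (rule int) (intro continuous_intros g)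
    show "integrable lborel (\<lambda>y. k y *\<^sub>R e)"
      by (rule int) (rule continuous_on_const)
  qed
  also have "\<dots> = e" using \<open>(LINT y|lborel. k y) = 1\<close> int[of "\<lambda>_. 1::real"] by simp
  finally show ?thesis .
qed

section \<open>Cauchy integral formulae\<close>

lemma
  fixes L :: "real^'n::finite \<Rightarrow> 'b::euclidean_space"
  assumes "linear L"
  shows Ck_on_1_linear_diff: "Ck_on 1 (\<lambda>x. L (x - X)) V"
    and pd_linear_diff: "pd i (\<lambda>x. L (x - X)) x = L (axis i 1)"
proof -
  have "bounded_linear L" using assms by (simp add: linear_conv_bounded_linear)
  hence d: "((\<lambda>x. L (x - X)) has_derivative L) (at x)" for x
    using bounded_linear.has_derivative[of L "\<lambda>x. x - X" "\<lambda>h. h" "at x"] has_derivative_diff[OF has_derivative_ident has_derivative_const, of X]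
    by simp
  show "Ck_on 1 (\<lambda>x. L (x - X)) V" by (rule Ck_on_1I[OF d]) simp
  show "pd i (\<lambda>x. L (x - X)) x = L (axis i 1)" by (rule pd_eqI[OF d])
qed

text \<open>Everything rests on \<open>H\<close>. At \<open>axis i 1\<close> it makes each
  \<partial>_i u_i equal to \<mu>; by linearity the contraction with x - X is \<mu> |x - X|^2. As
  \<kappa> is homogeneous of degree -2m = -N, its gradient contributes -N \<kappa> \<mu>, cancelling
  N \<kappa> \<mu> from the sum of the \<partial>_i u_i.\<close>

lemma
  fixes v w c d :: "'n::{finite,wellorder} rvec \<Rightarrow> 'n clifford" and A \<mu> :: real and m :: nat
  assumes lin: "linear v" "linear w" "linear c" "linear d"
    and H: "\<And>Z. v Z \<star> c Z + w Z \<star> d Z = (\<mu> * (Z \<bullet> Z)) *\<^sub>R cl_one"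
    and dim: "CARD('n) = 2 * m"
  defines "u \<equiv> \<lambda>X i x. v (x - X) \<star> c (axis i 1) + w (x - X) \<star> d (axis i 1)"
    and "\<kappa> \<equiv> \<lambda>X x. A / ((x - X) \<bullet> (x - X)) ^ m"
  shows Ck_on_1_kernel: "Ck_on 1 (\<lambda>x. \<kappa> X x *\<^sub>R u X i x) (- {X})"
    and divergence_kernel: "x \<noteq> X \<Longrightarrow> (\<Sum>i\<in>UNIV. pd i (\<lambda>x. \<kappa> X x *\<^sub>R u X i x) x) = 0"
    and radial_kernel: "(\<Sum>i\<in>UNIV. (x - X) $ i *\<^sub>R u X i x) = (\<mu> * ((x - X) \<bullet> (x - X))) *\<^sub>R cl_one"
proof -
  let ?q = "\<lambda>x. (x - X) \<bullet> (x - X)"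
  let ?L = "\<lambda>i Z. v Z \<star> c (axis i 1) + w Z \<star> d (axis i 1)"
  have L: "linear (?L i)" for i
    by (rule linearI) (simp_all add: linear_add[OF lin(1)] linear_add[OF lin(2)] linear_scale[OF lin(1)]
      linear_scale[OF lin(2)] cl_mult.add_left cl_mult.scaleR_left scaleR_add_right)
  have u: "Ck_on 1 (u X i) V" for i V
    unfolding u_def by (rule Ck_on_1_linear_diff[OF L])
  have pdu: "pd i (u X i) x = \<mu> *\<^sub>R cl_one" for i x
    unfolding u_def pd_linear_diff[OF L] H by (simp add: inner_axis)
  have q: "?q x \<in> {0<..}" if "x \<in> - {X}" for x using that by simp
  have h: "((\<lambda>t. A / t ^ m) has_real_derivative - (A * m / t ^ (m + 1))) (at t)" if "t \<in> {0<..}" for t :: real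
  proof -
    have "((\<lambda>t. A / t ^ m) has_real_derivative - A * (real m * t ^ (m - 1)) / (t ^ m * t ^ m)) (at t)"
      using that by (auto intro!: derivative_eq_intros)
    also have "- A * (real m * t ^ (m - 1)) / (t ^ m * t ^ m) = - (A * m / t ^ (m + 1))"
      using that by (cases m) (simp_all add: field_simps)
    finally show ?thesis .
  qed
  have hc: "continuous_on {0<..} (\<lambda>t. - (A * m / t ^ (m + 1)))"
    by (intro continuous_intros) auto
  note inner = Ck_on_1_inner_self[where P = X and V = "- {X}"]
  have \<kappa>: "Ck_on 1 (\<kappa> X) (- {X})"
    unfolding \<kappa>_def by (rule Ck_on_1_real_compose_on[OF h hc inner]) (use q in auto)
  have pd\<kappa>: "pd i (\<kappa> X) x = - (A * m / ?q x ^ (m + 1)) * (2 * (x - X) $ i)" if "x \<noteq> X" for i x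
    unfolding \<kappa>_def pd_inner_self[symmetric] by (rule pd_real_compose_on[OF h hc inner]) (use q that in auto)
  show "Ck_on 1 (\<lambda>x. \<kappa> X x *\<^sub>R u X i x) (- {X})"
    by (rule Ck_on_1_scaleR[OF \<kappa> u])
  show radial: "(\<Sum>i\<in>UNIV. (x - X) $ i *\<^sub>R u X i x) = (\<mu> * ?q x) *\<^sub>R cl_one" for x
  proof -
    have "(\<Sum>i\<in>UNIV. (x - X) $ i *\<^sub>R u X i x)
      = v (x - X) \<star> (\<Sum>i\<in>UNIV. (x - X) $ i *\<^sub>R c (axis i 1)) + w (x - X) \<star> (\<Sum>i\<in>UNIV. (x - X) $ i *\<^sub>R d (axis i 1))"
      by (simp add: u_def cl_mult.sum_right cl_mult.scaleR_right scaleR_add_right sum.distrib)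
    thus ?thesis unfolding linear_eq_sum_axis[OF lin(3), symmetric] linear_eq_sum_axis[OF lin(4), symmetric] H .
  qed
  show "(\<Sum>i\<in>UNIV. pd i (\<lambda>x. \<kappa> X x *\<^sub>R u X i x) x) = 0" if x: "x \<noteq> X"
  proof -
    have x': "x \<in> - {X}" using x by simp
    have "(\<Sum>i\<in>UNIV. pd i (\<lambda>x. \<kappa> X x *\<^sub>R u X i x) x)
      = (\<Sum>i\<in>UNIV. \<kappa> X x *\<^sub>R (\<mu> *\<^sub>R cl_one) + (- (A * m / ?q x ^ (m + 1)) * (2 * (x - X) $ i)) *\<^sub>R u X i x)"
      by (simp only: pd_scaleR[OF \<kappa> u x'] pdu pd\<kappa>[OF x])
    also have "\<dots> = real CARD('n) *\<^sub>R (\<kappa> X x *\<^sub>R (\<mu> *\<^sub>R cl_one))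
        + (- (2 * A * m / ?q x ^ (m + 1))) *\<^sub>R (\<Sum>i\<in>UNIV. (x - X) $ i *\<^sub>R u X i x)"
      unfolding sum.distrib scaleR_sum_right by (simp add: mult_ac sum_constant_scaleR del: sum_constant)
    also have "\<dots> = (real CARD('n) * \<kappa> X x * \<mu> - 2 * A * m / ?q x ^ (m + 1) * (\<mu> * ?q x)) *\<^sub>R cl_one"
      unfolding radial scaleR_scaleR scaleR_add_left[symmetric]
      by (rule arg_cong[of _ _ "\<lambda>r. r *\<^sub>R cl_one"]) (simp only: mult_minus_left mult.assoc diff_conv_add_uminus)
    also have "real CARD('n) * \<kappa> X x * \<mu> - 2 * A * m / ?q x ^ (m + 1) * (\<mu> * ?q x) = 0"
    proof -
      have "real (2 * m) * (A / s ^ m) * \<mu> - 2 * A * m / s ^ (m + 1) * (\<mu> * s) = 0" if "s > 0" for s :: real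
        using that by (simp add: field_simps)
      from this[of "?q x"] show ?thesis using x by (simp only: \<kappa>_def dim) simp
    qed
    finally show ?thesis by simp
  qed
qed

text \<open>The boundary integral does not depend on the cut-off radius, so an estimate for every
  \<open>e\<close> gives equality. The order of factors matters: by associativity \<open>c\<close>
  and \<open>d\<close> meet the derivatives of \<open>g\<close>, where monogenicity applies, while
  \<open>v\<close> and \<open>w\<close> stay outside the sum over directions.\<close>

theorem Cauchy_boundary_integral:
  fixes D U :: "'n::{finite,wellorder} rvec set" and v w c d g :: "'n rvec \<Rightarrow> 'n clifford"
  assumes D: "open D" "bounded D" "smooth_boundary D" and U: "open U" "closure D \<subseteq> U" and X: "X \<in> D"
    and g: "Ck_on 1 g U"
    and gc: "\<And>Y. Y \<in> U \<Longrightarrow> (\<Sum>i\<in>UNIV. c (axis i 1) \<star> pd i g Y) = 0"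
    and gd: "\<And>Y. Y \<in> U \<Longrightarrow> (\<Sum>i\<in>UNIV. d (axis i 1) \<star> pd i g Y) = 0"
    and lin: "linear v" "linear w" "linear c" "linear d"
    and H: "\<And>Z. v Z \<star> c Z + w Z \<star> d Z = (\<mu> * (Z \<bullet> Z)) *\<^sub>R cl_one"
    and dim: "CARD('n) = 2 * m"
    and \<omega>: "\<And>Y M. Y \<in> frontier D \<Longrightarrow> \<omega> Y (map (\<lambda>l. M $ ix l) [2..<CARD('n)+1]) =
      ((2 / sphere_measure (sphere (0 :: 'n rvec) 1) / norm (Y - X) ^ CARD('n)) *\<^sub>R
        (v (Y - X) \<star> c (flux M) + w (Y - X) \<star> d (flux M))) \<star> g Y"
  shows "boundary_integral D \<omega> = (2 * \<mu>) *\<^sub>R g X"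
proof -
  let ?A = "2 / sphere_measure (sphere (0 :: 'n rvec) 1)" and ?V = "measure lborel (ball (0 :: 'n rvec) 1)"
  let ?q = "\<lambda>x. (x - X) \<bullet> (x - X)"
  let ?u = "\<lambda>i x. v (x - X) \<star> c (axis i 1) + w (x - X) \<star> d (axis i 1)"
  let ?\<kappa> = "\<lambda>x. ?A / ?q x ^ m"
  let ?B = "\<lambda>i x. ?\<kappa> x *\<^sub>R ?u i x"
  have q_norm: "norm (x - X) ^ CARD('n) = ?q x ^ m" for x
    by (simp add: dim power_mult power2_norm_eq_inner)
  have m: "0 < m" using dim by (cases m) auto
  have XU: "X \<in> U" using X U(2) closure_subset[of D] by blast
  note kernel = Ck_on_1_kernel[OF lin H dim, of ?A X] divergence_kernel[OF lin H dim, where A = ?A and X = X] radial_kernel[OF lin H dim, where X = X]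
  have approx: "norm (boundary_integral D \<omega> - (2 * \<mu>) *\<^sub>R g X) \<le> \<bar>2 * \<mu>\<bar> * e" if e: "e > 0" for e
  proof -
    have "continuous_on U g" by (rule Ck_on_1_continuous_on[OF g])
    hence "isCont g X" using U(1) XU by (simp add: continuous_on_eq_continuous_at)
    then obtain s where s: "s > 0" "\<And>y. dist y X < s \<Longrightarrow> dist (g y) (g X) < e"
      using e unfolding continuous_at_eps_delta by blast
    obtain t where t: "t > 0" "cball X t \<subseteq> D" using D(1) X open_contains_cball by blast
    define r where "r = min (s / 2) t"
    have r: "r > 0" "cball X r \<subseteq> D" "\<And>y. y \<in> cball X r \<Longrightarrow> norm (g y - g X) \<le> e"
    proof -
      show "r > 0" using s t by (simp add: r_def)
      show "cball X r \<subseteq> D" using t(2) by (auto simp: r_def)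
      show "norm (g y - g X) \<le> e" if "y \<in> cball X r" for y
        using s(2)[of y] that s(1) unfolding dist_norm[symmetric] by (simp add: r_def dist_commute)
    qed
    have rN: "r ^ CARD('n) / 2 < r ^ CARD('n)" "0 < r ^ CARD('n) / 2" using r(1) by simp_all
    obtain \<sigma> \<sigma>' where \<sigma>: "\<And>t. (\<sigma> has_real_derivative \<sigma>' t) (at t)" "continuous_on UNIV \<sigma>'" "\<And>t. 0 \<le> \<sigma>' t"
      "\<And>t. t \<le> r ^ CARD('n) / 2 \<Longrightarrow> \<sigma> t = 0" "\<And>t. r ^ CARD('n) \<le> t \<Longrightarrow> \<sigma> t = 1"
      "\<And>t. 0 \<le> \<sigma> t" "\<And>t. \<sigma> t \<le> 1"
      by (rule ex_C1_step[OF rN(1)]) (rule that)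
    let ?\<psi> = "\<lambda>x. \<sigma> (?q x ^ m)"
    let ?F = "\<lambda>i x. ?\<psi> x *\<^sub>R (?B i x \<star> g x)"
    have h: "((\<lambda>t. \<sigma> (t ^ m)) has_real_derivative \<sigma>' (t ^ m) * (m * t ^ (m - 1))) (at t)" for t :: real
    proof -
      have "((\<lambda>t. t ^ m) has_real_derivative m * t ^ (m - 1)) (at t)" by (auto intro!: derivative_eq_intros)
      from DERIV_chain2[OF \<sigma>(1) this] show ?thesis .
    qed
    have hc: "continuous_on UNIV (\<lambda>t::real. \<sigma>' (t ^ m) * (m * t ^ (m - 1)))"
      by (intro continuous_on_mult continuous_on_compose2[OF \<sigma>(2)] continuous_intros) auto
    have \<psi>: "Ck_on 1 ?\<psi> V" for V
      by (rule Ck_on_1_real_compose[OF h hc Ck_on_1_inner_self])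
    have pd\<psi>: "pd i ?\<psi> x = \<sigma>' (?q x ^ m) * (m * ?q x ^ (m - 1)) * (2 * (x - X) $ i)" for i x
      using pd_real_compose[OF h hc Ck_on_1_inner_self[where P = X and V = UNIV] UNIV_I] by (simp add: pd_inner_self)
    \<comment> \<open>On this neighbourhood of the pole the cut-off field is 0, so it is C^1 on all
      of \<open>U\<close> although the kernel is singular at \<open>X\<close>.\<close>
    let ?W = "{x. ?q x ^ m < r ^ CARD('n) / 2}"
    have W: "open ?W" by (intro open_Collect_less continuous_intros)
    have XW: "X \<in> ?W" using rN(2) by (simp add: zero_power[OF m])
    have FW: "?F i x = 0" if "x \<in> ?W" for i x using that \<sigma>(4) by simp
    have V: "open (U - {X})" using U(1) by auto
    have B: "Ck_on 1 (?B i) (U - {X})" for i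
      by (rule Ck_on_1_subset[OF kernel(1)]) auto
    have g': "Ck_on 1 g (U - {X})" by (rule Ck_on_1_subset[OF g]) auto
    have Bg: "Ck_on 1 (\<lambda>x. ?B i x \<star> g x) (U - {X})" for i
      by (rule cl_mult.Ck_on_1_prod[OF B g'])
    have "Ck_on 1 (?F i) (U - {X})" for i
      by (rule Ck_on_1_scaleR[OF \<psi> Bg])
    moreover have "Ck_on 1 (?F i) ?W" for i
      using Ck_on_cong_open[OF W, of "?F i" "\<lambda>_. 0" 1] FW Ck_on_1_const[of "0 :: 'n clifford" ?W] by blast
    ultimately have "Ck_on 1 (?F i) (U - {X} \<union> ?W)" for i
      by (rule Ck_on_1_Un[OF V W])
    hence F: "Ck_on 1 (?F i) U" for i
      by (rule Ck_on_1_subset) (use XW in blast)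
    \<comment> \<open>The derivatives of \<open>g\<close> drop out by monogenicity and those of the
      kernel by its zero divergence; only the gradient of the cut-off survives.\<close>
    have div: "(\<Sum>i\<in>UNIV. pd i (?F i) y) = (2 * \<mu>) *\<^sub>R ((\<sigma>' (norm (y - X) ^ CARD('n)) / ?V) *\<^sub>R g y)" if y: "y \<in> U" for y
    proof (cases "y = X")
      case True
      have "pd i (?F i) y = 0" for i
        by (rule pd_eq_0[OF W]) (use XW True FW in auto)
      moreover have "\<sigma>' (norm (y - X) ^ CARD('n)) = 0"
        by (rule derivative_eq_0_on_open[OF \<sigma>(1), where S = "{..<r ^ CARD('n) / 2}" and c = 0])
           (use True rN(2) \<sigma>(4) in \<open>auto simp: zero_power\<close>)
      ultimately show ?thesis by simp
    next
      case False
      hence y': "y \<in> U - {X}" using y by simp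
      have qy: "?q y > 0" using False by simp
      have 1: "(\<Sum>i\<in>UNIV. ?B i y \<star> pd i g y) = 0"
      proof -
        have "(\<Sum>i\<in>UNIV. ?B i y \<star> pd i g y) = ?\<kappa> y *\<^sub>R (v (y - X) \<star> (\<Sum>i\<in>UNIV. c (axis i 1) \<star> pd i g y)
          + w (y - X) \<star> (\<Sum>i\<in>UNIV. d (axis i 1) \<star> pd i g y))"
          by (simp add: cl_mult.scaleR_left cl_mult.add_left cl_mult_assoc cl_mult.sum_right scaleR_add_right
              scaleR_sum_right sum.distrib)
        thus ?thesis by (simp add: gc[OF y] gd[OF y] cl_mult.zero_right)
      qed
      have 2: "(\<Sum>i\<in>UNIV. pd i (?B i) y \<star> g y) = 0"
        unfolding cl_mult.sum_left[symmetric] kernel(2)[OF False] cl_mult.zero_left ..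
      have 3: "(\<Sum>i\<in>UNIV. pd i ?\<psi> y *\<^sub>R (?B i y \<star> g y)) = (2 * \<mu>) *\<^sub>R ((\<sigma>' (norm (y - X) ^ CARD('n)) / ?V) *\<^sub>R g y)"
      proof -
        have "(\<Sum>i\<in>UNIV. pd i ?\<psi> y *\<^sub>R (?B i y \<star> g y))
          = (\<sigma>' (?q y ^ m) * (m * ?q y ^ (m - 1)) * 2 * ?\<kappa> y) *\<^sub>R ((\<Sum>i\<in>UNIV. (y - X) $ i *\<^sub>R ?u i y) \<star> g y)"
          unfolding pd\<psi> cl_mult.sum_left scaleR_sum_right
          by (intro sum.cong refl) (simp only: cl_mult.scaleR_left scaleR_scaleR mult_ac)
        also have "\<dots> = (\<sigma>' (?q y ^ m) * (m * ?q y ^ (m - 1)) * 2 * ?\<kappa> y * (\<mu> * ?q y)) *\<^sub>R g y"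
          unfolding kernel(3) by (simp only: cl_mult.scaleR_left cl_one_mult scaleR_scaleR)
        also have "\<sigma>' (?q y ^ m) * (m * ?q y ^ (m - 1)) * 2 * ?\<kappa> y * (\<mu> * ?q y)
          = 2 * \<mu> * (\<sigma>' (norm (y - X) ^ CARD('n)) / ?V)"
        proof -
          have "?q y ^ (m - 1) * ?q y = ?q y ^ m" using m by (cases m) auto
          hence e1: "?q y ^ (m - 1) * ?q y / ?q y ^ m = 1" using qy by simp
          \<comment> \<open>The area of the unit sphere is N times the volume of the unit ball, and
            N = 2m.\<close>
          have e2: "real m * 2 * ?A = 2 / ?V"
            using m unfolding sphere_measure_unit_sphere dim by simp
          have e3: "\<sigma>' (?q y ^ m) * (m * ?q y ^ (m - 1)) * 2 * ?\<kappa> y * (\<mu> * ?q y)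
            = \<sigma>' (?q y ^ m) * \<mu> * (real m * 2 * ?A) * (?q y ^ (m - 1) * ?q y / ?q y ^ m)" by simp
          show ?thesis unfolding e3 e1 e2 q_norm by simp
        qed
        finally show ?thesis by simp
      qed
      have "pd i (?F i) y = ?\<psi> y *\<^sub>R (?B i y \<star> pd i g y + pd i (?B i) y \<star> g y) + pd i ?\<psi> y *\<^sub>R (?B i y \<star> g y)" for i
        unfolding pd_scaleR[OF \<psi> Bg y'] cl_mult.pd_prod[OF B g' y'] ..
      hence "(\<Sum>i\<in>UNIV. pd i (?F i) y) = ?\<psi> y *\<^sub>R ((\<Sum>i\<in>UNIV. ?B i y \<star> pd i g y) + (\<Sum>i\<in>UNIV. pd i (?B i) y \<star> g y))
        + (\<Sum>i\<in>UNIV. pd i ?\<psi> y *\<^sub>R (?B i y \<star> g y))"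
        by (simp only: sum.distrib scaleR_sum_right[symmetric])
      thus ?thesis unfolding 1 2 3 by simp
    qed
    have "\<omega> Y (map (\<lambda>l. M $ ix l) [2..<CARD('n)+1]) = (\<Sum>i\<in>UNIV. det (replace_row (ix 1) (axis i 1) M) *\<^sub>R ?F i Y)"
      if Y: "Y \<in> frontier D" for Y M
    proof -
      \<comment> \<open>Frontier points of the open set \<open>D\<close> avoid the ball outside of
        which the step is already 1.\<close>
      have "Y \<notin> D" using Y D(1) by (simp add: frontier_def interior_open)
      hence "Y \<notin> cball X r" using r(2) by blast
      hence "r ^ CARD('n) \<le> norm (Y - X) ^ CARD('n)"
        using r(1) by (intro power_mono) (simp_all add: dist_norm norm_minus_commute)
      hence \<psi>1: "?\<psi> Y = 1" unfolding q_norm by (rule \<sigma>(5))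
      have "(\<Sum>i\<in>UNIV. det (replace_row (ix 1) (axis i 1) M) *\<^sub>R ?F i Y)
        = (?\<kappa> Y *\<^sub>R (\<Sum>i\<in>UNIV. flux M $ i *\<^sub>R ?u i Y)) \<star> g Y"
        unfolding \<psi>1 by (simp add: flux_def scaleR_sum_right cl_mult.sum_left cl_mult.scaleR_left mult.commute)
      also have "(\<Sum>i\<in>UNIV. flux M $ i *\<^sub>R ?u i Y) = v (Y - X) \<star> (\<Sum>i\<in>UNIV. flux M $ i *\<^sub>R c (axis i 1))
        + w (Y - X) \<star> (\<Sum>i\<in>UNIV. flux M $ i *\<^sub>R d (axis i 1))"
        by (simp add: cl_mult.sum_right cl_mult.scaleR_right scaleR_add_right sum.distrib)
      finally show ?thesis
        unfolding linear_eq_sum_axis[OF lin(3), symmetric] linear_eq_sum_axis[OF lin(4), symmetric] \<omega>[OF Y] q_norm by simp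
    qed
    from boundary_integral_eq_divergence[OF D U F this]
    have "boundary_integral D \<omega> = (LINT y|lborel. indicator D y *\<^sub>R (\<Sum>i\<in>UNIV. pd i (?F i) y))" .
    also have "\<dots> = (LINT y|lborel. (2 * \<mu>) *\<^sub>R (indicator D y *\<^sub>R ((\<sigma>' (norm (y - X) ^ CARD('n)) / ?V) *\<^sub>R g y)))"
    proof (rule Bochner_Integration.integral_cong[OF refl])
      fix y
      show "indicator D y *\<^sub>R (\<Sum>i\<in>UNIV. pd i (?F i) y) = (2 * \<mu>) *\<^sub>R (indicator D y *\<^sub>R ((\<sigma>' (norm (y - X) ^ CARD('n)) / ?V) *\<^sub>R g y))"
      proof (cases "y \<in> D")
        case True
        hence "y \<in> U" using U(2) closure_subset[of D] by blast
        from div[OF this] show ?thesis using True by simp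
      qed simp
    qed
    also have "\<dots> = (2 * \<mu>) *\<^sub>R (LINT y|lborel. indicator D y *\<^sub>R ((\<sigma>' (norm (y - X) ^ CARD('n)) / ?V) *\<^sub>R g y))"
      by (rule integral_scaleR_right)
    finally have "boundary_integral D \<omega> - (2 * \<mu>) *\<^sub>R g X = (2 * \<mu>) *\<^sub>R
      ((LINT y|lborel. indicator D y *\<^sub>R ((\<sigma>' (norm (y - X) ^ CARD('n)) / ?V) *\<^sub>R g y)) - g X)"
      by (simp only: scaleR_diff_right)
    moreover have "norm ((LINT y|lborel. indicator D y *\<^sub>R ((\<sigma>' (norm (y - X) ^ CARD('n)) / ?V) *\<^sub>R g y)) - g X) \<le> e"
    proof -
      have "cball X r \<subseteq> U" using r(2) U(2) closure_subset[of D] by blast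
      hence cont: "continuous_on (cball X r) g" by (rule continuous_on_subset[OF Ck_on_1_continuous_on[OF g]])
      show ?thesis
        by (rule integral_radial_approximation[OF \<sigma>(1-3) r(1) \<sigma>(4,5) r(2) cont r(3)])
    qed
    ultimately show ?thesis by (simp only: norm_scaleR) (rule mult_left_mono, auto)
  qed
  have "norm (boundary_integral D \<omega> - (2 * \<mu>) *\<^sub>R g X) \<le> 0"
  proof (rule field_le_epsilon)
    fix e :: real assume "e > 0"
    \<comment> \<open>The 1 in the denominator covers the case \<mu> = 0.\<close>
    hence "norm (boundary_integral D \<omega> - (2 * \<mu>) *\<^sub>R g X) \<le> \<bar>2 * \<mu>\<bar> * (e / (\<bar>2 * \<mu>\<bar> + 1))"
      by (intro approx) (simp add: add_nonneg_pos)
    also have "\<dots> \<le> e" using \<open>e > 0\<close> by (simp add: field_simps)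
    finally show "norm (boundary_integral D \<omega> - (2 * \<mu>) *\<^sub>R g X) \<le> 0 + e" by simp
  qed
  thus ?thesis by simp
qed

text \<open>The minus sign in front of the daggered forms cancels the one of \<open>hat_dzc\<close>,
  so all four carry the same factor. Omitting dz_k leaves a conjugated coefficient, whence each form
  is the conjugate type of normal vector.\<close>

lemma
  fixes M :: "'n::{finite,wellorder} rmat"
  assumes dim: "CARD('n) = 4 * p"
  defines "ws \<equiv> map (\<lambda>m. M $ ix m) [2..<CARD('n)+1]"
  shows dsig_eq: "dsig p ws = ((-4) ^ p / 2) *\<^sub>R vecv_d p (flux M)"
    and dsig_d_eq: "dsig_d p ws = ((-4) ^ p / 2) *\<^sub>R vecv p (flux M)"
    and dsig_J_eq: "dsig_J p ws = ((-4) ^ p / 2) *\<^sub>R vecv_dJ p (flux M)"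
    and dsig_dJ_eq: "dsig_dJ p ws = ((-4) ^ p / 2) *\<^sub>R vecv_J p (flux M)"
proof -
  let ?s = "(-4) ^ p / 2 :: complex"
  have s: "complex_of_real ((-4) ^ p / 2) = ?s" by simp
  have hz: "hat_dz p k ws *s a = ?s *s (zcco k (flux M) *s a)" "hat_dzc p k ws *s a = - (?s *s (zco k (flux M) *s a))"
    if "k \<in> {1..2*p}" for k and a :: "'n clifford"
    unfolding ws_def hat_dz_eq[OF dim that] hat_dzc_eq[OF dim that] by (simp_all add: vec_eq_iff)
  have pair: "2 * j \<in> {1..2*p}" "2 * j - 1 \<in> {1..2*p}" if "j \<in> {1..p}" for j
    using that by auto
  have sum: "?s *s (\<Sum>k\<in>A. f k) = (\<Sum>k\<in>A. ?s *s f k)" for A :: "nat set" and f :: "nat \<Rightarrow> 'n clifford"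
    by (simp add: vec_eq_iff sum_distrib_left)
  show "dsig p ws = ((-4) ^ p / 2) *\<^sub>R vecv_d p (flux M)"
    unfolding dsig_def vecv_d_def scaleR_eq_vector_scalar s sum by (intro sum.cong refl hz)
  show "dsig_d p ws = ((-4) ^ p / 2) *\<^sub>R vecv p (flux M)"
    unfolding dsig_d_def vecv_def scaleR_eq_vector_scalar s sum sum_negf[symmetric]
    by (intro sum.cong refl) (simp only: hz minus_minus)
  show "dsig_J p ws = ((-4) ^ p / 2) *\<^sub>R vecv_dJ p (flux M)"
    unfolding dsig_J_def vecv_dJ_def scaleR_eq_vector_scalar s sum
    by (intro sum.cong refl) (simp only: hz[OF pair(1)] hz[OF pair(2)] vector_sub_rdistrib vector_ssub_ldistrib)
  show "dsig_dJ p ws = ((-4) ^ p / 2) *\<^sub>R vecv_J p (flux M)"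
    unfolding dsig_dJ_def vecv_J_def scaleR_eq_vector_scalar s sum sum_negf[symmetric]
    by (intro sum.cong refl) (simp add: hz[OF pair(1)] hz[OF pair(2)] vector_ssub_ldistrib del: One_nat_def)
qed

text \<open>The factor (-4)^p / 2 is absorbed into \<open>c\<close> and \<open>d\<close> and thus
  multiplies \<mu>; the 2 of the Cauchy formula turns it into (-4)^p \<mu>.\<close>

lemma kernel_boundary_integral:
  fixes D U :: "'n::{finite,wellorder} rvec set" and v w c d g :: "'n rvec \<Rightarrow> 'n clifford"
  assumes dim: "CARD('n) = 4 * p"
    and D: "open D" "bounded D" "smooth_boundary D" and U: "open U" "closure D \<subseteq> U" and X: "X \<in> D"
    and g: "Ck_on 1 g U"
    and gc: "\<And>Y. Y \<in> U \<Longrightarrow> (\<Sum>i\<in>UNIV. c (axis i 1) \<star> pd i g Y) = 0"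
    and gd: "\<And>Y. Y \<in> U \<Longrightarrow> (\<Sum>i\<in>UNIV. d (axis i 1) \<star> pd i g Y) = 0"
    and lin: "linear v" "linear w" "linear c" "linear d"
    and H: "\<And>Z. v Z \<star> c Z + w Z \<star> d Z = (\<mu> * (norm Z)\<^sup>2) *\<^sub>R cl_one"
    and \<sigma>: "\<And>M. \<sigma> (map (\<lambda>m. M $ ix m) [2..<CARD('n)+1]) = ((-4) ^ p / 2) *\<^sub>R c (flux M)"
    and \<tau>: "\<And>M. \<tau> (map (\<lambda>m. M $ ix m) [2..<CARD('n)+1]) = ((-4) ^ p / 2) *\<^sub>R d (flux M)"
  shows "boundary_integral D (\<lambda>Y ws. ((kernel_coeff p (Y - X) *\<^sub>R v (Y - X)) \<star> \<sigma> ws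
      + (kernel_coeff p (Y - X) *\<^sub>R w (Y - X)) \<star> \<tau> ws) \<star> g Y) = ((-4) ^ p * \<mu>) *\<^sub>R g X"
proof -
  let ?s = "(-4) ^ p / 2 :: real"
  have "boundary_integral D (\<lambda>Y ws. ((kernel_coeff p (Y - X) *\<^sub>R v (Y - X)) \<star> \<sigma> ws
      + (kernel_coeff p (Y - X) *\<^sub>R w (Y - X)) \<star> \<tau> ws) \<star> g Y) = (2 * (?s * \<mu>)) *\<^sub>R g X"
  proof (rule Cauchy_boundary_integral[OF D U X g, where v = v and w = w and c = "\<lambda>Z. ?s *\<^sub>R c Z" and d = "\<lambda>Z. ?s *\<^sub>R d Z" and m = "2 * p"])
    show "(\<Sum>i\<in>UNIV. (?s *\<^sub>R c (axis i 1)) \<star> pd i g Y) = 0" "(\<Sum>i\<in>UNIV. (?s *\<^sub>R d (axis i 1)) \<star> pd i g Y) = 0" if "Y \<in> U" for Y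
      unfolding cl_mult.scaleR_left scaleR_sum_right[symmetric] gc[OF that] gd[OF that] by simp_all
    show "linear (\<lambda>Z. ?s *\<^sub>R c Z)" "linear (\<lambda>Z. ?s *\<^sub>R d Z)"
      using lin(3,4) by (auto intro: linear_compose_scale_right)
    show "v Z \<star> (?s *\<^sub>R c Z) + w Z \<star> (?s *\<^sub>R d Z) = (?s * \<mu> * (Z \<bullet> Z)) *\<^sub>R cl_one" for Z
      unfolding cl_mult.scaleR_right scaleR_add_right[symmetric] H by (simp add: power2_norm_eq_inner)
    show "((kernel_coeff p (Y - X) *\<^sub>R v (Y - X)) \<star> \<sigma> (map (\<lambda>m. M $ ix m) [2..<CARD('n)+1])
      + (kernel_coeff p (Y - X) *\<^sub>R w (Y - X)) \<star> \<tau> (map (\<lambda>m. M $ ix m) [2..<CARD('n)+1])) \<star> g Y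
      = ((2 / sphere_measure (sphere (0 :: 'n rvec) 1) / norm (Y - X) ^ CARD('n)) *\<^sub>R
        (v (Y - X) \<star> (?s *\<^sub>R c (flux M)) + w (Y - X) \<star> (?s *\<^sub>R d (flux M)))) \<star> g Y" for Y M
      unfolding \<sigma> \<tau> unfolding kernel_coeff_def znorm_eq_norm[OF dim] cl_mult.scaleR_left scaleR_add_right dim ..
  qed (use lin dim in auto)
  thus ?thesis by simp
qed

theorem corollary1:
  fixes p :: nat
    and D U :: "'n::{finite,wellorder} rvec set"
    and g :: "'n rvec \<Rightarrow> 'n clifford"
  assumes dim: "CARD('n) = 4 * p"
    and domain: "open D" "connected D" "bounded D"
    and boundary: "smooth_boundary D"
    and nbhd: "open U" "closure D \<subseteq> U"
    and g: "quat_monogenic p U g"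
  shows "\<forall>X\<in>interior D.
    g X = (1 / (-4) ^ p) *\<^sub>R boundary_integral D (\<lambda>Y ws.
      (kerE p (Y - X) \<star> dsig p ws + kerE_d p (Y - X) \<star> dsig_d p ws) \<star> g Y) \<and>
    g X = (1 / (-4) ^ p) *\<^sub>R boundary_integral D (\<lambda>Y ws.
      (kerE_J p (Y - X) \<star> dsig_J p ws + kerE_dJ p (Y - X) \<star> dsig_dJ p ws) \<star> g Y) \<and>
    boundary_integral D (\<lambda>Y ws.
      (kerE p (Y - X) \<star> dsig_d p ws + kerE_d p (Y - X) \<star> dsig p ws) \<star> g Y) = 0 \<and>
    boundary_integral D (\<lambda>Y ws.
      (kerE_J p (Y - X) \<star> dsig_dJ p ws + kerE_dJ p (Y - X) \<star> dsig_J p ws) \<star> g Y) = 0"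
proof
  fix X assume "X \<in> interior D"
  hence X: "X \<in> D" using interior_subset by blast
  have C1: "Ck_on 1 g U" and mono: "\<And>Y. Y \<in> U \<Longrightarrow> dirac p g Y = 0" "\<And>Y. Y \<in> U \<Longrightarrow> dirac_d p g Y = 0"
    "\<And>Y. Y \<in> U \<Longrightarrow> dirac_J p g Y = 0" "\<And>Y. Y \<in> U \<Longrightarrow> dirac_dJ p g Y = 0"
    using g unfolding quat_monogenic_def by blast+
  have null: "(\<Sum>i\<in>UNIV. vecv_d p (axis i 1) \<star> pd i g Y) = 0" "(\<Sum>i\<in>UNIV. vecv p (axis i 1) \<star> pd i g Y) = 0"
    "(\<Sum>i\<in>UNIV. vecv_dJ p (axis i 1) \<star> pd i g Y) = 0" "(\<Sum>i\<in>UNIV. vecv_J p (axis i 1) \<star> pd i g Y) = 0"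
    if "Y \<in> U" for Y
    unfolding sum_vecv_d_pd sum_vecv_pd sum_vecv_dJ_pd sum_vecv_J_pd mono[OF that] by simp_all
  note K = kernel_boundary_integral[OF dim domain(1,3) boundary nbhd X C1]
  note lin = linear_vecv[of p]
  \<comment> \<open>Here \<open>c\<close> and \<open>d\<close> are the conjugate partners of
    \<open>v\<close> and \<open>w\<close>, so the required identity is the Witt relation with \<mu>
    = 1.\<close>
  have "boundary_integral D (\<lambda>Y ws. (kerE p (Y - X) \<star> dsig p ws + kerE_d p (Y - X) \<star> dsig_d p ws) \<star> g Y) = ((-4) ^ p * 1) *\<^sub>R g X"
    unfolding kerE_def kerE_d_def
    by (rule K[OF null(1,2) lin(1,2,2,1) _ dsig_eq[OF dim] dsig_d_eq[OF dim]]) (simp_all add: vecv_vecv_d[OF dim])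
  moreover have "boundary_integral D (\<lambda>Y ws. (kerE_J p (Y - X) \<star> dsig_J p ws + kerE_dJ p (Y - X) \<star> dsig_dJ p ws) \<star> g Y) = ((-4) ^ p * 1) *\<^sub>R g X"
    unfolding kerE_J_def kerE_dJ_def
    by (rule K[OF null(3,4) lin(3,4,4,3) _ dsig_J_eq[OF dim] dsig_dJ_eq[OF dim]]) (simp_all add: vecv_J_vecv_dJ[OF dim])
  \<comment> \<open>Exchanging \<open>c\<close> and \<open>d\<close> leaves only squares of
    isotropic variables, so \<mu> = 0.\<close>
  moreover have "boundary_integral D (\<lambda>Y ws. (kerE p (Y - X) \<star> dsig_d p ws + kerE_d p (Y - X) \<star> dsig p ws) \<star> g Y) = ((-4) ^ p * 0) *\<^sub>R g X"
    unfolding kerE_def kerE_d_def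
    by (rule K[OF null(2,1) lin(1,2,1,2) _ dsig_d_eq[OF dim] dsig_eq[OF dim]]) (simp_all add: vecv_square[OF dim] vecv_d_square[OF dim])
  moreover have "boundary_integral D (\<lambda>Y ws. (kerE_J p (Y - X) \<star> dsig_dJ p ws + kerE_dJ p (Y - X) \<star> dsig_J p ws) \<star> g Y) = ((-4) ^ p * 0) *\<^sub>R g X"
    unfolding kerE_J_def kerE_dJ_def
    by (rule K[OF null(4,3) lin(3,4,3,4) _ dsig_dJ_eq[OF dim] dsig_J_eq[OF dim]]) (simp_all add: vecv_J_square[OF dim] vecv_dJ_square[OF dim])
  ultimately show "g X = (1 / (-4) ^ p) *\<^sub>R boundary_integral D (\<lambda>Y ws.
      (kerE p (Y - X) \<star> dsig p ws + kerE_d p (Y - X) \<star> dsig_d p ws) \<star> g Y) \<and>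
    g X = (1 / (-4) ^ p) *\<^sub>R boundary_integral D (\<lambda>Y ws.
      (kerE_J p (Y - X) \<star> dsig_J p ws + kerE_dJ p (Y - X) \<star> dsig_dJ p ws) \<star> g Y) \<and>
    boundary_integral D (\<lambda>Y ws.
      (kerE p (Y - X) \<star> dsig_d p ws + kerE_d p (Y - X) \<star> dsig p ws) \<star> g Y) = 0 \<and>
    boundary_integral D (\<lambda>Y ws.
      (kerE_J p (Y - X) \<star> dsig_dJ p ws + kerE_dJ p (Y - X) \<star> dsig_J p ws) \<star> g Y) = 0"
    by simp
qed

end
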